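(* Let $W$ be a graphon, let $H$ be a finite simple graph with $|V(H)|\ge2$, let $G_n\sim G(n,W)$, and let $$R(H,G_n)=\sum_{1\le a,b\le|V(H)|}\hat t\Big(H\oplus_{a,b}H,G_n\Big)-|V(H)|^2\,\hat t(H,G_n)^2.$$ Then, as $n\to\infty$: (1) if $W$ is $H$-regular, then $\sqrt n\,R(H,G_n)\to0$ in probability; (2) if $W$ is not $H$-regular, then $\sqrt n\,R(H,G_n)\to\infty$ in probability.
   Context: A graphon is a measurable symmetric function $W:[0,1]^2\to[0,1]$. $G(n,W)$ is the random graph on $\{1,\dots,n\}$ obtained from independent i.i.d. $U[0,1]$ families $(U_i)_{i\le n}$ and $(Y_{ij})_{i<j\le n}$ by putting the edge $(i,j)$ iff $Y_{ij}\le W(U_i,U_j)$. Graphs have vertex set $V(H)=\{1,\dots,|V(H)|\}$. $t(H,W)=\int_{[0,1]^{|V(H)|}}\prod_{(a,b)\in E(H)}W(x_a,x_b)\prod_a\mathrm dx_a$, and $t_a(x,H,W)=\mathbb E[\prod_{(c,d)\in E(H)}W(U_c,U_d)\mid U_a=x]$. $W$ is $H$-regular if $\frac1{|V(H)|}\sum_{a=1}^{|V(H)|}t_a(x,H,W)=t(H,W)$ for almost every $x\in[0,1]$. For a finite simple graph $F$, $X(F,G_n)$ is the number of unlabelled (not necessarily induced) copies of $F$ in $G_n$, $(n)_k=n(n-1)\cdots(n-k+1)$, and $\hat t(F,G_n)=\frac{|\mathrm{Aut}(F)|}{(n)_{|V(F)|}}X(F,G_n)$, where $\mathrm{Aut}(F)$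 is the automorphism group. The vertex join $H\oplus_{a,b}H$ is the graph obtained from two disjoint copies of $H$ by identifying vertex $a$ of the first copy with vertex $b$ of the second. *)

theory Defs
  imports "HOL-Probability.Probability" "HOL-Combinatorics.Permutations"
begin

section \<open>Finite simple graphs\<close>

datatype 'v sgraph = SGraph (verts: "'v set") (edges: "'v set set")

definition simple_graph :: "'v sgraph \<Rightarrow> bool" where
  "simple_graph H \<longleftrightarrow> finite (verts H) \<and> (\<forall>e\<in>edges H. e \<subseteq> verts H \<and> card e = 2)"

definition subgraph :: "'v sgraph \<Rightarrow> 'v sgraph \<Rightarrow> bool" where
  "subgraph S G \<longleftrightarrow> simple_graph S \<and> verts S \<subseteq> verts G \<and> edges S \<subseteq> edges G"

definition isomorphic :: "'u sgraph \<Rightarrow> 'v sgraph \<Rightarrow> bool" where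
  "isomorphic F S \<longleftrightarrow>
     (\<exists>f. bij_betw f (verts F) (verts S) \<and> (\<lambda>e. f ` e) ` edges F = edges S)"

definition Aut :: "'v sgraph \<Rightarrow> ('v \<Rightarrow> 'v) set" where
  "Aut F = {p. p permutes verts F \<and> (\<lambda>e. p ` e) ` edges F = edges F}"

text \<open>Subgraphs are pairs of a vertex set and an edge set, so that isolated vertices of \<open>F\<close>
  are part of a copy of \<open>F\<close>.\<close>

definition num_copies :: "'u sgraph \<Rightarrow> 'v sgraph \<Rightarrow> nat" where
  "num_copies F G = card {S. subgraph S G \<and> isomorphic F S}"

definition falling_fact :: "nat \<Rightarrow> nat \<Rightarrow> real" where
  "falling_fact n k = (\<Prod>i<k. real n - real i)"

text \<open>If \<open>G\<close> has fewer vertices than \<open>F\<close>, the falling factorial vanishes and \<open>t_hat F G = 0\<close>.\<close>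

definition t_hat :: "'u sgraph \<Rightarrow> 'v sgraph \<Rightarrow> real" where
  "t_hat F G = real (card (Aut F)) / falling_fact (card (verts G)) (card (verts F))
               * real (num_copies F G)"

text \<open>The two disjoint copies are tagged by \<open>Inl\<close> and \<open>Inr\<close>; vertex \<open>b\<close> of the second copy is
  replaced by vertex \<open>a\<close> of the first. The vertices are not renamed to an initial segment of the
  positive integers, since \<open>t_hat\<close> only depends on the isomorphism type of its first argument.\<close>

definition vertex_join :: "'u sgraph \<Rightarrow> 'u \<Rightarrow> 'v \<Rightarrow> 'v sgraph \<Rightarrow> ('u + 'v) sgraph" where
  "vertex_join H1 a b H2 =
     (let \<phi> = (\<lambda>v. if v = b then Inl a else Inr v)
      in SGraph (Inl ` verts H1 \<union> \<phi> ` verts H2)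
                ((\<lambda>e. Inl ` e) ` edges H1 \<union> (\<lambda>e. \<phi> ` e) ` edges H2))"

section \<open>Graphons\<close>

text \<open>The uniform distribution on the unit interval, with underlying space the interval itself.\<close>

definition U01 :: "real measure" where
  "U01 = restrict_space lborel {0..1}"

text \<open>Only the values of \<open>W\<close> on the unit square matter; measurability is Borel measurability.\<close>

definition graphon :: "(real \<Rightarrow> real \<Rightarrow> real) \<Rightarrow> bool" where
  "graphon W \<longleftrightarrow>
     (\<lambda>(x, y). W x y) \<in> borel_measurable (U01 \<Otimes>\<^sub>M U01) \<and>
     (\<forall>x\<in>{0..1}. \<forall>y\<in>{0..1}. W x y = W y x \<and> 0 \<le> W x y \<and> W x y \<le> 1)"

text \<open>Each undirected edge contributes one factor, through its increasing orientation.\<close>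

definition edge_prod :: "'v::linorder sgraph \<Rightarrow> (real \<Rightarrow> real \<Rightarrow> real) \<Rightarrow> ('v \<Rightarrow> real) \<Rightarrow> real" where
  "edge_prod H W x = (\<Prod>(c, d)\<in>{(c, d). c < d \<and> {c, d} \<in> edges H}. W (x c) (x d))"

definition hom_density :: "'v::linorder sgraph \<Rightarrow> (real \<Rightarrow> real \<Rightarrow> real) \<Rightarrow> real" where
  "hom_density H W = (LINT x | (\<Pi>\<^sub>M a\<in>verts H. U01). edge_prod H W x)"

text \<open>The conditional expectation of \<open>edge_prod H W\<close> at independent uniform variables, given that
  the \<open>a\<close>-th variable equals \<open>x\<close>: the remaining variables are integrated out. The fact
  \<open>real_cond_exp_edge_prod\<close> below relates this to the conditional expectation of the library.\<close>

definition hom_density_at ::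
    "'v::linorder \<Rightarrow> real \<Rightarrow> 'v sgraph \<Rightarrow> (real \<Rightarrow> real \<Rightarrow> real) \<Rightarrow> real" where
  "hom_density_at a x H W =
     (LINT u | (\<Pi>\<^sub>M c\<in>verts H - {a}. U01). edge_prod H W (u(a := x)))"

definition H_regular :: "'v::linorder sgraph \<Rightarrow> (real \<Rightarrow> real \<Rightarrow> real) \<Rightarrow> bool" where
  "H_regular H W \<longleftrightarrow>
     (AE x in U01. 1 / real (card (verts H)) * (\<Sum>a\<in>verts H. hom_density_at a x H W)
                   = hom_density H W)"

section \<open>The random graph of a graphon\<close>

definition index_pairs :: "nat \<Rightarrow> (nat \<times> nat) set" where
  "index_pairs n = {(i, j). 1 \<le> i \<and> i < j \<and> j \<le> n}"

definition sample_graph ::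
    "nat \<Rightarrow> (real \<Rightarrow> real \<Rightarrow> real) \<Rightarrow> (nat \<Rightarrow> real) \<Rightarrow> (nat \<times> nat \<Rightarrow> real) \<Rightarrow> nat sgraph" where
  "sample_graph n W U Y =
     SGraph {1..n} {{i, j} | i j. (i, j) \<in> index_pairs n \<and> Y (i, j) \<le> W (U i) (U j)}"

text \<open>The law of \<open>G(n, W)\<close>.\<close>

definition random_graph :: "nat \<Rightarrow> (real \<Rightarrow> real \<Rightarrow> real) \<Rightarrow> nat sgraph measure" where
  "random_graph n W =
     distr ((\<Pi>\<^sub>M i\<in>{1..n}. U01) \<Otimes>\<^sub>M (\<Pi>\<^sub>M p\<in>index_pairs n. U01)) (count_space UNIV)
           (\<lambda>(U, Y). sample_graph n W U Y)"

section \<open>Convergence in probability\<close>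

text \<open>The \<open>n\<close>-th random variable may live on its own probability space.\<close>

definition tendsto_in_prob ::
    "(nat \<Rightarrow> 'w measure) \<Rightarrow> (nat \<Rightarrow> 'w \<Rightarrow> real) \<Rightarrow> real \<Rightarrow> bool" where
  "tendsto_in_prob M X c \<longleftrightarrow>
     (\<forall>\<epsilon>>0. (\<lambda>n. measure (M n) {\<omega>\<in>space (M n). \<bar>X n \<omega> - c\<bar> > \<epsilon>}) \<longlonglongrightarrow> 0)"

definition tendsto_infinity_in_prob ::
    "(nat \<Rightarrow> 'w measure) \<Rightarrow> (nat \<Rightarrow> 'w \<Rightarrow> real) \<Rightarrow> bool" where
  "tendsto_infinity_in_prob M X \<longleftrightarrow>
     (\<forall>K. (\<lambda>n. measure (M n) {\<omega>\<in>space (M n). X n \<omega> > K}) \<longlonglongrightarrow> 1)"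

section \<open>The statistic\<close>

definition R_stat :: "'u sgraph \<Rightarrow> 'v sgraph \<Rightarrow> real" where
  "R_stat H G = (\<Sum>a\<in>verts H. \<Sum>b\<in>verts H. t_hat (vertex_join H a b H) G)
                - (real (card (verts H)))\<^sup>2 * (t_hat H G)\<^sup>2"

section \<open>Adequacy of the definitions\<close>

lemma space_U01: "space U01 = {0..1}"
  by (simp add: U01_def space_restrict_space)

lemma prob_space_U01: "prob_space U01"
  by (rule prob_spaceI) (simp add: U01_def space_restrict_space emeasure_restrict_space)

lemma measurable_W_comp:
  assumes W: "graphon W" and "f \<in> N \<rightarrow>\<^sub>M U01" "g \<in> N \<rightarrow>\<^sub>M U01"
  shows "(\<lambda>x. W (f x) (g x)) \<in> borel_measurable N"
proof -
  have "(\<lambda>x. (f x, g x)) \<in> N \<rightarrow>\<^sub>M U01 \<Otimes>\<^sub>M U01"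
    using assms by (intro measurable_Pair)
  from measurable_compose[OF this, of "\<lambda>(x, y). W x y" borel] W show ?thesis
    by (simp add: graphon_def)
qed

lemma measurable_edge_prod:
  assumes W: "graphon W" and H: "simple_graph H"
  shows "edge_prod H W \<in> borel_measurable (\<Pi>\<^sub>M c\<in>verts H. U01)"
  unfolding edge_prod_def
proof (rule borel_measurable_prod)
  fix p assume "p \<in> {(c, d). c < d \<and> {c, d} \<in> edges H}"
  then obtain c d where p: "p = (c, d)" and cd: "{c, d} \<in> edges H" by auto
  with H have "c \<in> verts H" "d \<in> verts H" by (auto simp: simple_graph_def)
  then have "(\<lambda>x. W (x c) (x d)) \<in> borel_measurable (\<Pi>\<^sub>M c\<in>verts H. U01)"
    by (intro measurable_W_comp[OF W] measurable_component_singleton)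
  then show "(\<lambda>x. case p of (c, d) \<Rightarrow> W (x c) (x d)) \<in> borel_measurable (\<Pi>\<^sub>M c\<in>verts H. U01)"
    by (simp add: p)
qed

lemma edge_prod_bounds:
  assumes W: "graphon W" and H: "simple_graph H" and x: "x \<in> space (\<Pi>\<^sub>M c\<in>verts H. U01)"
  shows "0 \<le> edge_prod H W x" "edge_prod H W x \<le> 1"
proof -
  have *: "0 \<le> W (x c) (x d) \<and> W (x c) (x d) \<le> 1" if "{c, d} \<in> edges H" for c d
  proof -
    from that H have "c \<in> verts H" "d \<in> verts H" by (auto simp: simple_graph_def)
    with x have "x c \<in> {0..1}" "x d \<in> {0..1}"
      by (auto simp: space_PiM space_U01 PiE_iff simp del: atLeastAtMost_iff)
    with W show ?thesis by (simp add: graphon_def del: atLeastAtMost_iff)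
  qed
  show "0 \<le> edge_prod H W x" "edge_prod H W x \<le> 1"
    unfolding edge_prod_def by (intro prod_nonneg prod_le_1; use * in force)+
qed

lemma real_cond_exp_edge_prod:
  assumes W: "graphon W" and H: "simple_graph H" and a: "a \<in> verts H"
  defines "P \<equiv> \<Pi>\<^sub>M c\<in>verts H. U01"
  shows "AE u in P. real_cond_exp P (vimage_algebra (space P) (\<lambda>u. u a) U01) (edge_prod H W) u
                    = hom_density_at a (u a) H W"
proof -
  define F where "F = vimage_algebra (space P) (\<lambda>u. u a) U01"
  define Q where "Q = (\<Pi>\<^sub>M c\<in>verts H - {a}. U01)"
  define g where "g = (\<lambda>x. hom_density_at a x H W)"
  interpret U: prob_space U01 by (rule prob_space_U01)
  interpret P: prob_space P unfolding P_def by (intro prob_space_PiM prob_space_U01)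
  interpret Q: prob_space Q unfolding Q_def by (intro prob_space_PiM prob_space_U01)
  interpret UQ: pair_prob_space U01 Q ..
  have ins: "insert a (verts H - {a}) = verts H" using a by auto
  have proj: "(\<lambda>u. u a) \<in> P \<rightarrow>\<^sub>M U01" unfolding P_def using a by measurable
  have proj': "(\<lambda>u. u a) \<in> space P \<rightarrow> space U01" using measurable_space[OF proj] by blast
  have sub: "subalgebra P F"
    unfolding subalgebra_def F_def
    using measurable_sets[OF proj] by (auto simp: sets_vimage_algebra2[OF proj'])
  interpret F: finite_measure_subalgebra P F by standard (rule sub)
  have bd: "AE u in P. norm (edge_prod H W u) \<le> 1"
    using edge_prod_bounds[OF W H] by (auto simp: P_def)
  have int: "integrable P (edge_prod H W)"
    using P.integrable_const_bound[OF bd] measurable_edge_prod[OF W H] by (simp add: P_def)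
  have upd: "(\<lambda>(x, v). v(a := x)) \<in> U01 \<Otimes>\<^sub>M Q \<rightarrow>\<^sub>M P"
    unfolding P_def Q_def split_beta'
    by (rule measurable_fun_upd[where J = "verts H - {a}"]) (use a in auto)
  have distr: "distr (U01 \<Otimes>\<^sub>M Q) P (\<lambda>(x, v). v(a := x)) = P"
    using distr_pair_PiM_eq_PiM[of "verts H - {a}" "\<lambda>_. U01" a]
    unfolding P_def Q_def ins by (simp add: prob_space_U01)
  have m2: "(\<lambda>(x, v). edge_prod H W (v(a := x))) \<in> borel_measurable (U01 \<Otimes>\<^sub>M Q)"
    using measurable_compose[OF upd, of "edge_prod H W" borel] measurable_edge_prod[OF W H]
    by (simp add: P_def split_beta')
  have gm: "g \<in> borel_measurable U01"
    unfolding g_def hom_density_at_def Q_def[symmetric]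
    using m2 by (intro Q.borel_measurable_lebesgue_integral) auto
  have key: "(LINT u|P. indicator B (u a) * edge_prod H W u) = (LINT x|U01. indicator B x * g x)"
    and intg: "integrable U01 (\<lambda>x. indicator B x * g x)"
    if B: "B \<in> sets U01" for B
  proof -
    let ?f = "\<lambda>u. indicator B (u a) * edge_prod H W u"
    have mf: "?f \<in> borel_measurable P"
      using measurable_compose[OF proj borel_measurable_indicator[OF B]] int
      by (intro borel_measurable_times) auto
    have i1: "integrable P ?f"
      by (rule Bochner_Integration.integrable_bound[OF int mf]) (auto simp: indicator_def)
    have i2: "integrable (U01 \<Otimes>\<^sub>M Q) (\<lambda>z. ?f (case z of (x, v) \<Rightarrow> v(a := x)))"
      using i1 upd distr integrable_distr_eq[OF upd mf] by simp
    then have i3: "integrable (U01 \<Otimes>\<^sub>M Q) (\<lambda>(x, v). indicator B x * edge_prod H W (v(a := x)))"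
      by (simp add: split_beta')
    have "(LINT u|P. ?f u) = (LINT z|(U01 \<Otimes>\<^sub>M Q). ?f (case z of (x, v) \<Rightarrow> v(a := x)))"
      using distr integral_distr[OF upd mf] by simp
    also have "\<dots> = (LINT z|(U01 \<Otimes>\<^sub>M Q). (case z of (x, v) \<Rightarrow> indicator B x * edge_prod H W (v(a := x))))"
      by (simp add: split_beta')
    also have "\<dots> = (LINT x|U01. LINT v|Q. indicator B x * edge_prod H W (v(a := x)))"
      using UQ.integral_fst'[OF i3] by simp
    also have "\<dots> = (LINT x|U01. indicator B x * g x)"
      by (simp add: g_def hom_density_at_def Q_def)
    finally show "(LINT u|P. ?f u) = (LINT x|U01. indicator B x * g x)" .
    show "integrable U01 (\<lambda>x. indicator B x * g x)"
      using UQ.integrable_fst'[OF i3] by (simp add: g_def hom_density_at_def Q_def)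
  qed
  have dP: "distr P U01 (\<lambda>u. u a) = U01"
    unfolding P_def using a by (intro distr_PiM_component prob_space_U01)
  have ig: "integrable U01 g"
    using intg[of "space U01"] by (simp cong: Bochner_Integration.integrable_cong)
  have igP: "integrable P (\<lambda>u. g (u a))"
    using integrable_distr_eq[OF proj gm] dP ig by simp
  have gF: "(\<lambda>u. g (u a)) \<in> borel_measurable F"
    using measurable_compose[OF measurable_vimage_algebra1[OF proj'] gm]
    unfolding F_def .
  have "AE u in P. real_cond_exp P F (edge_prod H W) u = g (u a)"
  proof (rule F.real_cond_exp_charact[OF _ int igP gF])
    fix A assume "A \<in> sets F"
    then obtain B where B: "B \<in> sets U01" and A: "A = (\<lambda>u. u a) -` B \<inter> space P"
        unfolding F_def by (auto simp: sets_vimage_algebra2[OF proj'])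
    have "(LINT u:A|P. edge_prod H W u) = (LINT u|P. indicator B (u a) * edge_prod H W u)"
      unfolding set_lebesgue_integral_def A
      by (intro Bochner_Integration.integral_cong) (auto simp: indicator_def)
    also have "\<dots> = (LINT x|distr P U01 (\<lambda>u. u a). indicator B x * g x)"
      using key[OF B] dP by simp
    also have "\<dots> = (LINT u|P. indicator B (u a) * g (u a))"
      by (intro integral_distr[OF proj] borel_measurable_times borel_measurable_indicator B gm)
    also have "\<dots> = (LINT u:A|P. g (u a))"
      unfolding set_lebesgue_integral_def A
      by (intro Bochner_Integration.integral_cong) (auto simp: indicator_def)
    finally show "(LINT u:A|P. edge_prod H W u) = (LINT u:A|P. g (u a))" .
  qed
  then show ?thesis by (simp add: F_def g_def)
qed

lemma finite_index_pairs: "finite (index_pairs n)"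
  by (rule finite_subset[of _ "{1..n} \<times> {1..n}"]) (auto simp: index_pairs_def)

lemma measurable_sample_graph:
  assumes W: "graphon W"
  shows "(\<lambda>(U, Y). sample_graph n W U Y)
         \<in> (\<Pi>\<^sub>M i\<in>{1..n}. U01) \<Otimes>\<^sub>M (\<Pi>\<^sub>M p\<in>index_pairs n. U01) \<rightarrow>\<^sub>M count_space UNIV"
proof -
  let ?N = "(\<Pi>\<^sub>M i\<in>{1..n}. U01) \<Otimes>\<^sub>M (\<Pi>\<^sub>M p\<in>index_pairs n. U01)"
  define S where "S = (\<lambda>z::(nat \<Rightarrow> real) \<times> (nat \<times> nat \<Rightarrow> real).
    {p \<in> index_pairs n. snd z p \<le> W (fst z (fst p)) (fst z (snd p))})"
  have S1: "S \<in> ?N \<rightarrow>\<^sub>M count_space (Pow (index_pairs n))"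
  proof (rule measurable_count_space_eq2[THEN iffD2])
    show "finite (Pow (index_pairs n))" using finite_index_pairs by simp
    have pm: "{z \<in> space ?N. snd z p \<le> W (fst z (fst p)) (fst z (snd p))} \<in> sets ?N"
      if p: "p \<in> index_pairs n" for p
    proof -
      have i: "fst p \<in> {1..n}" "snd p \<in> {1..n}" using p by (auto simp: index_pairs_def)
      have 1: "(\<lambda>z. fst z (fst p)) \<in> ?N \<rightarrow>\<^sub>M U01"
        by (rule measurable_compose[OF measurable_fst measurable_component_singleton[OF i(1)]])
      have 2: "(\<lambda>z. fst z (snd p)) \<in> ?N \<rightarrow>\<^sub>M U01"
        by (rule measurable_compose[OF measurable_fst measurable_component_singleton[OF i(2)]])
      have "(\<lambda>z. snd z p) \<in> ?N \<rightarrow>\<^sub>M U01"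
        by (rule measurable_compose[OF measurable_snd measurable_component_singleton[OF p]])
      then have 3: "(\<lambda>z. snd z p) \<in> borel_measurable ?N"
        by (rule measurable_compose)
          (simp add: U01_def measurable_restrict_space1)
      show ?thesis
        by (rule borel_measurable_le[OF 3 measurable_W_comp[OF W 1 2]])
    qed
    show "S \<in> space ?N \<rightarrow> Pow (index_pairs n) \<and>
      (\<forall>A\<in>Pow (index_pairs n). S -` {A} \<inter> space ?N \<in> sets ?N)"
    proof (intro conjI ballI)
      show "S \<in> space ?N \<rightarrow> Pow (index_pairs n)" by (auto simp: S_def)
      fix A assume A: "A \<in> Pow (index_pairs n)"
      have "S -` {A} \<inter> space ?N =
        {z \<in> space ?N. \<forall>p\<in>index_pairs n.
           (snd z p \<le> W (fst z (fst p)) (fst z (snd p))) = (p \<in> A)}"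
        using A by (auto simp: S_def)
      also have "\<dots> \<in> sets ?N"
      proof (rule sets.sets_Collect_finite_All[OF _ finite_index_pairs])
        fix p assume p: "p \<in> index_pairs n"
        show "{z \<in> space ?N. (snd z p \<le> W (fst z (fst p)) (fst z (snd p))) = (p \<in> A)} \<in> sets ?N"
          using pm[OF p] sets.sets_Collect_neg[OF pm[OF p]] by (cases "p \<in> A") auto
      qed
      finally show "S -` {A} \<inter> space ?N \<in> sets ?N" .
    qed
  qed
  have "(\<lambda>z. SGraph {1..n} ((\<lambda>p. {fst p, snd p}) ` S z)) \<in> ?N \<rightarrow>\<^sub>M count_space UNIV"
    by (rule measurable_compose[OF S1]) simp
  also have "(\<lambda>z. SGraph {1..n} ((\<lambda>p. {fst p, snd p}) ` S z)) = (\<lambda>(U, Y). sample_graph n W U Y)"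
    by (rule ext) (force simp: S_def sample_graph_def split_beta')
  finally show ?thesis .
qed

lemma prob_space_random_graph:
  assumes W: "graphon W"
  shows "prob_space (random_graph n W)"
proof -
  interpret A: prob_space "\<Pi>\<^sub>M i\<in>{1..n}. U01" by (intro prob_space_PiM prob_space_U01)
  interpret B: prob_space "\<Pi>\<^sub>M p\<in>index_pairs n. U01" by (intro prob_space_PiM prob_space_U01)
  interpret AB: pair_prob_space "\<Pi>\<^sub>M i\<in>{1..n}. U01" "\<Pi>\<^sub>M p\<in>index_pairs n. U01" ..
  show ?thesis
    unfolding random_graph_def by (rule AB.prob_space_distr[OF measurable_sample_graph[OF W]])
qed

end

theory Submission
  imports Defs "HOL-Real_Asymp.Real_Asymp"
begin

text \<open>
  The statistic is an empirical variance in disguise. For a vertex \<open>v\<close> of a graph \<open>G\<close> on \<open>n\<close>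
  vertices let \<open>D v\<close> be the number of embeddings of \<open>H\<close> that send some root \<open>a\<close> to \<open>v\<close>, added up
  over all roots \<open>a\<close> and divided by \<open>n ^ (k - 1)\<close>, where \<open>k\<close> is the number of vertices of \<open>H\<close>. The
  mean of \<open>D\<close> over the vertices is \<open>k\<close> times the density of \<open>H\<close>. In the mean of \<open>D\<^sup>2\<close>, pairs of
  embeddings with a common root occur, and apart from the few pairs that collide elsewhere they are
  embeddings of the vertex joins of \<open>H\<close> with itself. So \<open>R_stat H G\<close> differs from the variance of
  \<open>D\<close> over the vertices by at most \<open>C / n\<close>, for every sufficiently large graph \<open>G\<close> (\<open>R_stat_approx\<close>).

  In the random graph, \<open>D v\<close> is close to \<open>f (U v)\<close>, where \<open>f x\<close> is the sum of the rooted densities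
  \<open>hom_density_at a x H W\<close>: the embedding indicators, centred by their conditional expectation given
  the label of the root, are orthogonal unless their images collide away from the root
  (\<open>centred_embeddings_orthogonal\<close>), and counting the collisions gives a mean square distance
  \<open>O(1 / n)\<close> (\<open>expectation_rooted_density_deviation\<close>). Regularity of \<open>W\<close> says exactly that the
  variance \<open>\<sigma>\<^sup>2\<close> of \<open>f\<close> under the uniform distribution is zero (\<open>H_regular_iff_root_variance\<close>).

  If \<open>\<sigma>\<^sup>2 = 0\<close>, the variance of \<open>D\<close> over the vertices is at most its mean square distance from the
  constant \<open>f\<close>, hence \<open>O(1 / n)\<close> in expectation, and \<open>sqrt n\<close> times it tends to zero by Markov's
  inequality. If \<open>\<sigma>\<^sup>2 > 0\<close>, the law of large numbers for \<open>f (U v)\<close> and its square keeps the variance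
  of \<open>D\<close> above a positive constant with probability tending to one, so \<open>sqrt n\<close> times it exceeds
  every bound.
\<close>

section \<open>Embeddings and subgraph densities\<close>

definition embeddings :: "'u sgraph \<Rightarrow> 'v sgraph \<Rightarrow> ('u \<Rightarrow> 'v) set" where
  "embeddings F G =
     {\<phi> \<in> verts F \<rightarrow>\<^sub>E verts G. inj_on \<phi> (verts F) \<and> (\<forall>e\<in>edges F. \<phi> ` e \<in> edges G)}"

lemma finite_embeddings:
  assumes "finite (verts F)" "finite (verts G)"
  shows "finite (embeddings F G)"
  unfolding embeddings_def using assms by (simp add: finite_PiE)

text \<open>Sending an embedding to its image maps onto the copies of \<open>F\<close>. Two embeddings have the
  same image iff they differ by an automorphism of \<open>F\<close>, so every fibre has \<open>card (Aut F)\<close>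
  elements.\<close>

lemma card_embeddings:
  assumes F: "simple_graph F" and G: "finite (verts G)"
  shows "card (embeddings F G) = card (Aut F) * num_copies F G"
proof -
  let ?V = "verts F" and ?E = "edges F"
  let ?S = "\<lambda>\<phi>. SGraph (\<phi> ` ?V) ((`) \<phi> ` ?E)"
  let ?C = "{S. subgraph S G \<and> isomorphic F S}"
  have finV: "finite ?V" and sub: "\<And>e. e \<in> ?E \<Longrightarrow> e \<subseteq> ?V" and two: "\<And>e. e \<in> ?E \<Longrightarrow> card e = 2"
    using F by (auto simp: simple_graph_def)
  have fin: "finite (embeddings F G)" by (rule finite_embeddings[OF finV G])
  have img: "?S ` embeddings F G = ?C"
  proof (intro equalityI subsetI)
    fix S assume "S \<in> ?S ` embeddings F G"
    then obtain \<phi> where S: "S = ?S \<phi>" and \<phi>: "\<phi> \<in> ?V \<rightarrow>\<^sub>E verts G" "inj_on \<phi> ?V"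
      "\<And>e. e \<in> ?E \<Longrightarrow> \<phi> ` e \<in> edges G" by (auto simp: embeddings_def)
    have "card (\<phi> ` e) = 2" if "e \<in> ?E" for e
      using card_image[OF inj_on_subset[OF \<phi>(2) sub[OF that]]] two[OF that] by simp
    then have "simple_graph S" using finV sub by (auto simp: S simple_graph_def)
    then have "subgraph S G" using \<phi> by (auto simp: S subgraph_def)
    moreover have "isomorphic F S"
      unfolding isomorphic_def S using \<phi>(2) by (auto intro!: exI[of _ \<phi>] simp: bij_betw_def)
    ultimately show "S \<in> ?C" by simp
  next
    fix S assume "S \<in> ?C"
    then obtain f where S: "subgraph S G" and f: "bij_betw f ?V (verts S)" "(`) f ` ?E = edges S"
      by (auto simp: isomorphic_def)
    define \<phi> where "\<phi> = restrict f ?V"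
    have eq: "\<phi> ` e = f ` e" if "e \<subseteq> ?V" for e
      using that by (auto simp: \<phi>_def image_iff subset_iff)
    have "\<phi> ` ?V = verts S" using eq[of ?V] f by (simp add: bij_betw_def)
    moreover have "(`) \<phi> ` ?E = edges S"
      unfolding f(2)[symmetric] by (rule image_cong[OF refl eq[OF sub]])
    ultimately have "S = ?S \<phi>" by simp
    moreover have "\<phi> \<in> embeddings F G"
    proof -
      have "\<phi> \<in> ?V \<rightarrow>\<^sub>E verts G" using f S by (auto simp: \<phi>_def subgraph_def bij_betw_def)
      moreover have "inj_on \<phi> ?V"
        using f by (auto simp: \<phi>_def bij_betw_def inj_on_restrict_eq)
      moreover have "\<phi> ` e \<in> edges G" if "e \<in> ?E" for e
        using eq[OF sub[OF that]] f(2) that S by (auto simp: subgraph_def)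
      ultimately show ?thesis by (simp add: embeddings_def)
    qed
    ultimately show "S \<in> ?S ` embeddings F G" by (rule image_eqI)
  qed
  have fiber: "card {\<phi> \<in> embeddings F G. ?S \<phi> = ?S \<phi>0} = card (Aut F)" if \<phi>0: "\<phi>0 \<in> embeddings F G" for \<phi>0
  proof -
    have inj0: "inj_on \<phi>0 ?V" and \<phi>0P: "\<phi>0 \<in> ?V \<rightarrow>\<^sub>E verts G" using \<phi>0 by (auto simp: embeddings_def)
    have "bij_betw (\<lambda>p. restrict (\<phi>0 \<circ> p) ?V) (Aut F) {\<phi> \<in> embeddings F G. ?S \<phi> = ?S \<phi>0}"
      unfolding bij_betw_def
    proof (intro conjI equalityI subsetI)
      show "inj_on (\<lambda>p. restrict (\<phi>0 \<circ> p) ?V) (Aut F)"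
      proof (rule inj_onI, rule ext)
        fix p q x assume p: "p \<in> Aut F" and q: "q \<in> Aut F"
          and eq: "restrict (\<phi>0 \<circ> p) ?V = restrict (\<phi>0 \<circ> q) ?V"
        have pp: "p permutes ?V" and qq: "q permutes ?V" using p q by (auto simp: Aut_def)
        show "p x = q x"
        proof (cases "x \<in> ?V")
          case True
          then have "\<phi>0 (p x) = \<phi>0 (q x)" using fun_cong[OF eq, of x] by simp
          then show ?thesis
            using inj0 True permutes_in_image[OF pp] permutes_in_image[OF qq] by (auto simp: inj_on_def)
        next
          case False
          then show ?thesis using pp qq by (simp add: permutes_def)
        qed
      qed
    next
      fix \<phi> assume "\<phi> \<in> (\<lambda>p. restrict (\<phi>0 \<circ> p) ?V) ` Aut F"
      then obtain p where p: "p permutes ?V" "(`) p ` ?E = ?E" and \<phi>: "\<phi> = restrict (\<phi>0 \<circ> p) ?V"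
        by (auto simp: Aut_def)
      have eq: "\<phi> ` e = \<phi>0 ` p ` e" if "e \<subseteq> ?V" for e
        using that by (auto simp: \<phi> image_iff subset_iff)
      have V: "\<phi> ` ?V = \<phi>0 ` ?V" using eq[of ?V] permutes_image[OF p(1)] by simp
      have "(`) \<phi> ` ?E = (`) \<phi>0 ` (`) p ` ?E"
        unfolding image_image by (rule image_cong) (use eq sub in auto)
      then have E: "(`) \<phi> ` ?E = (`) \<phi>0 ` ?E" by (simp add: p(2))
      have "inj_on (\<phi>0 \<circ> p) ?V"
        using inj0 permutes_inj_on[OF p(1)] permutes_image[OF p(1)] by (intro comp_inj_on) auto
      then have "inj_on \<phi> ?V" by (simp add: \<phi> inj_on_restrict_eq)
      moreover have "\<phi> \<in> ?V \<rightarrow>\<^sub>E verts G"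
        using \<phi>0P permutes_in_image[OF p(1)] by (auto simp: \<phi> PiE_iff)
      moreover have "\<forall>e\<in>?E. \<phi> ` e \<in> edges G"
        using E \<phi>0 unfolding embeddings_def by (smt (verit) imageE imageI mem_Collect_eq)
      ultimately show "\<phi> \<in> {\<phi> \<in> embeddings F G. ?S \<phi> = ?S \<phi>0}"
        using V E by (simp add: embeddings_def)
    next
      fix \<phi> assume "\<phi> \<in> {\<phi> \<in> embeddings F G. ?S \<phi> = ?S \<phi>0}"
      then have \<phi>: "\<phi> \<in> ?V \<rightarrow>\<^sub>E verts G" "inj_on \<phi> ?V" "\<phi> ` ?V = \<phi>0 ` ?V" "(`) \<phi> ` ?E = (`) \<phi>0 ` ?E"
        by (auto simp: embeddings_def)
      define p where "p = (\<lambda>x. if x \<in> ?V then inv_into ?V \<phi>0 (\<phi> x) else x)"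
      have p0: "\<phi>0 (p x) = \<phi> x" if "x \<in> ?V" for x
        using \<phi>(3) that by (auto simp: p_def intro!: f_inv_into_f)
      have "bij_betw \<phi> ?V (\<phi>0 ` ?V)" using \<phi> by (auto simp: bij_betw_def)
      from bij_betw_trans[OF this bij_betw_inv_into[OF inj_on_imp_bij_betw[OF inj0]]]
      have "bij_betw p ?V ?V" by (rule bij_betw_cong[THEN iffD1, rotated]) (simp add: p_def)
      then have perm: "p permutes ?V" by (rule bij_imp_permutes) (simp add: p_def)
      have im: "\<phi>0 ` p ` e = \<phi> ` e" if "e \<subseteq> ?V" for e
        using p0 that by (auto simp: image_iff subset_iff)
      have "(`) \<phi>0 ` (`) p ` ?E = (\<lambda>e. \<phi>0 ` p ` e) ` ?E" by (rule image_image)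
      also have "\<dots> = (`) \<phi> ` ?E" by (rule image_cong[OF refl im[OF sub]])
      also note \<phi>(4)
      finally have "(`) \<phi>0 ` (`) p ` ?E = (`) \<phi>0 ` ?E" .
      then have "(`) p ` ?E = ?E"
        by (subst (asm) inj_on_image_eq_iff[OF inj_on_image_Pow[OF inj0]])
          (use sub permutes_in_image[OF perm] in blast)+
      then have "p \<in> Aut F" using perm by (simp add: Aut_def)
      moreover have "\<phi> = restrict (\<phi>0 \<circ> p) ?V"
        using p0 \<phi>(1) by (auto simp: fun_eq_iff PiE_iff extensional_def)
      ultimately show "\<phi> \<in> (\<lambda>p. restrict (\<phi>0 \<circ> p) ?V) ` Aut F"
        by blast
    qed
    then show ?thesis by (simp add: bij_betw_same_card)
  qed
  have "card (embeddings F G) = (\<Sum>S\<in>?S ` embeddings F G. card {\<phi> \<in> embeddings F G. ?S \<phi> = S})"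
    unfolding card_eq_sum by (rule sum.image_gen[OF fin])
  also have "\<dots> = (\<Sum>S\<in>?S ` embeddings F G. card (Aut F))"
  proof (rule sum.cong[OF refl])
    fix S assume "S \<in> ?S ` embeddings F G"
    then obtain \<phi>0 where S: "S = ?S \<phi>0" and "\<phi>0 \<in> embeddings F G" by (rule imageE)
    then show "card {\<phi> \<in> embeddings F G. ?S \<phi> = S} = card (Aut F)"
      unfolding S by (intro fiber)
  qed
  also have "\<dots> = card (Aut F) * num_copies F G" by (simp add: img num_copies_def)
  finally show ?thesis .
qed

lemma t_hat_eq_embeddings:
  assumes "simple_graph F" "finite (verts G)"
  shows "t_hat F G = real (card (embeddings F G)) / falling_fact (card (verts G)) (card (verts F))"
  by (simp add: t_hat_def card_embeddings[OF assms])

lemma falling_fact_le_power: "m \<le> n \<Longrightarrow> falling_fact n m \<le> real n ^ m"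
  unfolding falling_fact_def
  using prod_mono[of "{..<m}" "\<lambda>i. real n - real i" "\<lambda>_. real n"] by simp

text \<open>Relative to \<open>n ^ m\<close> the falling factorial is the product of the \<open>1 - i / n\<close> for \<open>i < m\<close>, which
  for \<open>m \<le> n\<close> is at least one minus the sum of the \<open>i / n\<close>. If \<open>n < m ^ 2\<close> the bound is negative.\<close>

lemma falling_fact_ge_power:
  assumes "0 < n"
  shows "falling_fact n m \<ge> (1 - real m ^ 2 / real n) * real n ^ m"
proof (cases "real m ^ 2 \<le> real n")
  case False
  have "falling_fact n m \<ge> 0"
  proof (cases "m \<le> n")
    case True
    then show ?thesis unfolding falling_fact_def by (intro prod_nonneg) auto
  next
    case False
    then have "n \<in> {..<m}" by simp
    then have "falling_fact n m = 0"
      unfolding falling_fact_def by (intro prod_zero) auto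
    then show ?thesis by simp
  qed
  moreover have "(1 - real m ^ 2 / real n) * real n ^ m \<le> 0"
    using False assms by (intro mult_nonpos_nonneg) (auto simp: field_simps)
  ultimately show ?thesis by simp
next
  case True
  show ?thesis using True
  proof (induction m)
    case 0
    then show ?case by (simp add: falling_fact_def)
  next
    case (Suc m)
    have le: "real m ^ 2 \<le> real n"
      by (rule order_trans[OF power_mono Suc.prems]) auto
    have mn: "real m \<le> real n"
    proof -
      have "real m \<le> real m ^ 2" by (cases m) (auto simp: power2_eq_square)
      with le show ?thesis by simp
    qed
    have "(1 - real (Suc m) ^ 2 / real n) \<le> (1 - real m ^ 2 / real n) * (1 - real m / real n)"
    proof -
      have "0 \<le> real m ^ 2 / real n * (real m / real n)" by simp
      moreover have "real (Suc m) ^ 2 / real n \<ge> real m ^ 2 / real n + real m / real n"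
        using assms by (simp add: field_simps power2_eq_square)
      moreover have "1 - z \<le> (1 - x) * (1 - y)" if "0 \<le> x * y" "x + y \<le> z" for x y z :: real
        using that by (simp add: algebra_simps)
      ultimately show ?thesis by blast
    qed
    then have "(1 - real (Suc m) ^ 2 / real n) * real n ^ Suc m
        \<le> (1 - real m ^ 2 / real n) * (1 - real m / real n) * real n ^ Suc m"
      by (rule mult_right_mono) simp
    also have "\<dots> = ((1 - real m ^ 2 / real n) * real n ^ m) * (real n - real m)"
      using assms by (simp add: field_simps)
    also have "\<dots> \<le> falling_fact n m * (real n - real m)"
      using Suc.IH[OF le] mn by (intro mult_right_mono) auto
    also have "\<dots> = falling_fact n (Suc m)" by (simp add: falling_fact_def)
    finally show ?case .
  qed
qed

text \<open>Dividing by \<open>n ^ m\<close> instead of the falling factorial costs \<open>O(1 / n)\<close> and makes the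
  normalisations of \<open>H\<close> and of its vertex joins compatible. The size condition keeps the falling
  factorial above half of \<open>n ^ m\<close>.\<close>

lemma t_hat_approx:
  assumes F: "simple_graph F" and G: "finite (verts G)" "0 < card (verts G)"
    and large: "2 * card (verts F) ^ 2 \<le> card (verts G)"
  shows "\<bar>t_hat F G - real (card (embeddings F G)) / real (card (verts G)) ^ card (verts F)\<bar>
         \<le> 2 * real (card (verts F)) ^ 2 / real (card (verts G))"
    and "real (card (embeddings F G)) / real (card (verts G)) ^ card (verts F) \<le> 1"
proof -
  define n m where "n = card (verts G)" and "m = card (verts F)"
  define N where "N = real (card (embeddings F G))"
  have n: "0 < n" using G by (simp add: n_def)
  have "card (embeddings F G) \<le> card (verts F \<rightarrow>\<^sub>E verts G)"
    using F G by (intro card_mono finite_PiE) (auto simp: embeddings_def simple_graph_def)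
  then have N: "N \<le> real n ^ m"
    using F by (simp add: N_def card_PiE n_def m_def simple_graph_def flip: of_nat_power)
  show "real (card (embeddings F G)) / real (card (verts G)) ^ card (verts F) \<le> 1"
    using N n by (simp add: N_def n_def m_def)
  define f where "f = falling_fact n m"
  have "real (2 * m ^ 2) \<le> real n" using large unfolding n_def m_def of_nat_le_iff .
  then have lg: "2 * real m ^ 2 \<le> real n" by simp
  have r: "f \<ge> (1 - real m ^ 2 / real n) * real n ^ m" unfolding f_def by (rule falling_fact_ge_power[OF n])
  have "m \<le> m ^ 2" by (cases m) (auto simp: power2_eq_square)
  then have mn: "m \<le> n" using large by (simp add: n_def m_def)
  have up: "f \<le> real n ^ m" unfolding f_def by (rule falling_fact_le_power[OF mn])
  have "(1/2) * real n ^ m \<le> (1 - real m ^ 2 / real n) * real n ^ m"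
    using lg n by (intro mult_right_mono) (auto simp: field_simps)
  from order_trans[OF this r] have half: "f \<ge> real n ^ m / 2" by simp
  then have f0: "f > 0" using n by (meson half_gt_zero less_le_trans of_nat_0_less_iff zero_less_power)
  have N0: "0 \<le> N" by (simp add: N_def)
  have "N / f - N / real n ^ m = (N / real n ^ m) * ((real n ^ m - f) / f)"
    using n f0 by (simp add: field_simps)
  moreover have "N / real n ^ m * ((real n ^ m - f) / f) \<le> 1 * (2 * real m ^ 2 / real n)"
  proof (rule mult_mono)
    show "N / real n ^ m \<le> 1" using N n by simp
    have "(real n ^ m - f) / f \<le> (real m ^ 2 / real n * real n ^ m) / (real n ^ m / 2)"
      using r half f0 up n by (intro frac_le) (auto simp: algebra_simps)
    also have "\<dots> = 2 * real m ^ 2 / real n" using n by simp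
    finally show "(real n ^ m - f) / f \<le> 2 * real m ^ 2 / real n" .
  qed (use up f0 in auto)
  moreover have "0 \<le> N / real n ^ m * ((real n ^ m - f) / f)" using N0 f0 up by simp
  ultimately have "\<bar>N / f - N / real n ^ m\<bar> \<le> 2 * real m ^ 2 / real n" by simp
  then show "\<bar>t_hat F G - real (card (embeddings F G)) / real (card (verts G)) ^ card (verts F)\<bar>
         \<le> 2 * real (card (verts F)) ^ 2 / real (card (verts G))"
    by (simp add: t_hat_eq_embeddings[OF F G(1)] N_def f_def n_def m_def)
qed

section \<open>Vertex joins and pairs of rooted maps\<close>

text \<open>At a collision \<open>\<theta> c = \<theta> d\<close> with \<open>d \<noteq> r\<close>, the values at the root \<open>r\<close> and at \<open>d\<close> are
  determined by the others, so two of the \<open>card V\<close> degrees of freedom are lost. The rooted maps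
  alone lose only one; hence collisions are rarer by a factor \<open>1 / card T\<close>.\<close>

lemma card_rooted_noninjective_le:
  assumes V: "finite V" "r \<in> V" and T: "finite T"
  shows "card {\<theta> \<in> V \<rightarrow>\<^sub>E T. \<theta> r = v \<and> \<not> inj_on \<theta> V} \<le> card V ^ 2 * card T ^ (card V - 2)"
proof -
  let ?B = "\<lambda>(c, d). {\<theta> \<in> V \<rightarrow>\<^sub>E T. \<theta> r = v \<and> c \<noteq> d \<and> d \<noteq> r \<and> \<theta> c = \<theta> d}"
  have B: "card (?B p) \<le> card T ^ (card V - 2)" if "p \<in> V \<times> V" for p
  proof -
    obtain c d where p: "p = (c, d)" and cd: "c \<in> V" "d \<in> V"
      using \<open>p \<in> V \<times> V\<close> by (cases p) auto
    show ?thesis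
    proof (cases "c \<noteq> d \<and> d \<noteq> r")
      case False
      then have "?B p = {}" by (auto simp: p)
      then show ?thesis by (metis card.empty le0)
    next
      case True
      have "card (?B p) \<le> card ((V - {r, d}) \<rightarrow>\<^sub>E T)"
      proof (rule card_inj_on_le)
        show "inj_on (\<lambda>\<theta>. restrict \<theta> (V - {r, d})) (?B p)"
        proof (rule inj_onI, rule ext)
          fix \<theta> \<theta>' x assume h: "\<theta> \<in> ?B p" "\<theta>' \<in> ?B p"
            "restrict \<theta> (V - {r, d}) = restrict \<theta>' (V - {r, d})"
          have *: "\<theta> y = \<theta>' y" if "y \<noteq> d" for y
            using fun_cong[OF h(3), of y] h(1,2) that
            by (cases "y \<in> V - {r, d}") (auto simp: p PiE_iff extensional_def)
          show "\<theta> x = \<theta>' x" using *[of x] *[of c] h(1,2) True by (cases "x = d") (auto simp: p)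
        qed
        show "(\<lambda>\<theta>. restrict \<theta> (V - {r, d})) ` (?B p) \<subseteq> (V - {r, d}) \<rightarrow>\<^sub>E T"
          by (rule image_subsetI) (auto simp: p PiE_iff)
        show "finite ((V - {r, d}) \<rightarrow>\<^sub>E T)" using V T by (simp add: finite_PiE)
      qed
      also have "\<dots> = card T ^ (card V - 2)"
      proof -
        have "card {r, d} = 2" using True by (auto simp: card_insert_if)
        then show ?thesis using V cd by (simp add: card_PiE card_Diff_subset)
      qed
      finally show ?thesis .
    qed
  qed
  have "{\<theta> \<in> V \<rightarrow>\<^sub>E T. \<theta> r = v \<and> \<not> inj_on \<theta> V} \<subseteq> (\<Union>p\<in>V \<times> V. ?B p)"
  proof
    fix \<theta> assume "\<theta> \<in> {\<theta> \<in> V \<rightarrow>\<^sub>E T. \<theta> r = v \<and> \<not> inj_on \<theta> V}"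
    then obtain c d where h: "\<theta> \<in> V \<rightarrow>\<^sub>E T" "\<theta> r = v" "c \<in> V" "d \<in> V" "\<theta> c = \<theta> d" "c \<noteq> d"
      by (auto simp: inj_on_def)
    then have "\<theta> \<in> ?B (c, d) \<or> \<theta> \<in> ?B (d, c)" by auto
    then show "\<theta> \<in> (\<Union>p\<in>V \<times> V. ?B p)" using h by blast
  qed
  moreover have fB: "finite (\<Union>p\<in>V \<times> V. ?B p)" using V T by (auto simp: finite_PiE)
  ultimately have "card {\<theta> \<in> V \<rightarrow>\<^sub>E T. \<theta> r = v \<and> \<not> inj_on \<theta> V} \<le> card (\<Union>p\<in>V \<times> V. ?B p)"
    by (intro card_mono)
  also have "\<dots> \<le> (\<Sum>p\<in>V \<times> V. card (?B p))" using V by (intro card_UN_le) auto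
  also have "\<dots> \<le> (\<Sum>p\<in>V \<times> V. card T ^ (card V - 2))" by (rule sum_mono) (rule B)
  also have "\<dots> = card V ^ 2 * card T ^ (card V - 2)"
    by (simp add: card_cartesian_product power2_eq_square)
  finally show ?thesis .
qed

text \<open>The position of a vertex of the second graph inside the vertex join.\<close>

definition join_map :: "'u \<Rightarrow> 'v \<Rightarrow> 'v \<Rightarrow> 'u + 'v" where
  "join_map a b v = (if v = b then Inl a else Inr v)"

lemma verts_vertex_join: "verts (vertex_join H1 a b H2) = Inl ` verts H1 \<union> join_map a b ` verts H2"
  and edges_vertex_join: "edges (vertex_join H1 a b H2)
    = (`) Inl ` edges H1 \<union> (`) (join_map a b) ` edges H2"
  by (auto simp: vertex_join_def Let_def join_map_def[abs_def])

lemma inj_join_map: "inj (join_map a b)"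
  by (auto simp: inj_def join_map_def split: if_splits)

lemma verts_vertex_join_disjoint:
  assumes "a \<in> verts H1" "b \<in> verts H2"
  shows "verts (vertex_join H1 a b H2) = Inl ` verts H1 \<union> Inr ` (verts H2 - {b})"
  using assms by (auto simp: verts_vertex_join join_map_def image_iff)

lemma card_verts_vertex_join:
  assumes "simple_graph H1" "simple_graph H2" "a \<in> verts H1" "b \<in> verts H2"
  shows "card (verts (vertex_join H1 a b H2)) = card (verts H1) + card (verts H2) - 1"
proof -
  have f: "finite (verts H1)" "finite (verts H2)" using assms by (auto simp: simple_graph_def)
  have "card (Inl ` verts H1 \<union> Inr ` (verts H2 - {b}))
      = card (verts H1) + card (verts H2 - {b})"
    using f by (subst card_Un_disjoint) (auto simp: card_image)
  moreover have "card (verts H2) > 0" using f assms by (auto simp: card_gt_0_iff)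
  ultimately show ?thesis
    using f assms by (simp add: verts_vertex_join_disjoint card_Diff_singleton)
qed

lemma simple_graph_vertex_join:
  assumes "simple_graph H1" "simple_graph H2"
  shows "simple_graph (vertex_join H1 a b H2)"
proof -
  have c1: "card ((Inl :: 'a \<Rightarrow> 'a + 'b) ` e) = card e" for e
    by (rule card_image) simp
  have c2: "card (join_map a b ` e) = card e" for e
    by (rule card_image) (rule inj_on_subset[OF inj_join_map subset_UNIV])
  show ?thesis
    unfolding simple_graph_def
  proof (intro conjI ballI)
    show "finite (verts (vertex_join H1 a b H2))"
      using assms by (simp add: verts_vertex_join simple_graph_def)
    fix e assume "e \<in> edges (vertex_join H1 a b H2)"
    then consider e' where "e' \<in> edges H1" "e = Inl ` e'"
      | e' where "e' \<in> edges H2" "e = join_map a b ` e'"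
      by (auto simp: edges_vertex_join)
    then have "e \<subseteq> verts (vertex_join H1 a b H2) \<and> card e = 2"
    proof cases
      case 1
      then have "e' \<subseteq> verts H1" "card e' = 2" using assms(1) by (auto simp: simple_graph_def)
      then show ?thesis by (simp add: 1(2) c1 verts_vertex_join image_mono le_supI1)
    next
      case 2
      then have "e' \<subseteq> verts H2" "card e' = 2" using assms(2) by (auto simp: simple_graph_def)
      then show ?thesis by (simp add: 2(2) c2 verts_vertex_join image_mono le_supI2)
    qed
    then show "e \<subseteq> verts (vertex_join H1 a b H2)" "card e = 2" by auto
  qed
qed

text \<open>Restriction of a map on the vertex join to the two halves. Restricting makes the result
  extensional, so that it is an honest bijection onto pairs of maps that agree at the glued vertex.\<close>

definition join_split :: "'u set \<Rightarrow> 'u \<Rightarrow> 'v \<Rightarrow> 'v set \<Rightarrow> ('u + 'v \<Rightarrow> 't) \<Rightarrow> ('u \<Rightarrow> 't) \<times> ('v \<Rightarrow> 't)" where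
  "join_split A a b B \<theta> = (restrict (\<theta> \<circ> Inl) A, restrict (\<theta> \<circ> join_map a b) B)"

lemma bij_betw_join_split:
  assumes a: "a \<in> verts H1" and b: "b \<in> verts H2"
  shows "bij_betw (join_split (verts H1) a b (verts H2))
           {\<theta> \<in> verts (vertex_join H1 a b H2) \<rightarrow>\<^sub>E T. \<theta> (Inl a) = v}
           ({\<phi> \<in> verts H1 \<rightarrow>\<^sub>E T. \<phi> a = v} \<times> {\<psi> \<in> verts H2 \<rightarrow>\<^sub>E T. \<psi> b = v})"
    (is "bij_betw ?s ?L ?R")
proof (rule bij_betw_byWitness)
  define J where "J = verts (vertex_join H1 a b H2)"
  define g where "g = (\<lambda>(\<phi>, \<psi>). restrict (case_sum \<phi> \<psi> :: 'a + 'b \<Rightarrow> 'c) J)"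
  have J: "Inl x \<in> J \<longleftrightarrow> x \<in> verts H1" "Inr y \<in> J \<longleftrightarrow> y \<in> verts H2 \<and> y \<noteq> b" for x y
    by (auto simp: J_def verts_vertex_join_disjoint[OF a b])
  have s: "?s \<theta> = (restrict (\<lambda>x. \<theta> (Inl x)) (verts H1),
      restrict (\<lambda>y. if y = b then \<theta> (Inl a) else \<theta> (Inr y)) (verts H2))" for \<theta> :: "'a + 'b \<Rightarrow> 'c"
    by (auto simp: join_split_def join_map_def fun_eq_iff)
  show "\<forall>\<theta>\<in>?L. g (?s \<theta>) = \<theta>"
  proof (intro ballI ext)
    fix \<theta> :: "'a + 'b \<Rightarrow> 'c" and x
    assume \<theta>: "\<theta> \<in> ?L"
    have "\<theta> x = undefined" if "x \<notin> J" using \<theta> that by (auto simp: J_def PiE_iff extensional_def)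
    then show "g (?s \<theta>) x = \<theta> x"
      by (cases x) (auto simp: s g_def J)
  qed
  show "\<forall>p\<in>?R. ?s (g p) = p"
  proof
    fix p assume "p \<in> ?R"
    then obtain \<phi> \<psi> where p: "p = (\<phi>, \<psi>)" and \<phi>: "\<phi> \<in> verts H1 \<rightarrow>\<^sub>E T" "\<phi> a = v"
      and \<psi>: "\<psi> \<in> verts H2 \<rightarrow>\<^sub>E T" "\<psi> b = v" by auto
    have \<phi>0: "\<phi> x = undefined" if "x \<notin> verts H1" for x using \<phi> that by (rule_tac PiE_arb)
    have \<psi>0: "\<psi> x = undefined" if "x \<notin> verts H2" for x using \<psi> that by (rule_tac PiE_arb)
    show "?s (g p) = p"
      using \<phi>(2) \<psi>(2) a by (auto simp: s p g_def J fun_eq_iff \<phi>0 \<psi>0)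
  qed
  show "?s ` ?L \<subseteq> ?R"
  proof (rule image_subsetI)
    fix \<theta> assume \<theta>: "\<theta> \<in> ?L"
    then have \<theta>T: "\<theta> x \<in> T" if "x \<in> J" for x using that by (auto simp: J_def)
    show "?s \<theta> \<in> ?R"
      using \<theta> a b by (auto simp: s \<theta>T J)
  qed
  show "g ` ?R \<subseteq> ?L"
  proof (rule image_subsetI)
    fix p assume "p \<in> ?R"
    then obtain \<phi> \<psi> where p: "p = (\<phi>, \<psi>)" and \<phi>: "\<phi> \<in> verts H1 \<rightarrow>\<^sub>E T" "\<phi> a = v"
      and \<psi>: "\<psi> \<in> verts H2 \<rightarrow>\<^sub>E T" by auto
    have "case_sum \<phi> \<psi> x \<in> T" if "x \<in> J" for x
      using that PiE_mem[OF \<phi>(1)] PiE_mem[OF \<psi>] by (cases x) (auto simp: J)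
    then show "g p \<in> ?L"
      using \<phi>(2) a unfolding J_def[symmetric] by (auto simp: p g_def J)
  qed
qed

lemma join_split_hom_iff:
  assumes "simple_graph H1" "simple_graph H2"
  shows "(\<forall>e\<in>edges (vertex_join H1 a b H2). \<theta> ` e \<in> E) \<longleftrightarrow>
     (\<forall>e\<in>edges H1. fst (join_split (verts H1) a b (verts H2) \<theta>) ` e \<in> E) \<and>
     (\<forall>e\<in>edges H2. snd (join_split (verts H1) a b (verts H2) \<theta>) ` e \<in> E)"
proof -
  have l: "fst (join_split (verts H1) a b (verts H2) \<theta>) ` e = \<theta> ` Inl ` e" if "e \<in> edges H1" for e
  proof -
    have "e \<subseteq> verts H1" using assms(1) that by (auto simp: simple_graph_def)
    then show ?thesis by (auto simp: join_split_def image_iff subset_iff)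
  qed
  have r: "snd (join_split (verts H1) a b (verts H2) \<theta>) ` e = \<theta> ` join_map a b ` e"
    if "e \<in> edges H2" for e
  proof -
    have "e \<subseteq> verts H2" using assms(2) that by (auto simp: simple_graph_def)
    then show ?thesis by (auto simp: join_split_def image_iff subset_iff)
  qed
  have "(\<forall>e\<in>edges (vertex_join H1 a b H2). \<theta> ` e \<in> E) \<longleftrightarrow>
      (\<forall>e\<in>edges H1. \<theta> ` Inl ` e \<in> E) \<and> (\<forall>e\<in>edges H2. \<theta> ` join_map a b ` e \<in> E)"
    unfolding edges_vertex_join by blast
  also have "\<dots> \<longleftrightarrow> (\<forall>e\<in>edges H1. fst (join_split (verts H1) a b (verts H2) \<theta>) ` e \<in> E) \<and>
     (\<forall>e\<in>edges H2. snd (join_split (verts H1) a b (verts H2) \<theta>) ` e \<in> E)"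
    by (intro arg_cong2[of _ _ _ _ "(\<and>)"] ball_cong refl) (simp_all only: l r)
  finally show ?thesis .
qed

lemma join_split_injective:
  assumes a: "a \<in> verts H1" and b: "b \<in> verts H2"
    and inj: "inj_on \<theta> (verts (vertex_join H1 a b H2))"
    and split: "join_split (verts H1) a b (verts H2) \<theta> = (\<phi>, \<psi>)"
  shows "inj_on \<phi> (verts H1)" "inj_on \<psi> (verts H2)"
    "\<phi> ` verts H1 \<inter> \<psi> ` (verts H2 - {b}) = {}"
proof -
  have \<phi>: "\<phi> x = \<theta> (Inl x)" if "x \<in> verts H1" for x
    using split that by (auto simp: join_split_def)
  have \<psi>: "\<psi> x = \<theta> (join_map a b x)" if "x \<in> verts H2" for x
    using split that by (auto simp: join_split_def)
  have J: "Inl x \<in> verts (vertex_join H1 a b H2)" if "x \<in> verts H1" for x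
    using that by (simp add: verts_vertex_join)
  have J': "join_map a b x \<in> verts (vertex_join H1 a b H2)" if "x \<in> verts H2" for x
    using that by (simp add: verts_vertex_join)
  show "inj_on \<phi> (verts H1)"
  proof (rule inj_onI)
    fix x y assume xy: "x \<in> verts H1" "y \<in> verts H1" "\<phi> x = \<phi> y"
    then have "\<theta> (Inl x) = \<theta> (Inl y)" by (simp add: \<phi>)
    from inj_onD[OF inj this J J] xy show "x = y" by simp
  qed
  show "inj_on \<psi> (verts H2)"
  proof (rule inj_onI)
    fix x y assume xy: "x \<in> verts H2" "y \<in> verts H2" "\<psi> x = \<psi> y"
    then have "\<theta> (join_map a b x) = \<theta> (join_map a b y)" by (simp add: \<psi>)
    from inj_onD[OF inj this J' J'] xy show "x = y" using injD[OF inj_join_map] by metis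
  qed
  show "\<phi> ` verts H1 \<inter> \<psi> ` (verts H2 - {b}) = {}"
  proof (rule ccontr)
    assume "\<phi> ` verts H1 \<inter> \<psi> ` (verts H2 - {b}) \<noteq> {}"
    then obtain x y where xy: "x \<in> verts H1" "y \<in> verts H2" "y \<noteq> b" "\<phi> x = \<psi> y" by auto
    then have "\<theta> (Inl x) = \<theta> (join_map a b y)" by (simp add: \<phi> \<psi>)
    from inj_onD[OF inj this J J'] xy show False by (simp add: join_map_def)
  qed
qed

section \<open>Rooted embeddings and the statistic as an empirical variance\<close>

definition rooted_embeddings :: "'u sgraph \<Rightarrow> 'v sgraph \<Rightarrow> 'u \<Rightarrow> 'v \<Rightarrow> ('u \<Rightarrow> 'v) set" where
  "rooted_embeddings H G a v = {\<phi> \<in> embeddings H G. \<phi> a = v}"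

lemma sum_card_rooted_embeddings:
  assumes "finite (verts H)" "finite (verts G)" "a \<in> verts H"
  shows "(\<Sum>v\<in>verts G. card (rooted_embeddings H G a v)) = card (embeddings H G)"
proof -
  have "(\<Union>v\<in>verts G. rooted_embeddings H G a v) = embeddings H G"
    using assms(3) by (auto simp: rooted_embeddings_def embeddings_def)
  moreover have "card (\<Union>v\<in>verts G. rooted_embeddings H G a v)
      = (\<Sum>v\<in>verts G. card (rooted_embeddings H G a v))"
    using assms finite_embeddings[OF assms(1,2)]
    by (intro card_UN_disjoint) (auto simp: rooted_embeddings_def)
  ultimately show ?thesis by simp
qed

text \<open>A pair of embeddings with a common root is a homomorphism of the vertex join that is
  injective on each half. It fails to be an embedding of the join only if the two images collide
  away from the root, and such maps are few.\<close>

lemma rooted_embeddings_product: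
  assumes H: "simple_graph H1" "simple_graph H2" and a: "a \<in> verts H1" and b: "b \<in> verts H2"
    and G: "finite (verts G)"
  defines "J \<equiv> vertex_join H1 a b H2"
  shows "card (rooted_embeddings J G (Inl a) v)
      \<le> card (rooted_embeddings H1 G a v) * card (rooted_embeddings H2 G b v)"
    and "card (rooted_embeddings H1 G a v) * card (rooted_embeddings H2 G b v)
      \<le> card (rooted_embeddings J G (Inl a) v)
          + card (verts J) ^ 2 * card (verts G) ^ (card (verts J) - 2)"
proof -
  let ?s = "join_split (verts H1) a b (verts H2)"
  let ?T = "verts G"
  let ?L = "{\<theta> \<in> verts J \<rightarrow>\<^sub>E ?T. \<theta> (Inl a) = v}"
  let ?P = "rooted_embeddings H1 G a v \<times> rooted_embeddings H2 G b v"
  let ?N = "{\<theta> \<in> verts J \<rightarrow>\<^sub>E ?T. \<theta> (Inl a) = v \<and> \<not> inj_on \<theta> (verts J)}"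
  have bij: "bij_betw ?s ?L ({\<phi> \<in> verts H1 \<rightarrow>\<^sub>E ?T. \<phi> a = v} \<times> {\<psi> \<in> verts H2 \<rightarrow>\<^sub>E ?T. \<psi> b = v})"
    unfolding J_def by (rule bij_betw_join_split[OF a b])
  have simpJ: "simple_graph J" unfolding J_def by (rule simple_graph_vertex_join[OF H])
  then have finJ: "finite (verts J)" by (simp add: simple_graph_def)
  have finL: "finite ?L" using finJ G by (simp add: finite_PiE)
  have finN: "finite ?N" by (rule finite_subset[OF _ finL]) auto
  \<comment> \<open>\<open>Q\<close> are the homomorphisms of the join that are injective on each half.\<close>
  define Q where "Q = {\<theta> \<in> ?L. ?s \<theta> \<in> ?P}"
  have finQ: "finite Q" by (rule finite_subset[OF _ finL]) (auto simp: Q_def)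
  have "?P \<subseteq> {\<phi> \<in> verts H1 \<rightarrow>\<^sub>E ?T. \<phi> a = v} \<times> {\<psi> \<in> verts H2 \<rightarrow>\<^sub>E ?T. \<psi> b = v}"
    by (auto simp: rooted_embeddings_def embeddings_def)
  then have sub: "?P \<subseteq> ?s ` ?L" unfolding bij_betw_imp_surj_on[OF bij] .
  have im: "f ` {x \<in> A. f x \<in> B} = B" if "B \<subseteq> f ` A" for f :: "'x \<Rightarrow> 'y" and A B
    using that by blast
  have "?s ` Q = ?P" unfolding Q_def by (rule im[OF sub])
  moreover have "inj_on ?s Q"
    by (rule inj_on_subset[OF bij_betw_imp_inj_on[OF bij]]) (auto simp: Q_def)
  ultimately have cardQ: "card Q = card ?P" by (metis card_image)
  have hom: "(\<forall>e\<in>edges J. \<theta> ` e \<in> edges G) \<longleftrightarrow> (\<forall>e\<in>edges H1. fst (?s \<theta>) ` e \<in> edges G) \<and>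
     (\<forall>e\<in>edges H2. snd (?s \<theta>) ` e \<in> edges G)" for \<theta>
    unfolding J_def by (rule join_split_hom_iff[OF H])
  have mem: "?s \<theta> \<in> {\<phi> \<in> verts H1 \<rightarrow>\<^sub>E ?T. \<phi> a = v} \<times> {\<psi> \<in> verts H2 \<rightarrow>\<^sub>E ?T. \<psi> b = v}"
    if "\<theta> \<in> ?L" for \<theta>
    using bij_betw_apply[OF bij that] .
  have "rooted_embeddings J G (Inl a) v \<subseteq> Q"
  proof
    fix \<theta> assume "\<theta> \<in> rooted_embeddings J G (Inl a) v"
    then have L: "\<theta> \<in> ?L" and inj: "inj_on \<theta> (verts J)" and h: "\<forall>e\<in>edges J. \<theta> ` e \<in> edges G"
      by (auto simp: rooted_embeddings_def embeddings_def)
    obtain \<phi> \<psi> where s: "?s \<theta> = (\<phi>, \<psi>)" by (cases "?s \<theta>")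
    have i: "inj_on \<phi> (verts H1)" "inj_on \<psi> (verts H2)"
      using join_split_injective[OF a b inj[unfolded J_def] s] by auto
    have "\<phi> \<in> rooted_embeddings H1 G a v" "\<psi> \<in> rooted_embeddings H2 G b v"
      using mem[OF L] h[unfolded hom] i unfolding s rooted_embeddings_def embeddings_def by auto
    then show "\<theta> \<in> Q" using L s unfolding Q_def by auto
  qed
  then have "card (rooted_embeddings J G (Inl a) v) \<le> card Q"
    by (intro card_mono finQ)
  then show "card (rooted_embeddings J G (Inl a) v)
      \<le> card (rooted_embeddings H1 G a v) * card (rooted_embeddings H2 G b v)"
    by (simp add: cardQ card_cartesian_product)
  have "Q \<subseteq> rooted_embeddings J G (Inl a) v \<union> ?N"
  proof
    fix \<theta> assume "\<theta> \<in> Q"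
    then have L: "\<theta> \<in> ?L" and P: "?s \<theta> \<in> ?P" by (auto simp: Q_def)
    have "\<forall>e\<in>edges J. \<theta> ` e \<in> edges G"
      using P unfolding hom by (auto simp: rooted_embeddings_def embeddings_def)
    then show "\<theta> \<in> rooted_embeddings J G (Inl a) v \<union> ?N"
      using L by (auto simp: rooted_embeddings_def embeddings_def)
  qed
  then have "card Q \<le> card (rooted_embeddings J G (Inl a) v \<union> ?N)"
    using finN finite_embeddings[OF finJ G] by (intro card_mono) (auto simp: rooted_embeddings_def)
  also have "\<dots> \<le> card (rooted_embeddings J G (Inl a) v) + card ?N" by (rule card_Un_le)
  also have "card ?N \<le> card (verts J) ^ 2 * card ?T ^ (card (verts J) - 2)"
    using a by (intro card_rooted_noninjective_le finJ G) (simp add: J_def verts_vertex_join)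
  finally show "card (rooted_embeddings H1 G a v) * card (rooted_embeddings H2 G b v)
      \<le> card (rooted_embeddings J G (Inl a) v)
          + card (verts J) ^ 2 * card (verts G) ^ (card (verts J) - 2)"
    by (simp add: cardQ card_cartesian_product)
qed

definition mean_on :: "'i set \<Rightarrow> ('i \<Rightarrow> real) \<Rightarrow> real" where
  "mean_on S x = (\<Sum>i\<in>S. x i) / real (card S)"

lemma mean_on_nonneg: "(\<And>v. v \<in> S \<Longrightarrow> 0 \<le> x v) \<Longrightarrow> 0 \<le> mean_on S x"
  unfolding mean_on_def by (intro divide_nonneg_nonneg sum_nonneg) auto

definition var_on :: "'i set \<Rightarrow> ('i \<Rightarrow> real) \<Rightarrow> real" where
  "var_on S x = mean_on S (\<lambda>i. (x i - mean_on S x)\<^sup>2)"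

lemma var_on_nonneg: "0 \<le> var_on S x"
  by (simp add: var_on_def mean_on_def sum_nonneg)

text \<open>The decomposition of the mean square error into variance and squared bias.\<close>

lemma mean_square_deviation:
  assumes "finite S" "S \<noteq> {}"
  shows "mean_on S (\<lambda>i. (x i - c)\<^sup>2) = var_on S x + (mean_on S x - c)\<^sup>2"
proof -
  define \<mu> where "\<mu> = mean_on S x"
  have n: "real (card S) \<noteq> 0" using assms by simp
  have s: "(\<Sum>i\<in>S. x i) = real (card S) * \<mu>" using n by (simp add: \<mu>_def mean_on_def)
  have "(\<Sum>i\<in>S. (x i - c)\<^sup>2) = (\<Sum>i\<in>S. (x i - \<mu>)\<^sup>2 + 2 * (\<mu> - c) * (x i) + (c\<^sup>2 - \<mu>\<^sup>2))"
    by (rule sum.cong) (auto simp: power2_eq_square algebra_simps)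
  also have "\<dots> = (\<Sum>i\<in>S. (x i - \<mu>)\<^sup>2) + 2 * (\<mu> - c) * (\<Sum>i\<in>S. x i) + real (card S) * (c\<^sup>2 - \<mu>\<^sup>2)"
    by (simp add: sum.distrib sum_distrib_left)
  also have "\<dots> = (\<Sum>i\<in>S. (x i - \<mu>)\<^sup>2) + real (card S) * (\<mu> - c)\<^sup>2"
    by (simp add: s power2_eq_square algebra_simps)
  finally show ?thesis
    using n by (simp add: var_on_def mean_on_def[of S "\<lambda>i. (x i - _)\<^sup>2"] \<mu>_def[symmetric] field_simps)
qed

lemma var_on_le_mean_square:
  assumes "finite S" "S \<noteq> {}"
  shows "var_on S x \<le> mean_on S (\<lambda>i. (x i - c)\<^sup>2)"
  by (simp add: mean_square_deviation[OF assms])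

lemma square_diff_triangle: "(x - z)\<^sup>2 \<le> 2 * (x - y)\<^sup>2 + 2 * (y - z)\<^sup>2" for x y z :: real
proof -
  have "0 \<le> ((x - y) - (y - z))\<^sup>2" by simp
  then show ?thesis by (simp add: power2_eq_square algebra_simps)
qed

text \<open>Used from right to left: if \<open>y\<close> has large variance and \<open>x\<close> is close to \<open>y\<close> in mean square,
  then \<open>x\<close> has large variance.\<close>

lemma var_on_perturb:
  assumes S: "finite S" "S \<noteq> {}"
  shows "var_on S y \<le> 2 * var_on S x + 2 * mean_on S (\<lambda>i. (x i - y i)\<^sup>2)"
proof -
  have "(y i - mean_on S x)\<^sup>2 \<le> 2 * (x i - mean_on S x)\<^sup>2 + 2 * (x i - y i)\<^sup>2" for i
    using square_diff_triangle[of "y i" "mean_on S x" "x i"] by (simp add: power2_commute)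
  then have "mean_on S (\<lambda>i. (y i - mean_on S x)\<^sup>2)
      \<le> mean_on S (\<lambda>i. 2 * (x i - mean_on S x)\<^sup>2 + 2 * (x i - y i)\<^sup>2)"
    unfolding mean_on_def by (intro divide_right_mono sum_mono) auto
  also have "\<dots> = 2 * var_on S x + 2 * mean_on S (\<lambda>i. (x i - y i)\<^sup>2)"
    by (simp add: mean_on_def var_on_def sum.distrib sum_distrib_left[symmetric] add_divide_distrib)
  finally show ?thesis using var_on_le_mean_square[OF S, of y "mean_on S x"] by simp
qed

text \<open>All choices of the root vertex in \<open>H\<close> are added up; the normalisation by \<open>n ^ (k - 1)\<close> is
  the number of maps with a prescribed root value.\<close>

definition rooted_density :: "'u sgraph \<Rightarrow> 'v sgraph \<Rightarrow> 'v \<Rightarrow> real" where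
  "rooted_density H G v =
     (\<Sum>a\<in>verts H. real (card (rooted_embeddings H G a v))) / real (card (verts G)) ^ (card (verts H) - 1)"

text \<open>Summing over the common root \<open>v\<close> turns products of rooted counts into the number of
  embeddings of the join.\<close>

lemma t_hat_vertex_join_approx:
  assumes H: "simple_graph H" and a: "a \<in> verts H" and b: "b \<in> verts H"
    and G: "finite (verts G)" "0 < card (verts G)"
    and k: "2 \<le> card (verts H)"
  defines "m \<equiv> 2 * card (verts H) - 1"
  assumes large: "2 * m ^ 2 \<le> card (verts G)"
  shows "\<bar>t_hat (vertex_join H a b H) G
      - (\<Sum>v\<in>verts G. real (card (rooted_embeddings H G a v)) * real (card (rooted_embeddings H G b v)))
          / real (card (verts G)) ^ m\<bar>
    \<le> 3 * real m ^ 2 / real (card (verts G))"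
proof -
  define J n where "J = vertex_join H a b H" and "n = card (verts G)"
  define S where "S = (\<Sum>v\<in>verts G. card (rooted_embeddings H G a v) * card (rooted_embeddings H G b v))"
  have n: "0 < n" using G by (simp add: n_def)
  have cJ: "card (verts J) = m"
    unfolding J_def m_def card_verts_vertex_join[OF H H a b] by simp
  have sJ: "simple_graph J" unfolding J_def by (rule simple_graph_vertex_join[OF H H])
  then have fJ: "finite (verts J)" by (simp add: simple_graph_def)
  have r: "Inl a \<in> verts J" using a by (simp add: J_def verts_vertex_join)
  have E: "card (embeddings J G) = (\<Sum>v\<in>verts G. card (rooted_embeddings J G (Inl a) v))"
    using sum_card_rooted_embeddings[OF fJ G(1) r] by simp
  note prod = rooted_embeddings_product[OF H H a b G(1), folded J_def]
  have lo: "card (embeddings J G) \<le> S"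
    unfolding E S_def by (rule sum_mono) (rule prod(1))
  have "S \<le> (\<Sum>v\<in>verts G. card (rooted_embeddings J G (Inl a) v) + m ^ 2 * n ^ (m - 2))"
    unfolding S_def n_def by (rule sum_mono) (rule prod(2)[unfolded cJ])
  also have "\<dots> = card (embeddings J G) + m ^ 2 * n ^ (m - 1)"
  proof -
    have "m - 1 = Suc (m - 2)" using k by (simp add: m_def)
    then show ?thesis by (simp add: sum.distrib E n_def)
  qed
  finally have hi: "real S \<le> real (card (embeddings J G)) + real m ^ 2 * real n ^ (m - 1)"
    by (simp flip: of_nat_power of_nat_mult of_nat_add)
  have nm: "real n ^ m = real n * real n ^ (m - 1)"
    using k by (cases m) (auto simp: m_def)
  have "real S / real n ^ m - real (card (embeddings J G)) / real n ^ m
      = (real S - real (card (embeddings J G))) / real n ^ m" by (simp add: diff_divide_distrib)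
  also have "\<dots> \<le> (real m ^ 2 * real n ^ (m - 1)) / real n ^ m"
    using hi by (intro divide_right_mono) auto
  also have "\<dots> = real m ^ 2 / real n" using n by (simp add: nm)
  finally have up: "real S / real n ^ m - real (card (embeddings J G)) / real n ^ m \<le> real m ^ 2 / real n" .
  have "real (card (embeddings J G)) / real n ^ m \<le> real S / real n ^ m"
    using lo by (intro divide_right_mono) auto
  moreover have "\<bar>t_hat J G - real (card (embeddings J G)) / real n ^ m\<bar> \<le> 2 * real m ^ 2 / real n"
    using t_hat_approx(1)[OF sJ G] large by (simp add: cJ n_def)
  moreover have "3 * real m ^ 2 / real n = 2 * real m ^ 2 / real n + real m ^ 2 / real n"
    by (simp add: add_divide_distrib[symmetric])
  ultimately have "\<bar>t_hat J G - real S / real n ^ m\<bar> \<le> 3 * real m ^ 2 / real n"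
    using up by linarith
  then show ?thesis by (simp add: S_def J_def n_def)
qed

text \<open>Up to \<open>O(1 / n)\<close>, the rooted density has mean \<open>card (verts H) * t_hat H G\<close> over the vertices of
  \<open>G\<close>, and its square has as mean the sum of the join densities. Thus the statistic is an
  empirical variance up to an error that is deterministic and uniform in the graph.\<close>

lemma R_stat_approx:
  assumes H: "simple_graph H" and k: "2 \<le> card (verts H)"
  obtains C N where "0 \<le> C" "0 < N"
    "\<And>G :: 'v sgraph. finite (verts G) \<Longrightarrow> N \<le> card (verts G) \<Longrightarrow>
       \<bar>R_stat H G - var_on (verts G) (rooted_density H G)\<bar> \<le> C / real (card (verts G))"
proof -
  define k where "k = card (verts H)"
  define m where "m = 2 * k - 1"
  define C where "C = real k ^ 2 * (3 * real m ^ 2) + real k ^ 2 * (6 * real k ^ 2)"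
  have fH: "finite (verts H)" using H by (simp add: simple_graph_def)
  have mk: "k \<le> m" "0 < m" "0 < k" using k by (auto simp: m_def k_def)
  have bound: "\<bar>R_stat H G - var_on (verts G) (rooted_density H G)\<bar> \<le> C / real (card (verts G))"
    if G: "finite (verts G)" and N: "2 * m ^ 2 \<le> card (verts G)" for G :: "'v sgraph"
  proof -
    define n where "n = card (verts G)"
    define I where "I = real (card (embeddings H G)) / real n ^ k"
    define S where "S = (\<lambda>a b. (\<Sum>v\<in>verts G. real (card (rooted_embeddings H G a v))
        * real (card (rooted_embeddings H G b v))) / real n ^ m)"
    have k2: "2 * k ^ 2 \<le> n" using N power_mono[OF mk(1) le0, of 2] unfolding n_def by linarith
    have "0 < m ^ 2" using mk(2) by simp
    then have npos: "0 < n" using N unfolding n_def by linarith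
    then have ne: "verts G \<noteq> {}" by (auto simp: n_def)
    have nk: "real n ^ k = real n ^ (k - 1) * real n"
      using mk(3) by (cases k) auto
    \<comment> \<open>The exponents of the two normalisations match: \<open>2 * k - 1 = 2 * (k - 1) + 1\<close>.\<close>
    have nm: "real n ^ m = (real n ^ (k - 1))\<^sup>2 * real n"
    proof -
      have "m = Suc (2 * (k - 1))" using mk(3) by (simp add: m_def)
      then show ?thesis by (simp add: power_mult[symmetric] mult.commute)
    qed
    have mean: "mean_on (verts G) (rooted_density H G) = real k * I"
    proof -
      have "(\<Sum>v\<in>verts G. \<Sum>a\<in>verts H. real (card (rooted_embeddings H G a v)))
          = (\<Sum>a\<in>verts H. real (\<Sum>v\<in>verts G. card (rooted_embeddings H G a v)))"
        by (subst sum.swap) simp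
      also have "\<dots> = (\<Sum>a\<in>verts H. real (card (embeddings H G)))"
        by (rule sum.cong[OF refl]) (simp only: sum_card_rooted_embeddings[OF fH G])
      also have "\<dots> = real k * real (card (embeddings H G))"
        by (simp add: k_def)
      finally show ?thesis
        by (simp add: mean_on_def rooted_density_def I_def nk sum_divide_distrib[symmetric]
            n_def[symmetric] k_def[symmetric])
    qed
    have sq: "mean_on (verts G) (\<lambda>v. (rooted_density H G v)\<^sup>2) = (\<Sum>a\<in>verts H. \<Sum>b\<in>verts H. S a b)"
    proof -
      have "(\<Sum>v\<in>verts G. (\<Sum>a\<in>verts H. real (card (rooted_embeddings H G a v)))\<^sup>2)
          = (\<Sum>v\<in>verts G. \<Sum>a\<in>verts H. \<Sum>b\<in>verts H. real (card (rooted_embeddings H G a v))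
              * real (card (rooted_embeddings H G b v)))"
        by (simp add: power2_eq_square sum_product)
      also have "\<dots> = (\<Sum>a\<in>verts H. \<Sum>v\<in>verts G. \<Sum>b\<in>verts H. real (card (rooted_embeddings H G a v))
              * real (card (rooted_embeddings H G b v)))" by (rule sum.swap)
      also have "\<dots> = (\<Sum>a\<in>verts H. \<Sum>b\<in>verts H. \<Sum>v\<in>verts G. real (card (rooted_embeddings H G a v))
              * real (card (rooted_embeddings H G b v)))"
        by (intro sum.cong[OF refl] sum.swap)
      finally show ?thesis
        by (simp add: mean_on_def rooted_density_def S_def nm power_divide sum_divide_distrib[symmetric]
            n_def[symmetric] k_def[symmetric])
    qed
    have var: "var_on (verts G) (rooted_density H G) = (\<Sum>a\<in>verts H. \<Sum>b\<in>verts H. S a b) - real k ^ 2 * I ^ 2"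
      using mean_square_deviation[OF G ne, of "rooted_density H G" 0]
      by (simp add: mean sq power_mult_distrib)
    have join: "\<bar>t_hat (vertex_join H a b H) G - S a b\<bar> \<le> 3 * real m ^ 2 / real n"
      if "a \<in> verts H" "b \<in> verts H" for a b
      using t_hat_vertex_join_approx[OF H that G _ k] npos N
      by (simp add: S_def n_def m_def k_def)
    have "\<bar>(\<Sum>a\<in>verts H. \<Sum>b\<in>verts H. t_hat (vertex_join H a b H) G) - (\<Sum>a\<in>verts H. \<Sum>b\<in>verts H. S a b)\<bar>
        = \<bar>\<Sum>a\<in>verts H. \<Sum>b\<in>verts H. t_hat (vertex_join H a b H) G - S a b\<bar>"
      by (simp add: sum_subtractf)
    also have "\<dots> \<le> (\<Sum>a\<in>verts H. \<bar>\<Sum>b\<in>verts H. t_hat (vertex_join H a b H) G - S a b\<bar>)"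
      by (rule sum_abs)
    also have "\<dots> \<le> (\<Sum>a\<in>verts H. \<Sum>b\<in>verts H. \<bar>t_hat (vertex_join H a b H) G - S a b\<bar>)"
      by (intro sum_mono sum_abs)
    also have "\<dots> \<le> (\<Sum>a\<in>verts H. \<Sum>b\<in>verts H. 3 * real m ^ 2 / real n)"
      by (intro sum_mono join)
    also have "\<dots> = real k ^ 2 * (3 * real m ^ 2) / real n"
      by (simp add: k_def power2_eq_square)
    finally have 1: "\<bar>(\<Sum>a\<in>verts H. \<Sum>b\<in>verts H. t_hat (vertex_join H a b H) G)
        - (\<Sum>a\<in>verts H. \<Sum>b\<in>verts H. S a b)\<bar> \<le> real k ^ 2 * (3 * real m ^ 2) / real n" .
    have tI: "\<bar>t_hat H G - I\<bar> \<le> 2 * real k ^ 2 / real n" "I \<le> 1"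
      using t_hat_approx[OF H G] npos k2 by (auto simp: n_def k_def I_def)
    have I0: "0 \<le> I" by (simp add: I_def)
    have "real (2 * k ^ 2) \<le> real n" using k2 unfolding of_nat_le_iff .
    then have "2 * real k ^ 2 / real n \<le> 1" using npos by simp
    with tI I0 have "\<bar>t_hat H G + I\<bar> \<le> 3" by linarith
    moreover have "(t_hat H G)\<^sup>2 - I\<^sup>2 = (t_hat H G - I) * (t_hat H G + I)"
      by (simp add: power2_eq_square algebra_simps)
    ultimately have "\<bar>(t_hat H G)\<^sup>2 - I\<^sup>2\<bar> \<le> 2 * real k ^ 2 / real n * 3"
      using tI by (simp only: abs_mult) (intro mult_mono, auto)
    then have "real k ^ 2 * \<bar>(t_hat H G)\<^sup>2 - I\<^sup>2\<bar> \<le> real k ^ 2 * (2 * real k ^ 2 / real n * 3)"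
      by (rule mult_left_mono) simp
    then have 2: "\<bar>real k ^ 2 * (t_hat H G)\<^sup>2 - real k ^ 2 * I\<^sup>2\<bar> \<le> real k ^ 2 * (6 * real k ^ 2) / real n"
      by (simp add: abs_mult right_diff_distrib[symmetric])
    show ?thesis
      using 1 2 unfolding R_stat_def var C_def n_def[symmetric] k_def[symmetric] add_divide_distrib
      by linarith
  qed
  show ?thesis
    by (rule that[of C "2 * m ^ 2"]) (use bound mk in \<open>auto simp: C_def\<close>)
qed

section \<open>Embedding indicators given the vertex labels\<close>

lemma (in prob_space) integrable_bounded:
  fixes f :: "'a \<Rightarrow> real"
  assumes "f \<in> borel_measurable M" "\<And>x. x \<in> space M \<Longrightarrow> \<bar>f x\<bar> \<le> B"
  shows "integrable M f"
  using assms by (intro integrable_const_bound[of _ B] AE_I2) auto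

lemma graphon_sym: "graphon W \<Longrightarrow> x \<in> {0..1} \<Longrightarrow> y \<in> {0..1} \<Longrightarrow> W x y = W y x"
  and graphon_nonneg: "graphon W \<Longrightarrow> x \<in> {0..1} \<Longrightarrow> y \<in> {0..1} \<Longrightarrow> 0 \<le> W x y"
  and graphon_le_1: "graphon W \<Longrightarrow> x \<in> {0..1} \<Longrightarrow> y \<in> {0..1} \<Longrightarrow> W x y \<le> 1"
  by (simp_all add: graphon_def)

lemma edge_prod_cong:
  assumes "simple_graph H" "\<And>c. c \<in> verts H \<Longrightarrow> x c = y c"
  shows "edge_prod H W x = edge_prod H W y"
  unfolding edge_prod_def using assms
  by (intro prod.cong refl) (auto simp: simple_graph_def)

lemma integral_U01_threshold:
  assumes "0 \<le> s" "s \<le> 1"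
  shows "(LINT y|U01. of_bool (y \<le> s)) = (s :: real)"
proof -
  interpret prob_space U01 by (rule prob_space_U01)
  have "(LINT y|U01. of_bool (y \<le> s)) = (LINT y|U01. indicator {0..s} y :: real)"
    by (intro Bochner_Integration.integral_cong) (auto simp: space_U01 indicator_def)
  also have "\<dots> = measure U01 {0..s}"
    using assms by (simp add: space_U01 Int_absorb2)
  also have "\<dots> = s"
    using assms by (simp add: U01_def measure_restrict_space)
  finally show ?thesis .
qed

lemma measurable_of_bool_le_U01: "(\<lambda>y. of_bool (y \<le> s)) \<in> borel_measurable U01"
  unfolding U01_def by (rule measurable_restrict_space1) simp

text \<open>Independence of the variables \<open>Y p\<close>, each of which lies below \<open>s p\<close> with probability
  \<open>s p\<close>.\<close>

lemma integral_PiM_thresholds: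
  assumes I: "finite I" and S: "S \<subseteq> I" and s: "\<And>p. p \<in> S \<Longrightarrow> 0 \<le> s p \<and> s p \<le> 1"
  shows "(LINT Y|(\<Pi>\<^sub>M p\<in>I. U01). (\<Prod>p\<in>S. of_bool (Y p \<le> s p))) = (\<Prod>p\<in>S. s p :: real)"
proof -
  interpret U: prob_space U01 by (rule prob_space_U01)
  interpret product_sigma_finite "\<lambda>_. U01" by standard
  let ?f = "\<lambda>p y. if p \<in> S then of_bool (y \<le> s p) else (1 :: real)"
  have restr: "prod g S = (\<Prod>p\<in>I. if p \<in> S then g p else 1)" for g :: "'a \<Rightarrow> real"
    using prod.inter_restrict[OF I, of g S] S by (simp add: Int_absorb1)
  have "(LINT Y|(\<Pi>\<^sub>M p\<in>I. U01). (\<Prod>p\<in>S. of_bool (Y p \<le> s p)))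
      = (LINT Y|(\<Pi>\<^sub>M p\<in>I. U01). (\<Prod>p\<in>I. ?f p (Y p)))"
    by (intro Bochner_Integration.integral_cong refl) (rule restr)
  also have "\<dots> = (\<Prod>p\<in>I. LINT y|U01. ?f p y)"
  proof (rule product_integral_prod[OF I])
    fix p show "integrable U01 (?f p)"
      by (rule U.integrable_bounded[of _ 1]) (cases "p \<in> S"; auto simp: measurable_of_bool_le_U01)+
  qed
  also have "\<dots> = (\<Prod>p\<in>I. if p \<in> S then s p else 1)"
    by (rule prod.cong) (auto simp: integral_U01_threshold s U.prob_space)
  also have "\<dots> = (\<Prod>p\<in>S. s p)"
    by (rule restr[symmetric])
  finally show ?thesis .
qed

definition ordered_edges :: "'v::linorder sgraph \<Rightarrow> ('v \<times> 'v) set" where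
  "ordered_edges H = {(c, d). c < d \<and> {c, d} \<in> edges H}"

text \<open>The index of the edge variable that decides whether \<open>i\<close> and \<open>j\<close> are adjacent.\<close>

definition sorted_pair :: "nat \<Rightarrow> nat \<Rightarrow> nat \<times> nat" where
  "sorted_pair i j = (min i j, max i j)"

text \<open>The indices of the edge variables that decide whether \<open>\<phi>\<close> is an embedding.\<close>

definition image_edges :: "'v::linorder sgraph \<Rightarrow> ('v \<Rightarrow> nat) \<Rightarrow> (nat \<times> nat) set" where
  "image_edges H \<phi> = (\<lambda>(c, d). sorted_pair (\<phi> c) (\<phi> d)) ` ordered_edges H"

lemma ordered_edges_verts:
  assumes "simple_graph H" "(c, d) \<in> ordered_edges H"
  shows "c \<in> verts H" "d \<in> verts H" "c < d" "{c, d} \<in> edges H"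
  using assms by (auto simp: simple_graph_def ordered_edges_def)

lemma edges_eq_ordered_edges:
  assumes "simple_graph H"
  shows "edges H = (\<lambda>(c, d). {c, d}) ` ordered_edges H"
proof (intro equalityI subsetI)
  fix e assume e: "e \<in> edges H"
  then have "card e = 2" using assms by (auto simp: simple_graph_def)
  then obtain c d where cd: "e = {c, d}" "c \<noteq> d" by (auto simp: card_2_iff)
  then have "(c, d) \<in> ordered_edges H \<or> (d, c) \<in> ordered_edges H"
    using e by (cases "c < d") (auto simp: ordered_edges_def insert_commute)
  then show "e \<in> (\<lambda>(c, d). {c, d}) ` ordered_edges H"
    unfolding cd(1) by (auto simp: image_iff insert_commute)
qed (auto simp: ordered_edges_def)

lemma edge_sample_graph_iff:
  assumes "i \<in> {1..n}" "j \<in> {1..n}" "i \<noteq> j"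
  shows "{i, j} \<in> edges (sample_graph n W U Y) \<longleftrightarrow>
    Y (sorted_pair i j) \<le> W (U (fst (sorted_pair i j))) (U (snd (sorted_pair i j)))"
proof (cases "i < j")
  case True
  then show ?thesis
    using assms by (force simp: sample_graph_def index_pairs_def sorted_pair_def doubleton_eq_iff)
next
  case False
  then have "j < i" using assms by simp
  then show ?thesis
    using assms by (force simp: sample_graph_def index_pairs_def sorted_pair_def doubleton_eq_iff)
qed

lemma verts_sample_graph: "verts (sample_graph n W U Y) = {1..n}"
  by (simp add: sample_graph_def)

context
  fixes H :: "'v::linorder sgraph" and n :: nat and \<phi> :: "'v \<Rightarrow> nat"
  assumes H: "simple_graph H" and \<phi>: "\<phi> \<in> verts H \<rightarrow>\<^sub>E {1..n}" and inj: "inj_on \<phi> (verts H)"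
begin

lemma finite_ordered_edges: "finite (ordered_edges H)"
  by (rule finite_subset[of _ "verts H \<times> verts H"])
    (use H ordered_edges_verts[OF H] in \<open>auto simp: simple_graph_def\<close>)

lemma image_edges_subset: "image_edges H \<phi> \<subseteq> index_pairs n"
proof
  fix p assume "p \<in> image_edges H \<phi>"
  then obtain c d where cd: "(c, d) \<in> ordered_edges H" and p: "p = sorted_pair (\<phi> c) (\<phi> d)"
    by (auto simp: image_edges_def)
  note v = ordered_edges_verts[OF H cd]
  have "\<phi> c \<noteq> \<phi> d" using inj_onD[OF inj _ v(1,2)] v(3) by auto
  moreover have "\<phi> c \<in> {1..n}" "\<phi> d \<in> {1..n}" using \<phi> v by auto
  ultimately show "p \<in> index_pairs n"
    by (auto simp: p sorted_pair_def index_pairs_def min_def max_def)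
qed

lemma image_edges_verts:
  assumes "p \<in> image_edges H \<phi>"
  shows "fst p \<in> \<phi> ` verts H" "snd p \<in> \<phi> ` verts H"
  using assms ordered_edges_verts[OF H]
  by (auto simp: image_edges_def sorted_pair_def min_def max_def)

lemma inj_on_image_edges: "inj_on (\<lambda>(c, d). sorted_pair (\<phi> c) (\<phi> d)) (ordered_edges H)"
proof (rule inj_onI, clarify)
  fix c d c' d' assume cd: "(c, d) \<in> ordered_edges H" and cd': "(c', d') \<in> ordered_edges H"
    and eq: "sorted_pair (\<phi> c) (\<phi> d) = sorted_pair (\<phi> c') (\<phi> d')"
  note v = ordered_edges_verts[OF H cd] and v' = ordered_edges_verts[OF H cd']
  have "(\<phi> c = \<phi> c' \<and> \<phi> d = \<phi> d') \<or> (\<phi> c = \<phi> d' \<and> \<phi> d = \<phi> c')"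
    using eq by (auto simp: sorted_pair_def min_def max_def split: if_splits)
  then have "(c = c' \<and> d = d') \<or> (c = d' \<and> d = c')"
    using inj_onD[OF inj] v v' by blast
  then show "c = c' \<and> d = d'" using v(3) v'(3) by auto
qed

lemma embedding_indicator:
  "of_bool (\<phi> \<in> embeddings H (sample_graph n W U Y))
    = (\<Prod>p\<in>image_edges H \<phi>. of_bool (Y p \<le> W (U (fst p)) (U (snd p))) :: real)"
proof -
  let ?G = "sample_graph n W U Y"
  have fin: "finite (image_edges H \<phi>)" using finite_ordered_edges by (simp add: image_edges_def)
  have e: "\<phi> ` {c, d} \<in> edges ?G \<longleftrightarrow>
      Y (sorted_pair (\<phi> c) (\<phi> d)) \<le> W (U (fst (sorted_pair (\<phi> c) (\<phi> d)))) (U (snd (sorted_pair (\<phi> c) (\<phi> d))))"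
    if cd: "(c, d) \<in> ordered_edges H" for c d
  proof -
    note v = ordered_edges_verts[OF H cd]
    have "\<phi> c \<noteq> \<phi> d" using inj_onD[OF inj _ v(1,2)] v(3) by auto
    moreover have "\<phi> c \<in> {1..n}" "\<phi> d \<in> {1..n}" using \<phi> v by auto
    ultimately have "{\<phi> c, \<phi> d} \<in> edges ?G \<longleftrightarrow>
      Y (sorted_pair (\<phi> c) (\<phi> d)) \<le> W (U (fst (sorted_pair (\<phi> c) (\<phi> d)))) (U (snd (sorted_pair (\<phi> c) (\<phi> d))))"
      by (intro edge_sample_graph_iff)
    then show ?thesis by simp
  qed
  have "(\<forall>e\<in>edges H. \<phi> ` e \<in> edges ?G) \<longleftrightarrow> (\<forall>(c, d)\<in>ordered_edges H. \<phi> ` {c, d} \<in> edges ?G)"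
    by (simp add: edges_eq_ordered_edges[OF H] split_beta)
  also have "\<dots> \<longleftrightarrow> (\<forall>p\<in>image_edges H \<phi>. Y p \<le> W (U (fst p)) (U (snd p)))"
    using e by (auto simp: image_edges_def)
  finally have *: "\<phi> \<in> embeddings H ?G \<longleftrightarrow> (\<forall>p\<in>image_edges H \<phi>. Y p \<le> W (U (fst p)) (U (snd p)))"
    using \<phi> inj by (simp add: embeddings_def verts_sample_graph)
  show ?thesis
  proof (cases "\<phi> \<in> embeddings H ?G")
    case True
    then show ?thesis using * by (auto intro!: prod.neutral[symmetric])
  next
    case False
    then obtain p where "p \<in> image_edges H \<phi>" "\<not> Y p \<le> W (U (fst p)) (U (snd p))" using * by auto
    then have "(\<Prod>p\<in>image_edges H \<phi>. of_bool (Y p \<le> W (U (fst p)) (U (snd p))) :: real) = 0"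
      using fin by (intro prod_zero) (auto intro!: bexI[of _ p])
    then show ?thesis using False by simp
  qed
qed

text \<open>An embedding need not be monotone; where it reverses an edge, symmetry of \<open>W\<close> is needed.\<close>

lemma prod_image_edges:
  assumes W: "graphon W" and U: "\<And>i. i \<in> {1..n} \<Longrightarrow> U i \<in> {0..1}"
  shows "(\<Prod>p\<in>image_edges H \<phi>. W (U (fst p)) (U (snd p))) = edge_prod H W (U \<circ> \<phi>)"
proof -
  have "(\<Prod>p\<in>image_edges H \<phi>. W (U (fst p)) (U (snd p)))
      = (\<Prod>q\<in>ordered_edges H. case q of (c, d) \<Rightarrow>
          W (U (fst (sorted_pair (\<phi> c) (\<phi> d)))) (U (snd (sorted_pair (\<phi> c) (\<phi> d)))))"
    unfolding image_edges_def
    by (subst prod.reindex[OF inj_on_image_edges]) (auto intro!: prod.cong)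
  also have "\<dots> = (\<Prod>(c, d)\<in>ordered_edges H. W (U (\<phi> c)) (U (\<phi> d)))"
  proof (rule prod.cong[OF refl], clarify)
    fix c d assume cd: "(c, d) \<in> ordered_edges H"
    have "U (\<phi> c) \<in> {0..1}" "U (\<phi> d) \<in> {0..1}"
      by (intro U PiE_mem[OF \<phi>] ordered_edges_verts[OF H cd])+
    then show "W (U (fst (sorted_pair (\<phi> c) (\<phi> d)))) (U (snd (sorted_pair (\<phi> c) (\<phi> d))))
        = W (U (\<phi> c)) (U (\<phi> d))"
      using graphon_sym[OF W] by (auto simp: sorted_pair_def min_def max_def)
  qed
  finally show ?thesis by (simp add: edge_prod_def ordered_edges_def)
qed

end

text \<open>Maps whose images share at most one vertex use disjoint sets of edge variables, so the two
  embedding indicators are conditionally independent given the labels.\<close>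

lemma integral_edges_embeddings:
  assumes W: "graphon W" and H: "simple_graph H"
    and \<phi>: "\<phi> \<in> verts H \<rightarrow>\<^sub>E {1..n}" "inj_on \<phi> (verts H)"
    and \<psi>: "\<psi> \<in> verts H \<rightarrow>\<^sub>E {1..n}" "inj_on \<psi> (verts H)"
    and meet: "\<phi> ` verts H \<inter> \<psi> ` verts H \<subseteq> {v}"
    and U: "\<And>i. i \<in> {1..n} \<Longrightarrow> U i \<in> {0..1}"
  shows "(LINT Y|(\<Pi>\<^sub>M p\<in>index_pairs n. U01). of_bool (\<phi> \<in> embeddings H (sample_graph n W U Y)))
      = edge_prod H W (U \<circ> \<phi>)"
    and "(LINT Y|(\<Pi>\<^sub>M p\<in>index_pairs n. U01). of_bool (\<phi> \<in> embeddings H (sample_graph n W U Y))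
          * of_bool (\<psi> \<in> embeddings H (sample_graph n W U Y)))
      = edge_prod H W (U \<circ> \<phi>) * edge_prod H W (U \<circ> \<psi>)"
proof -
  note sub1 = image_edges_subset[OF H \<phi>] and sub2 = image_edges_subset[OF H \<psi>]
  note fin = finite_subset[OF sub1 finite_index_pairs] finite_subset[OF sub2 finite_index_pairs]
  have s: "0 \<le> W (U (fst p)) (U (snd p)) \<and> W (U (fst p)) (U (snd p)) \<le> 1" if "p \<in> index_pairs n" for p
  proof -
    have "U (fst p) \<in> {0..1}" "U (snd p) \<in> {0..1}"
      by (rule U; use that in \<open>auto simp: index_pairs_def\<close>)+
    then show ?thesis using graphon_nonneg[OF W] graphon_le_1[OF W] by blast
  qed
  have w1: "edge_prod H W (U \<circ> \<phi>) = (\<Prod>p\<in>image_edges H \<phi>. W (U (fst p)) (U (snd p)))"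
    by (rule prod_image_edges[OF H \<phi> W, symmetric]) (rule U)
  have w2: "edge_prod H W (U \<circ> \<psi>) = (\<Prod>p\<in>image_edges H \<psi>. W (U (fst p)) (U (snd p)))"
    by (rule prod_image_edges[OF H \<psi> W, symmetric]) (rule U)
  show "(LINT Y|(\<Pi>\<^sub>M p\<in>index_pairs n. U01). of_bool (\<phi> \<in> embeddings H (sample_graph n W U Y)))
      = edge_prod H W (U \<circ> \<phi>)"
    unfolding embedding_indicator[OF H \<phi>] w1
    by (rule integral_PiM_thresholds[OF finite_index_pairs sub1]) (use s sub1 in blast)
  \<comment> \<open>A common edge would need two common vertices.\<close>
  have disj: "image_edges H \<phi> \<inter> image_edges H \<psi> = {}"
  proof (rule ccontr)
    assume "image_edges H \<phi> \<inter> image_edges H \<psi> \<noteq> {}"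
    then obtain p where p: "p \<in> image_edges H \<phi>" "p \<in> image_edges H \<psi>" by auto
    have "fst p = v" "snd p = v"
      using image_edges_verts[OF H \<phi> p(1)] image_edges_verts[OF H \<psi> p(2)] meet by auto
    moreover have "fst p < snd p" using p(1) sub1 by (auto simp: index_pairs_def)
    ultimately show False by simp
  qed
  show "(LINT Y|(\<Pi>\<^sub>M p\<in>index_pairs n. U01). of_bool (\<phi> \<in> embeddings H (sample_graph n W U Y))
          * of_bool (\<psi> \<in> embeddings H (sample_graph n W U Y)))
      = edge_prod H W (U \<circ> \<phi>) * edge_prod H W (U \<circ> \<psi>)"
    unfolding embedding_indicator[OF H \<phi>] embedding_indicator[OF H \<psi>] w1 w2
      prod.union_disjoint[OF fin disj, symmetric]
    by (rule integral_PiM_thresholds[OF finite_index_pairs]) (use s sub1 sub2 in blast)+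
qed

lemma measurable_edge_prod_rooted:
  assumes W: "graphon W" and H: "simple_graph H" and a: "a \<in> verts H"
  shows "(\<lambda>(x, u). edge_prod H W (u(a := x))) \<in> borel_measurable (U01 \<Otimes>\<^sub>M (\<Pi>\<^sub>M c\<in>verts H - {a}. U01))"
proof -
  have "(\<lambda>(x, v). v(a := x)) \<in> U01 \<Otimes>\<^sub>M (\<Pi>\<^sub>M c\<in>verts H - {a}. U01) \<rightarrow>\<^sub>M (\<Pi>\<^sub>M c\<in>verts H. U01)"
    unfolding split_beta' by (rule measurable_fun_upd[where J = "verts H - {a}"]) (use a in auto)
  from measurable_compose[OF this measurable_edge_prod[OF W H]] show ?thesis
    by (simp add: split_beta')
qed

lemma measurable_hom_density_at:
  assumes W: "graphon W" and H: "simple_graph H" and a: "a \<in> verts H"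
  shows "(\<lambda>x. hom_density_at a x H W) \<in> borel_measurable U01"
proof -
  interpret Q: prob_space "\<Pi>\<^sub>M c\<in>verts H - {a}. U01" by (intro prob_space_PiM prob_space_U01)
  show ?thesis
    unfolding hom_density_at_def
    using measurable_edge_prod_rooted[OF assms] by (intro Q.borel_measurable_lebesgue_integral)
qed

lemma edge_prod_rooted:
  assumes W: "graphon W" and H: "simple_graph H" and a: "a \<in> verts H" and x: "x \<in> {0..1}"
  shows "(\<lambda>u. edge_prod H W (u(a := x))) \<in> borel_measurable (\<Pi>\<^sub>M c\<in>verts H - {a}. U01)"
    and "u \<in> space (\<Pi>\<^sub>M c\<in>verts H - {a}. U01) \<Longrightarrow> 0 \<le> edge_prod H W (u(a := x)) \<and> edge_prod H W (u(a := x)) \<le> 1"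
proof -
  show "(\<lambda>u. edge_prod H W (u(a := x))) \<in> borel_measurable (\<Pi>\<^sub>M c\<in>verts H - {a}. U01)"
    using measurable_compose[OF measurable_Pair1'[of x U01] measurable_edge_prod_rooted[OF W H a]] x
    by (simp add: space_U01)
  assume "u \<in> space (\<Pi>\<^sub>M c\<in>verts H - {a}. U01)"
  then have "u(a := x) \<in> space (\<Pi>\<^sub>M c\<in>verts H. U01)"
    using x a by (auto simp: space_PiM space_U01 PiE_iff extensional_def)
  then show "0 \<le> edge_prod H W (u(a := x)) \<and> edge_prod H W (u(a := x)) \<le> 1"
    using edge_prod_bounds[OF W H] by blast
qed

lemma hom_density_at_bounds:
  assumes W: "graphon W" and H: "simple_graph H" and a: "a \<in> verts H" and x: "x \<in> {0..1}"
  shows "0 \<le> hom_density_at a x H W" "hom_density_at a x H W \<le> 1"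
proof -
  interpret Q: prob_space "\<Pi>\<^sub>M c\<in>verts H - {a}. U01" by (intro prob_space_PiM prob_space_U01)
  note e = edge_prod_rooted[OF W H a x]
  show "0 \<le> hom_density_at a x H W"
    unfolding hom_density_at_def using e(2) by (intro integral_nonneg_AE AE_I2) auto
  have "integrable (\<Pi>\<^sub>M c\<in>verts H - {a}. U01) (\<lambda>u. edge_prod H W (u(a := x)))"
    using e(2) by (intro Q.integrable_bounded[of _ 1] e(1)) fastforce
  then have "hom_density_at a x H W \<le> (LINT u|(\<Pi>\<^sub>M c\<in>verts H - {a}. U01). 1)"
    unfolding hom_density_at_def using e(2) by (intro integral_mono) auto
  then show "hom_density_at a x H W \<le> 1" by (simp add: Q.prob_space)
qed

text \<open>The tower property, in the form of Fubini for splitting off the coordinate \<open>a\<close>.\<close>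

lemma integral_hom_density_at:
  assumes W: "graphon W" and H: "simple_graph H" and a: "a \<in> verts H"
  shows "(LINT x|U01. hom_density_at a x H W) = hom_density H W"
proof -
  let ?P = "\<Pi>\<^sub>M c\<in>verts H. U01" and ?Q = "\<Pi>\<^sub>M c\<in>verts H - {a}. U01"
  interpret U: prob_space U01 by (rule prob_space_U01)
  interpret Q: prob_space ?Q by (intro prob_space_PiM prob_space_U01)
  interpret UQ: pair_prob_space U01 ?Q ..
  have ins: "insert a (verts H - {a}) = verts H" using a by auto
  have upd: "(\<lambda>(x, v). v(a := x)) \<in> U01 \<Otimes>\<^sub>M ?Q \<rightarrow>\<^sub>M ?P"
    unfolding split_beta' by (rule measurable_fun_upd[where J = "verts H - {a}"]) (use a in auto)
  have distr: "distr (U01 \<Otimes>\<^sub>M ?Q) ?P (\<lambda>(x, v). v(a := x)) = ?P"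
    using distr_pair_PiM_eq_PiM[of "verts H - {a}" "\<lambda>_. U01" a]
    unfolding ins by (simp add: prob_space_U01)
  have int: "integrable (U01 \<Otimes>\<^sub>M ?Q) (\<lambda>(x, u). edge_prod H W (u(a := x)))"
  proof (rule UQ.integrable_bounded[of _ 1])
    show "(\<lambda>(x, u). edge_prod H W (u(a := x))) \<in> borel_measurable (U01 \<Otimes>\<^sub>M ?Q)"
      by (rule measurable_edge_prod_rooted[OF W H a])
    fix z assume "z \<in> space (U01 \<Otimes>\<^sub>M ?Q)"
    then show "\<bar>case z of (x, u) \<Rightarrow> edge_prod H W (u(a := x))\<bar> \<le> 1"
      using edge_prod_rooted(2)[OF W H a, of "fst z" "snd z"]
      by (auto simp: space_pair_measure space_U01)
  qed
  have "hom_density H W = (LINT u|distr (U01 \<Otimes>\<^sub>M ?Q) ?P (\<lambda>(x, v). v(a := x)). edge_prod H W u)"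
    by (simp add: distr hom_density_def)
  also have "\<dots> = (LINT z|(U01 \<Otimes>\<^sub>M ?Q). edge_prod H W ((\<lambda>(x, v). v(a := x)) z))"
    by (rule integral_distr[OF upd measurable_edge_prod[OF W H]])
  also have "\<dots> = (LINT z|(U01 \<Otimes>\<^sub>M ?Q). (case z of (x, u) \<Rightarrow> edge_prod H W (u(a := x))))"
    by (simp add: split_beta')
  also have "\<dots> = (LINT x|U01. LINT u|?Q. edge_prod H W (u(a := x)))"
    using UQ.integral_fst'[OF int] by simp
  finally show ?thesis by (simp add: hom_density_at_def)
qed

section \<open>The probability space of labels\<close>

definition sample_space :: "nat \<Rightarrow> ((nat \<Rightarrow> real) \<times> (nat \<times> nat \<Rightarrow> real)) measure" where
  "sample_space n = (\<Pi>\<^sub>M i\<in>{1..n}. U01) \<Otimes>\<^sub>M (\<Pi>\<^sub>M p\<in>index_pairs n. U01)"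

lemma prob_space_sample_space: "prob_space (sample_space n)"
proof -
  interpret A: prob_space "\<Pi>\<^sub>M i\<in>{1..n}. U01" by (intro prob_space_PiM prob_space_U01)
  interpret B: prob_space "\<Pi>\<^sub>M p\<in>index_pairs n. U01" by (intro prob_space_PiM prob_space_U01)
  interpret AB: pair_prob_space "\<Pi>\<^sub>M i\<in>{1..n}. U01" "\<Pi>\<^sub>M p\<in>index_pairs n. U01" ..
  show ?thesis unfolding sample_space_def by (rule AB.prob_space_axioms)
qed

lemma space_vertex_labels:
  assumes "U \<in> space (\<Pi>\<^sub>M i\<in>I. U01)" "i \<in> I"
  shows "U i \<in> {0..1}"
  using assms by (auto simp: space_PiM space_U01 PiE_iff)

lemma measurable_vertex_label:
  assumes "v \<in> {1..n}"
  shows "(\<lambda>\<omega>. fst \<omega> v) \<in> sample_space n \<rightarrow>\<^sub>M U01"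
  unfolding sample_space_def
  by (rule measurable_compose[OF measurable_fst measurable_component_singleton[OF assms]])

lemma vertex_label_in_unit:
  assumes "\<omega> \<in> space (sample_space n)" "v \<in> {1..n}"
  shows "fst \<omega> v \<in> {0..1}"
  using measurable_space[OF measurable_vertex_label[OF assms(2)] assms(1)] by (simp add: space_U01)

lemma measurable_sample_graph':
  assumes W: "graphon W"
  shows "(\<lambda>\<omega>. f (sample_graph n W (fst \<omega>) (snd \<omega>))) \<in> borel_measurable (sample_space n)"
  using measurable_compose[OF measurable_sample_graph[OF W], of f borel]
  by (simp add: split_beta' sample_space_def)

section \<open>Orthogonality of centred embedding indicators\<close>

text \<open>For an injective \<open>\<phi>\<close> with \<open>\<phi> a = v\<close>, the subtracted term is the conditional expectation
  of the indicator given the label of \<open>v\<close>. The definition makes sense for every \<open>\<phi>\<close>, which later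
  allows sums over all maps rooted at \<open>v\<close>.\<close>

definition centred_embedding ::
    "nat \<Rightarrow> (real \<Rightarrow> real \<Rightarrow> real) \<Rightarrow> 'v::linorder sgraph \<Rightarrow> 'v \<Rightarrow> nat \<Rightarrow> ('v \<Rightarrow> nat)
     \<Rightarrow> (nat \<Rightarrow> real) \<times> (nat \<times> nat \<Rightarrow> real) \<Rightarrow> real" where
  "centred_embedding n W H a v \<phi> \<omega> =
     of_bool (\<phi> \<in> embeddings H (sample_graph n W (fst \<omega>) (snd \<omega>))) - hom_density_at a (fst \<omega> v) H W"

lemma measurable_centred_embedding:
  assumes W: "graphon W" and H: "simple_graph H" and a: "a \<in> verts H" and v: "v \<in> {1..n}"
  shows "centred_embedding n W H a v \<phi> \<in> borel_measurable (sample_space n)"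
  unfolding centred_embedding_def[abs_def]
  using measurable_sample_graph'[OF W, of "\<lambda>G. of_bool (\<phi> \<in> embeddings H G)"]
    measurable_compose[OF measurable_vertex_label[OF v] measurable_hom_density_at[OF W H a]]
  by (rule borel_measurable_diff)

lemma centred_embedding_bound:
  assumes W: "graphon W" and H: "simple_graph H" and a: "a \<in> verts H" and v: "v \<in> {1..n}"
    and \<omega>: "\<omega> \<in> space (sample_space n)"
  shows "\<bar>centred_embedding n W H a v \<phi> \<omega>\<bar> \<le> 1"
  using hom_density_at_bounds[OF W H a vertex_label_in_unit[OF \<omega> v]]
  by (auto simp: centred_embedding_def of_bool_def)

text \<open>Relabelling the integration variables along the injection \<open>\<phi>\<close>.\<close>

lemma integral_embedding_given_root:
  assumes W: "graphon W" and H: "simple_graph H" and a: "a \<in> verts H"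
    and \<phi>: "inj_on \<phi> (verts H)" and x: "x \<in> {0..1}"
  shows "(LINT y|(\<Pi>\<^sub>M j\<in>\<phi> ` (verts H - {a}). U01). edge_prod H W ((y \<circ> \<phi>)(a := x))) = hom_density_at a x H W"
proof -
  let ?V = "verts H - {a}"
  let ?J = "\<phi> ` ?V"
  let ?r = "\<lambda>y. \<lambda>c\<in>?V. y (\<phi> c)"
  have inj: "inj_on \<phi> ?V" using \<phi> by (rule inj_on_subset) auto
  have distr: "distr (\<Pi>\<^sub>M j\<in>?J. U01) (\<Pi>\<^sub>M c\<in>?V. U01) ?r = (\<Pi>\<^sub>M c\<in>?V. U01)"
    by (rule distr_PiM_reindex[OF prob_space_U01 inj]) auto
  have meas: "?r \<in> (\<Pi>\<^sub>M j\<in>?J. U01) \<rightarrow>\<^sub>M (\<Pi>\<^sub>M c\<in>?V. U01)"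
    by (intro measurable_restrict measurable_component_singleton) auto
  have "hom_density_at a x H W = (LINT u|distr (\<Pi>\<^sub>M j\<in>?J. U01) (\<Pi>\<^sub>M c\<in>?V. U01) ?r. edge_prod H W (u(a := x)))"
    by (simp add: hom_density_at_def distr)
  also have "\<dots> = (LINT y|(\<Pi>\<^sub>M j\<in>?J. U01). edge_prod H W ((?r y)(a := x)))"
    by (rule integral_distr[OF meas edge_prod_rooted(1)[OF W H a x]])
  also have "\<dots> = (LINT y|(\<Pi>\<^sub>M j\<in>?J. U01). edge_prod H W ((y \<circ> \<phi>)(a := x)))"
    by (intro Bochner_Integration.integral_cong refl edge_prod_cong[OF H]) auto
  finally show ?thesis by simp
qed

text \<open>Given the label of the common root, the two indicators depend on disjoint sets of labels and
  edge variables, hence are conditionally independent, and each centred indicator has conditional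
  mean zero. Concretely, the edge variables are integrated out first, and then the labels that
  only \<open>\<phi>\<close> uses; the latter integral already vanishes.\<close>

lemma centred_embeddings_orthogonal:
  assumes W: "graphon W" and H: "simple_graph H" and a: "a \<in> verts H" and b: "b \<in> verts H"
    and \<phi>: "\<phi> \<in> verts H \<rightarrow>\<^sub>E {1..n}" "inj_on \<phi> (verts H)" "\<phi> a = v"
    and \<psi>: "\<psi> \<in> verts H \<rightarrow>\<^sub>E {1..n}" "inj_on \<psi> (verts H)" "\<psi> b = v"
    and disj: "\<phi> ` verts H \<inter> \<psi> ` (verts H - {b}) = {}"
  shows "(LINT \<omega>|sample_space n. centred_embedding n W H a v \<phi> \<omega> * centred_embedding n W H b v \<psi> \<omega>) = 0"
proof -
  let ?A = "\<Pi>\<^sub>M i\<in>{1..n}. U01" and ?B = "\<Pi>\<^sub>M p\<in>index_pairs n. U01"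
  interpret U: prob_space U01 by (rule prob_space_U01)
  interpret product_sigma_finite "\<lambda>_. U01" by standard
  interpret A: prob_space ?A by (intro prob_space_PiM prob_space_U01)
  interpret B: prob_space ?B by (intro prob_space_PiM prob_space_U01)
  interpret AB: pair_prob_space ?A ?B ..
  interpret S: prob_space "sample_space n" by (rule prob_space_sample_space)
  have v: "v \<in> {1..n}" using \<phi> a by auto
  let ?t = "\<lambda>U. hom_density_at a (U v) H W" and ?s = "\<lambda>U. hom_density_at b (U v) H W"
  let ?X = "\<lambda>\<omega>. centred_embedding n W H a v \<phi> \<omega> * centred_embedding n W H b v \<psi> \<omega>"
  let ?F = "\<lambda>U. (edge_prod H W (U \<circ> \<phi>) - ?t U) * (edge_prod H W (U \<circ> \<psi>) - ?s U)"
  have bd: "\<bar>?X \<omega>\<bar> \<le> 1" if "\<omega> \<in> space (sample_space n)" for \<omega>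
    unfolding abs_mult
    using centred_embedding_bound[OF W H a v that, of \<phi>] centred_embedding_bound[OF W H b v that, of \<psi>]
    by (intro mult_le_one) auto
  have mX: "?X \<in> borel_measurable (sample_space n)"
    by (intro borel_measurable_times measurable_centred_embedding[OF W H _ v] a b)
  have intX: "integrable (?A \<Otimes>\<^sub>M ?B) ?X"
    using S.integrable_bounded[OF mX bd] by (simp add: sample_space_def)
  have "(LINT \<omega>|sample_space n. ?X \<omega>) = (LINT U|?A. LINT Y|?B. ?X (U, Y))"
    using AB.integral_fst'[OF intX] by (simp add: sample_space_def)
  also have "\<dots> = (LINT U|?A. ?F U)"
  proof (rule Bochner_Integration.integral_cong[OF refl])
    fix U assume U: "U \<in> space ?A"
    have U01: "U i \<in> {0..1}" if "i \<in> {1..n}" for i by (rule space_vertex_labels[OF U that])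
    define I where "I = (\<lambda>\<phi> Y. of_bool (\<phi> \<in> embeddings H (sample_graph n W U Y)) :: real)"
    have "\<psi> ` verts H \<subseteq> {v} \<union> \<psi> ` (verts H - {b})" using \<psi>(3) by auto
    then have meet: "\<phi> ` verts H \<inter> \<psi> ` verts H \<subseteq> {v}" "\<psi> ` verts H \<inter> \<phi> ` verts H \<subseteq> {v}" using disj by auto
    have e: "(LINT Y|?B. I \<phi> Y) = edge_prod H W (U \<circ> \<phi>)" "(LINT Y|?B. I \<psi> Y) = edge_prod H W (U \<circ> \<psi>)"
      "(LINT Y|?B. I \<phi> Y * I \<psi> Y) = edge_prod H W (U \<circ> \<phi>) * edge_prod H W (U \<circ> \<psi>)"
      using integral_edges_embeddings[OF W H \<phi>(1,2) \<psi>(1,2) meet(1), of U]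
        integral_edges_embeddings(1)[OF W H \<psi>(1,2) \<phi>(1,2) meet(2), of U] U01
      unfolding I_def by blast+
    have mI: "I \<phi> \<in> borel_measurable ?B" for \<phi>
      using measurable_compose[OF measurable_Pair1'[OF U] measurable_sample_graph'[OF W, of "\<lambda>G. of_bool (\<phi> \<in> embeddings H G)", unfolded sample_space_def]]
      by (simp add: I_def[abs_def])
    have i1: "integrable ?B (I \<phi>)" for \<phi>
      by (rule B.integrable_bounded[OF mI, of _ 1]) (simp add: I_def)
    have i2: "integrable ?B (\<lambda>Y. I \<phi> Y * I \<psi> Y)"
      by (rule B.integrable_bounded[of _ 1], intro borel_measurable_times mI, simp add: I_def)
    have "(LINT Y|?B. ?X (U, Y)) = (LINT Y|?B. I \<phi> Y * I \<psi> Y - ?s U * I \<phi> Y - ?t U * I \<psi> Y + ?t U * ?s U)"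
      by (rule Bochner_Integration.integral_cong[OF refl])
        (simp add: centred_embedding_def I_def algebra_simps)
    also have "\<dots> = (LINT Y|?B. I \<phi> Y * I \<psi> Y) - ?s U * (LINT Y|?B. I \<phi> Y) - ?t U * (LINT Y|?B. I \<psi> Y) + ?t U * ?s U"
      using i1 i2 by (simp add: B.prob_space)
    also have "\<dots> = ?F U" by (simp add: e algebra_simps)
    finally show "(LINT Y|?B. ?X (U, Y)) = ?F U" .
  qed
  also have "\<dots> = 0"
  proof -
    \<comment> \<open>\<open>J\<close> collects the labels that only \<open>\<phi>\<close> uses, so the second factor does not see them.\<close>
    define J where "J = \<phi> ` (verts H - {a})"
    define I where "I = {1..n} - J"
    have J: "J \<subseteq> {1..n}" using \<phi>(1) by (auto simp: J_def)
    then have IJ: "I \<inter> J = {}" "I \<union> J = {1..n}" "finite I" "finite J"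
      by (auto simp: I_def intro: finite_subset)
    have "v \<notin> J" using \<phi>(2,3) a by (auto simp: J_def inj_on_def)
    then have vI: "v \<in> I" using v by (simp add: I_def)
    have \<psi>I: "\<psi> c \<in> I" if "c \<in> verts H" for c
    proof (cases "c = b")
      case True
      then show ?thesis using vI \<psi>(3) by simp
    next
      case False
      then have "\<psi> c \<notin> J" using disj that by (auto simp: J_def)
      then show ?thesis using \<psi>(1) that by (auto simp: I_def)
    qed
    have mem: "(\<lambda>U. edge_prod H W (U \<circ> \<phi>)) \<in> borel_measurable ?A"
      if \<phi>: "\<phi> \<in> verts H \<rightarrow>\<^sub>E {1..n}" for \<phi>
    proof -
      have "(\<lambda>U. \<lambda>c\<in>verts H. U (\<phi> c)) \<in> ?A \<rightarrow>\<^sub>M (\<Pi>\<^sub>M c\<in>verts H. U01)"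
        using \<phi> by (intro measurable_restrict measurable_component_singleton) auto
      from measurable_compose[OF this measurable_edge_prod[OF W H]]
      have "(\<lambda>U. edge_prod H W (\<lambda>c\<in>verts H. U (\<phi> c))) \<in> borel_measurable ?A" .
      also have "(\<lambda>U. edge_prod H W (\<lambda>c\<in>verts H. U (\<phi> c))) = (\<lambda>U. edge_prod H W (U \<circ> \<phi>))"
        by (intro ext edge_prod_cong[OF H]) simp
      finally show ?thesis .
    qed
    have bnd: "0 \<le> edge_prod H W (U \<circ> \<phi>) \<and> edge_prod H W (U \<circ> \<phi>) \<le> 1"
      if \<phi>: "\<phi> \<in> verts H \<rightarrow>\<^sub>E {1..n}" and U: "U \<in> space ?A" for \<phi> U
    proof -
      have "(\<lambda>c\<in>verts H. U (\<phi> c)) \<in> space (\<Pi>\<^sub>M c\<in>verts H. U01)"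
        using \<phi> space_vertex_labels[OF U] by (auto simp: space_PiM space_U01 simp del: atLeastAtMost_iff)
      moreover have "edge_prod H W (\<lambda>c\<in>verts H. U (\<phi> c)) = edge_prod H W (U \<circ> \<phi>)"
        by (intro edge_prod_cong[OF H]) simp
      ultimately show ?thesis using edge_prod_bounds[OF W H] by metis
    qed
    have mt: "(\<lambda>U. hom_density_at a (U v) H W) \<in> borel_measurable ?A" if "a \<in> verts H" for a
      by (rule measurable_compose[OF measurable_component_singleton[OF v] measurable_hom_density_at[OF W H that]])
    have intF: "integrable ?A ?F"
    proof (rule A.integrable_bounded)
      show "?F \<in> borel_measurable ?A"
        by (intro borel_measurable_times borel_measurable_diff mem mt \<phi>(1) \<psi>(1) a b)
      fix U assume U: "U \<in> space ?A"
      note vv = space_vertex_labels[OF U v]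
      have "\<bar>edge_prod H W (U \<circ> \<phi>) - ?t U\<bar> \<le> 1" "\<bar>edge_prod H W (U \<circ> \<psi>) - ?s U\<bar> \<le> 1"
        using bnd[OF \<phi>(1) U] bnd[OF \<psi>(1) U] hom_density_at_bounds[OF W H a vv] hom_density_at_bounds[OF W H b vv]
        by auto
      then show "\<bar>?F U\<bar> \<le> 1" unfolding abs_mult by (intro mult_le_one) auto
    qed
    have "(LINT U|?A. ?F U) = (LINT x|(\<Pi>\<^sub>M i\<in>I. U01). LINT y|(\<Pi>\<^sub>M i\<in>J. U01). ?F (merge I J (x, y)))"
      using product_integral_fold[OF IJ(1,3,4), of ?F] intF unfolding IJ(2) .
    also have "\<dots> = (LINT x|(\<Pi>\<^sub>M i\<in>I. U01). 0)"
    proof (rule Bochner_Integration.integral_cong[OF refl])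
      fix x assume x: "x \<in> space (\<Pi>\<^sub>M i\<in>I. U01)"
      have xv: "x v \<in> {0..1}" by (rule space_vertex_labels[OF x vI])
      interpret J: prob_space "\<Pi>\<^sub>M i\<in>J. U01" by (intro prob_space_PiM prob_space_U01)
      let ?e = "\<lambda>y. edge_prod H W ((y \<circ> \<phi>)(a := x v))"
      have mv: "merge I J (x, y) v = x v" for y using vI by (simp add: merge_def)
      have e1: "edge_prod H W (merge I J (x, y) \<circ> \<phi>) = ?e y" for y
      proof (rule edge_prod_cong[OF H])
        fix c assume c: "c \<in> verts H"
        show "(merge I J (x, y) \<circ> \<phi>) c = ((y \<circ> \<phi>)(a := x v)) c"
        proof (cases "c = a")
          case True
          then show ?thesis using mv \<phi>(3) by simp
        next
          case False
          then have "\<phi> c \<in> J" using c by (simp add: J_def)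
          then show ?thesis using False IJ(1) by (auto simp: merge_def)
        qed
      qed
      have e2: "edge_prod H W (merge I J (x, y) \<circ> \<psi>) = edge_prod H W (x \<circ> \<psi>)" for y
        by (rule edge_prod_cong[OF H]) (simp add: merge_def \<psi>I)
      have me: "?e \<in> borel_measurable (\<Pi>\<^sub>M i\<in>J. U01)"
      proof -
        have r: "(\<lambda>y. \<lambda>c\<in>verts H - {a}. y (\<phi> c)) \<in> (\<Pi>\<^sub>M i\<in>J. U01) \<rightarrow>\<^sub>M (\<Pi>\<^sub>M c\<in>verts H - {a}. U01)"
          by (intro measurable_restrict measurable_component_singleton) (auto simp: J_def)
        have "(\<lambda>y. edge_prod H W ((\<lambda>c\<in>verts H - {a}. y (\<phi> c))(a := x v))) \<in> borel_measurable (\<Pi>\<^sub>M i\<in>J. U01)"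
          by (rule measurable_compose[OF r edge_prod_rooted(1)[OF W H a xv]])
        also have "(\<lambda>y. edge_prod H W ((\<lambda>c\<in>verts H - {a}. y (\<phi> c))(a := x v))) = ?e"
          by (intro ext edge_prod_cong[OF H]) auto
        finally show ?thesis .
      qed
      have ie: "integrable (\<Pi>\<^sub>M i\<in>J. U01) ?e"
      proof (rule J.integrable_bounded[OF me, of 1])
        fix y assume y: "y \<in> space (\<Pi>\<^sub>M i\<in>J. U01)"
        have "(\<lambda>c\<in>verts H - {a}. y (\<phi> c)) \<in> space (\<Pi>\<^sub>M c\<in>verts H - {a}. U01)"
          using space_vertex_labels[OF y]
          by (auto simp: space_PiM space_U01 J_def simp del: atLeastAtMost_iff)
        from edge_prod_rooted(2)[OF W H a xv this]
        have "\<bar>edge_prod H W ((\<lambda>c\<in>verts H - {a}. y (\<phi> c))(a := x v))\<bar> \<le> 1" by auto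
        also have "edge_prod H W ((\<lambda>c\<in>verts H - {a}. y (\<phi> c))(a := x v)) = ?e y"
          by (intro edge_prod_cong[OF H]) auto
        finally show "\<bar>?e y\<bar> \<le> 1" .
      qed
      have "(LINT y|(\<Pi>\<^sub>M i\<in>J. U01). ?F (merge I J (x, y)))
          = (LINT y|(\<Pi>\<^sub>M i\<in>J. U01). (?e y - ?t x) * (edge_prod H W (x \<circ> \<psi>) - ?s x))"
        by (simp only: e1 e2 mv)
      also have "\<dots> = (LINT y|(\<Pi>\<^sub>M i\<in>J. U01). ?e y - ?t x) * (edge_prod H W (x \<circ> \<psi>) - ?s x)"
        by (rule integral_mult_left_zero)
      also have "(LINT y|(\<Pi>\<^sub>M i\<in>J. U01). ?e y - ?t x) = 0"
        using ie integral_embedding_given_root[OF W H a \<phi>(2) xv]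
        by (simp add: J.prob_space J_def[symmetric])
      finally show "(LINT y|(\<Pi>\<^sub>M i\<in>J. U01). ?F (merge I J (x, y))) = 0"
        by (simp only: mult_zero_left)
    qed
    finally show ?thesis by simp
  qed
  finally show ?thesis .
qed

section \<open>Concentration of rooted densities and of label averages\<close>

text \<open>Only the pairs in \<open>bad\<close> contribute to the expanded square.\<close>

lemma (in prob_space) expectation_square_sum_le:
  fixes X :: "'i \<Rightarrow> 'a \<Rightarrow> real"
  assumes A: "finite A" and bad: "bad \<subseteq> A \<times> A"
    and meas: "\<And>i. i \<in> A \<Longrightarrow> X i \<in> borel_measurable M"
    and bound: "\<And>i \<omega>. i \<in> A \<Longrightarrow> \<omega> \<in> space M \<Longrightarrow> \<bar>X i \<omega>\<bar> \<le> B"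
    and orth: "\<And>i j. i \<in> A \<Longrightarrow> j \<in> A \<Longrightarrow> (i, j) \<notin> bad \<Longrightarrow> (\<integral>\<omega>. X i \<omega> * X j \<omega> \<partial>M) = 0"
  shows "(\<integral>\<omega>. (\<Sum>i\<in>A. X i \<omega>)\<^sup>2 \<partial>M) \<le> B\<^sup>2 * real (card bad)"
proof -
  have pb: "\<bar>X i \<omega> * X j \<omega>\<bar> \<le> B\<^sup>2" if "i \<in> A" "j \<in> A" "\<omega> \<in> space M" for i j \<omega>
    unfolding abs_mult power2_eq_square
    using bound[OF that(1,3)] bound[OF that(2,3)] by (intro mult_mono) auto
  have int: "integrable M (\<lambda>\<omega>. X i \<omega> * X j \<omega>)" if "i \<in> A" "j \<in> A" for i j
    by (rule integrable_bounded[OF borel_measurable_times[OF meas meas] pb]) (use that in auto)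
  have "(\<integral>\<omega>. (\<Sum>i\<in>A. X i \<omega>)\<^sup>2 \<partial>M) = (\<integral>\<omega>. (\<Sum>p\<in>A \<times> A. X (fst p) \<omega> * X (snd p) \<omega>) \<partial>M)"
    by (simp add: power2_eq_square sum_product sum.cartesian_product split_beta)
  also have "\<dots> = (\<Sum>p\<in>A \<times> A. \<integral>\<omega>. X (fst p) \<omega> * X (snd p) \<omega> \<partial>M)"
    by (rule Bochner_Integration.integral_sum) (auto intro: int)
  also have "\<dots> = (\<Sum>p\<in>bad. \<integral>\<omega>. X (fst p) \<omega> * X (snd p) \<omega> \<partial>M)"
    using A bad orth by (intro sum.mono_neutral_right) auto
  also have "\<dots> \<le> (\<Sum>p\<in>bad. B\<^sup>2)"
  proof (rule sum_mono)
    fix p assume "p \<in> bad"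
    then have p: "fst p \<in> A" "snd p \<in> A" using bad by auto
    have "(\<integral>\<omega>. X (fst p) \<omega> * X (snd p) \<omega> \<partial>M) \<le> (\<integral>\<omega>. B\<^sup>2 \<partial>M)"
      using pb[OF p] by (intro integral_mono int p) (auto simp: abs_le_iff)
    then show "(\<integral>\<omega>. X (fst p) \<omega> * X (snd p) \<omega> \<partial>M) \<le> B\<^sup>2" by (simp add: prob_space)
  qed
  finally show ?thesis by (simp add: mult.commute)
qed

lemma card_rooted_functions:
  assumes "finite V" "a \<in> V" "v \<in> T"
  shows "card {\<phi> \<in> V \<rightarrow>\<^sub>E T. \<phi> a = v} = card T ^ (card V - 1)"
proof -
  have "{\<phi> \<in> V \<rightarrow>\<^sub>E T. \<phi> a = v} = (\<Pi>\<^sub>E c\<in>V. if c = a then {v} else T)"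
  proof (intro equalityI subsetI)
    fix \<phi> assume \<phi>: "\<phi> \<in> (\<Pi>\<^sub>E c\<in>V. if c = a then {v} else T)"
    have "\<phi> c \<in> T" if "c \<in> V" for c
      using PiE_mem[OF \<phi> that] assms(3) by (cases "c = a") auto
    moreover have "\<phi> a = v" using PiE_mem[OF \<phi> assms(2)] by simp
    ultimately show "\<phi> \<in> {\<phi> \<in> V \<rightarrow>\<^sub>E T. \<phi> a = v}" using \<phi> by (simp add: PiE_iff)
  qed (simp add: PiE_iff)
  then have "card {\<phi> \<in> V \<rightarrow>\<^sub>E T. \<phi> a = v} = (\<Prod>c\<in>V. card (if c = a then {v} else T))"
    using assms by (simp add: card_PiE)
  also have "\<dots> = (\<Prod>c\<in>V - {a}. card (if c = a then {v} else T))"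
    using assms by (subst prod.remove[of V a]) auto
  also have "\<dots> = (\<Prod>c\<in>V - {a}. card T)" by (rule prod.cong) auto
  also have "\<dots> = card T ^ (card V - 1)" using assms by (simp add: card_Diff_singleton)
  finally show ?thesis .
qed

text \<open>Up to the factor \<open>card (verts H)\<close>, the function whose almost sure constancy is
  \<open>H\<close>-regularity.\<close>

definition root_function :: "'v::linorder sgraph \<Rightarrow> (real \<Rightarrow> real \<Rightarrow> real) \<Rightarrow> real \<Rightarrow> real" where
  "root_function H W x = (\<Sum>a\<in>verts H. hom_density_at a x H W)"

lemma measurable_root_function:
  assumes "graphon W" "simple_graph H"
  shows "root_function H W \<in> borel_measurable U01"
  unfolding root_function_def[abs_def]
  by (intro borel_measurable_sum measurable_hom_density_at assms)

lemma root_function_bounds: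
  assumes "graphon W" "simple_graph H" "x \<in> {0..1}"
  shows "0 \<le> root_function H W x" "root_function H W x \<le> real (card (verts H))"
  using hom_density_at_bounds[OF assms(1,2) _ assms(3)]
    sum_mono[of "verts H" "\<lambda>a. hom_density_at a x H W" "\<lambda>_. 1"]
  by (auto simp: root_function_def intro!: sum_nonneg)

lemma rooted_density_sample_graph_bounds:
  assumes W: "graphon W" and H: "simple_graph H" and v: "v \<in> {1..n}"
  shows "0 \<le> rooted_density H (sample_graph n W U Y) v"
    "rooted_density H (sample_graph n W U Y) v \<le> real (card (verts H))"
proof -
  let ?G = "sample_graph n W U Y"
  have f: "finite (verts H)" using H by (simp add: simple_graph_def)
  show "0 \<le> rooted_density H ?G v" by (simp add: rooted_density_def sum_nonneg)
  have "real (card (rooted_embeddings H ?G a v)) \<le> real n ^ (card (verts H) - 1)"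
    if "a \<in> verts H" for a
  proof -
    have "card (rooted_embeddings H ?G a v) \<le> card {\<phi> \<in> verts H \<rightarrow>\<^sub>E {1..n}. \<phi> a = v}"
      using f by (intro card_mono) (auto simp: rooted_embeddings_def embeddings_def verts_sample_graph finite_PiE)
    also have "\<dots> = n ^ (card (verts H) - 1)"
      using card_rooted_functions[OF f that v] by simp
    finally show ?thesis by (simp flip: of_nat_power)
  qed
  then have "(\<Sum>a\<in>verts H. real (card (rooted_embeddings H ?G a v)))
      \<le> (\<Sum>a\<in>verts H. real n ^ (card (verts H) - 1))" by (rule sum_mono)
  then show "rooted_density H ?G v \<le> real (card (verts H))"
    using v by (simp add: rooted_density_def verts_sample_graph divide_le_eq)
qed

text \<open>The deviation is a normalised sum of centred indicators over all roots \<open>a\<close> and all maps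
  sending \<open>a\<close> to \<open>v\<close>. By orthogonality only pairs of maps contribute whose join collides. With
  \<open>k\<close> vertices in \<open>H\<close> and \<open>m = 2 * k - 1\<close> in the join there are \<open>O(n ^ (m - 2))\<close> of them,
  against a squared normalisation \<open>n ^ (2 * k - 2) = n ^ (m - 1)\<close>.\<close>

lemma expectation_rooted_density_deviation:
  assumes W: "graphon W" and H: "simple_graph H" and k: "2 \<le> card (verts H)" and v: "v \<in> {1..n}"
  shows "(LINT \<omega>|sample_space n. (rooted_density H (sample_graph n W (fst \<omega>) (snd \<omega>)) v
            - root_function H W (fst \<omega> v))\<^sup>2)
    \<le> (real (card (verts H)) * real (2 * card (verts H) - 1))\<^sup>2 / real n"
proof -
  define V where "V = verts H"
  define k where "k = card V"
  define m where "m = 2 * k - 1"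
  define \<Phi> where "\<Phi> = (\<lambda>a. {\<phi> \<in> V \<rightarrow>\<^sub>E {1..n}. \<phi> a = v})"
  define A where "A = Sigma V \<Phi>"
  define X where "X = (\<lambda>(a, \<phi>). centred_embedding n W H a v \<phi>)"
  define N where "N = (\<lambda>a b. {\<theta> \<in> verts (vertex_join H a b H) \<rightarrow>\<^sub>E {1..n}.
      \<theta> (Inl a) = v \<and> \<not> inj_on \<theta> (verts (vertex_join H a b H))})"
  define bad where "bad = (\<Union>(a, b)\<in>V \<times> V.
      (\<lambda>\<theta>. ((a, fst (join_split V a b V \<theta>)), (b, snd (join_split V a b V \<theta>)))) ` N a b)"
  interpret S: prob_space "sample_space n" by (rule prob_space_sample_space)
  have fV: "finite V" using H by (simp add: simple_graph_def V_def)
  have npos: "0 < n" using v by auto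
  have f\<Phi>: "finite (\<Phi> a)" for a unfolding \<Phi>_def using fV by (simp add: finite_PiE)
  have fA: "finite A" unfolding A_def using fV f\<Phi> by auto
  have fJ: "finite (verts (vertex_join H a b H))" for a b
    using simple_graph_vertex_join[OF H H] by (simp add: simple_graph_def)
  have fN: "finite (N a b)" for a b
    by (rule finite_subset[of _ "verts (vertex_join H a b H) \<rightarrow>\<^sub>E {1..n}"])
      (auto simp: N_def intro!: finite_PiE fJ)
  have bij: "bij_betw (join_split V a b V)
      {\<theta> \<in> verts (vertex_join H a b H) \<rightarrow>\<^sub>E {1..n}. \<theta> (Inl a) = v} (\<Phi> a \<times> \<Phi> b)"
    if "a \<in> V" "b \<in> V" for a b
    unfolding \<Phi>_def V_def using bij_betw_join_split[of a H b H "{1..n}" v] that by (simp add: V_def)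
  have bad: "bad \<subseteq> A \<times> A"
  proof
    fix p assume "p \<in> bad"
    then obtain a b \<theta> where ab: "a \<in> V" "b \<in> V" and \<theta>: "\<theta> \<in> N a b"
      and p: "p = ((a, fst (join_split V a b V \<theta>)), (b, snd (join_split V a b V \<theta>)))"
      by (auto simp: bad_def)
    have "join_split V a b V \<theta> \<in> \<Phi> a \<times> \<Phi> b"
      by (rule bij_betw_apply[OF bij[OF ab]]) (use \<theta> in \<open>simp add: N_def\<close>)
    then show "p \<in> A \<times> A" using ab by (auto simp: p A_def)
  qed
  have cbad: "card bad \<le> k\<^sup>2 * (m\<^sup>2 * n ^ (m - 2))"
  proof -
    have "card bad \<le> (\<Sum>(a, b)\<in>V \<times> V. card
        ((\<lambda>\<theta>. ((a, fst (join_split V a b V \<theta>)), (b, snd (join_split V a b V \<theta>)))) ` N a b))"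
      unfolding bad_def using card_UN_le[of "V \<times> V" "\<lambda>(a, b).
        (\<lambda>\<theta>. ((a, fst (join_split V a b V \<theta>)), (b, snd (join_split V a b V \<theta>)))) ` N a b"] fV
      by (simp add: split_beta)
    also have "\<dots> \<le> (\<Sum>p\<in>V \<times> V. m\<^sup>2 * n ^ (m - 2))"
    proof (rule sum_mono, clarify)
      fix a b assume ab: "a \<in> V" "b \<in> V"
      have cJ: "card (verts (vertex_join H a b H)) = m"
        using card_verts_vertex_join[OF H H, of a b] ab by (simp add: m_def k_def V_def)
      have "Inl a \<in> verts (vertex_join H a b H)" using ab by (simp add: V_def verts_vertex_join)
      from card_rooted_noninjective_le[OF fJ this, of "{1..n}" v]
      have "card (N a b) \<le> m\<^sup>2 * n ^ (m - 2)" by (simp add: N_def cJ)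
      then show "card ((\<lambda>\<theta>. ((a, fst (join_split V a b V \<theta>)), (b, snd (join_split V a b V \<theta>)))) ` N a b)
          \<le> m\<^sup>2 * n ^ (m - 2)"
        using card_image_le[OF fN] order_trans by blast
    qed
    also have "\<dots> = k\<^sup>2 * (m\<^sup>2 * n ^ (m - 2))"
      by (simp add: k_def card_cartesian_product power2_eq_square)
    finally show ?thesis .
  qed
  have orth: "(LINT \<omega>|sample_space n. X i \<omega> * X j \<omega>) = 0"
    if i: "i \<in> A" and j: "j \<in> A" and nb: "(i, j) \<notin> bad" for i j
  proof -
    obtain a \<phi> b \<psi> where ij: "i = (a, \<phi>)" "j = (b, \<psi>)" by (cases i, cases j)
    have ab: "a \<in> V" "b \<in> V" and \<phi>: "\<phi> \<in> \<Phi> a" and \<psi>: "\<psi> \<in> \<Phi> b"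
      using i j by (auto simp: ij A_def)
    have "(\<phi>, \<psi>) \<in> join_split V a b V `
        {\<theta> \<in> verts (vertex_join H a b H) \<rightarrow>\<^sub>E {1..n}. \<theta> (Inl a) = v}"
      unfolding bij_betw_imp_surj_on[OF bij[OF ab]] using \<phi> \<psi> by simp
    then obtain \<theta> where s: "(\<phi>, \<psi>) = join_split V a b V \<theta>"
      and "\<theta> \<in> {\<theta> \<in> verts (vertex_join H a b H) \<rightarrow>\<^sub>E {1..n}. \<theta> (Inl a) = v}"
      by (rule imageE)
    then have \<theta>: "\<theta> \<in> verts (vertex_join H a b H) \<rightarrow>\<^sub>E {1..n}" "\<theta> (Inl a) = v" by simp_all
    have inj: "inj_on \<theta> (verts (vertex_join H a b H))"
    proof (rule ccontr)
      assume "\<not> ?thesis"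
      then have "\<theta> \<in> N a b" using \<theta> by (simp add: N_def)
      then have "((a, fst (join_split V a b V \<theta>)), (b, snd (join_split V a b V \<theta>))) \<in> bad"
        using ab unfolding bad_def by blast
      then have "(i, j) \<in> bad" by (simp add: s[symmetric] ij)
      with nb show False ..
    qed
    note inj' = join_split_injective[OF ab[unfolded V_def] inj s[symmetric, unfolded V_def]]
    show ?thesis
      unfolding ij X_def using \<phi> \<psi> ab inj'
      by (simp add: \<Phi>_def V_def centred_embeddings_orthogonal[OF W H, of a b \<phi> n v \<psi>])
  qed
  have mX: "X i \<in> borel_measurable (sample_space n)" if "i \<in> A" for i
    using that measurable_centred_embedding[OF W H _ v] by (auto simp: A_def X_def V_def)
  have bX: "\<bar>X i \<omega>\<bar> \<le> 1" if "i \<in> A" "\<omega> \<in> space (sample_space n)" for i \<omega>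
    using that(1) centred_embedding_bound[OF W H _ v that(2)] by (auto simp: A_def X_def V_def)
  have dev: "rooted_density H (sample_graph n W (fst \<omega>) (snd \<omega>)) v - root_function H W (fst \<omega> v)
      = (\<Sum>i\<in>A. X i \<omega>) / real n ^ (k - 1)" for \<omega>
  proof -
    let ?G = "sample_graph n W (fst \<omega>) (snd \<omega>)"
    have "(\<Sum>i\<in>A. X i \<omega>) = (\<Sum>a\<in>V. \<Sum>\<phi>\<in>\<Phi> a. centred_embedding n W H a v \<phi> \<omega>)"
      unfolding A_def X_def using fV f\<Phi> by (subst sum.Sigma) (auto simp: split_beta)
    also have "\<dots> = (\<Sum>a\<in>V. real (card (rooted_embeddings H ?G a v))
        - real n ^ (k - 1) * hom_density_at a (fst \<omega> v) H W)"
    proof (rule sum.cong[OF refl])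
      fix a assume a: "a \<in> V"
      have "(\<Sum>\<phi>\<in>\<Phi> a. of_bool (\<phi> \<in> embeddings H ?G)) = real (card (\<Phi> a \<inter> embeddings H ?G))"
        using f\<Phi> by (simp add: sum_of_bool_eq Int_def)
      also have "\<Phi> a \<inter> embeddings H ?G = rooted_embeddings H ?G a v"
        by (auto simp: \<Phi>_def rooted_embeddings_def embeddings_def verts_sample_graph V_def)
      moreover have "card (\<Phi> a) = n ^ (k - 1)"
        unfolding \<Phi>_def using card_rooted_functions[OF fV a v] by (simp add: k_def)
      ultimately show "(\<Sum>\<phi>\<in>\<Phi> a. centred_embedding n W H a v \<phi> \<omega>)
          = real (card (rooted_embeddings H ?G a v)) - real n ^ (k - 1) * hom_density_at a (fst \<omega> v) H W"
        by (simp add: centred_embedding_def sum_subtractf)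
    qed
    also have "\<dots> = (\<Sum>a\<in>V. real (card (rooted_embeddings H ?G a v)))
        - real n ^ (k - 1) * root_function H W (fst \<omega> v)"
      by (simp add: sum_subtractf sum_distrib_left root_function_def V_def)
    finally show ?thesis
      using npos by (simp add: rooted_density_def verts_sample_graph V_def k_def diff_divide_distrib)
  qed
  have pow: "real n ^ (k - 1) * real n ^ (k - 1) = real n * real n ^ (m - 2)"
  proof -
    have "(k - 1) + (k - 1) = Suc (m - 2)" using k by (simp add: m_def k_def V_def)
    then show ?thesis by (simp flip: power_add)
  qed
  have "(LINT \<omega>|sample_space n. (rooted_density H (sample_graph n W (fst \<omega>) (snd \<omega>)) v
            - root_function H W (fst \<omega> v))\<^sup>2)
      = (LINT \<omega>|sample_space n. (\<Sum>i\<in>A. X i \<omega>)\<^sup>2) / (real n ^ (k - 1) * real n ^ (k - 1))"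
    unfolding dev by (simp add: power_divide power2_eq_square)
  also have "\<dots> \<le> 1\<^sup>2 * real (card bad) / (real n ^ (k - 1) * real n ^ (k - 1))"
    by (intro divide_right_mono S.expectation_square_sum_le fA bad mX bX orth) auto
  also have "\<dots> \<le> (real k * real m)\<^sup>2 * real n ^ (m - 2) / (real n * real n ^ (m - 2))"
  proof -
    have "real (card bad) \<le> real (k\<^sup>2 * (m\<^sup>2 * n ^ (m - 2)))" using cbad by (rule of_nat_mono)
    then show ?thesis unfolding pow by (intro divide_right_mono) (auto simp: power_mult_distrib)
  qed
  also have "\<dots> = (real k * real m)\<^sup>2 / real n" using npos by simp
  finally show ?thesis by (simp add: k_def m_def V_def)
qed

lemma expectation_vertex_label:
  assumes v: "v \<in> {1..n}" and g: "g \<in> borel_measurable U01"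
  shows "(LINT \<omega>|sample_space n. g (fst \<omega> v)) = (LINT x|U01. g x :: real)"
proof -
  let ?A = "\<Pi>\<^sub>M i\<in>{1..n}. U01" and ?B = "\<Pi>\<^sub>M p\<in>index_pairs n. U01"
  interpret A: prob_space ?A by (intro prob_space_PiM prob_space_U01)
  interpret B: prob_space ?B by (intro prob_space_PiM prob_space_U01)
  have "distr (sample_space n) ?A fst = ?A"
    unfolding sample_space_def by (rule B.distr_pair_fst)
  then have "distr (sample_space n) U01 (\<lambda>\<omega>. fst \<omega> v) = distr ?A U01 (\<lambda>U. U v)"
    using distr_distr[of "\<lambda>U. U v" ?A U01 fst "sample_space n"] v
    by (simp add: sample_space_def comp_def)
  also have "\<dots> = U01" by (rule distr_PiM_component[OF prob_space_U01 v])
  finally show ?thesis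
    using integral_distr[OF measurable_vertex_label[OF v] g] by simp
qed

lemma expectation_vertex_label_pair:
  assumes uv: "u \<in> {1..n}" "v \<in> {1..n}" "u \<noteq> v"
    and g: "g \<in> borel_measurable U01" "\<And>x. x \<in> {0..1} \<Longrightarrow> \<bar>g x\<bar> \<le> B"
  shows "(LINT \<omega>|sample_space n. g (fst \<omega> u) * g (fst \<omega> v)) = (LINT x|U01. g x :: real)\<^sup>2"
proof -
  let ?A = "\<Pi>\<^sub>M i\<in>{1..n}. U01" and ?B = "\<Pi>\<^sub>M p\<in>index_pairs n. U01"
  interpret U: prob_space U01 by (rule prob_space_U01)
  interpret product_sigma_finite "\<lambda>_. U01" by standard
  interpret B: prob_space ?B by (intro prob_space_PiM prob_space_U01)
  let ?f = "\<lambda>i x. if i = u \<or> i = v then g x else 1"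
  have two: "(\<Prod>i\<in>{1..n}. if i = u \<or> i = v then h i else 1) = h u * h v" for h :: "nat \<Rightarrow> real"
  proof -
    have "(\<Prod>i\<in>{1..n}. if i = u \<or> i = v then h i else 1) = (\<Prod>i\<in>{u, v}. h i)"
      using uv by (intro prod.mono_neutral_cong_right) auto
    then show ?thesis using uv by simp
  qed
  have ig: "integrable U01 g" using g by (intro U.integrable_bounded[of _ B]) (auto simp: space_U01)
  have "distr (sample_space n) ?A fst = ?A"
    unfolding sample_space_def by (rule B.distr_pair_fst)
  moreover have m: "(\<lambda>U. g (U u) * g (U v)) \<in> borel_measurable ?A"
    by (intro borel_measurable_times measurable_compose[OF _ g(1)] measurable_component_singleton uv)
  ultimately have "(LINT \<omega>|sample_space n. g (fst \<omega> u) * g (fst \<omega> v)) = (LINT U|?A. g (U u) * g (U v))"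
    using integral_distr[of fst "sample_space n" ?A "\<lambda>U. g (U u) * g (U v)"]
    by (simp add: sample_space_def)
  also have "\<dots> = (LINT U|?A. (\<Prod>i\<in>{1..n}. ?f i (U i)))"
    by (simp only: two)
  also have "\<dots> = (\<Prod>i\<in>{1..n}. LINT x|U01. ?f i x)"
  proof (rule product_integral_prod)
    fix i show "integrable U01 (?f i)" by (cases "i = u \<or> i = v") (auto simp: ig)
  qed simp
  also have "\<dots> = (\<Prod>i\<in>{1..n}. if i = u \<or> i = v then (LINT x|U01. g x) else 1)"
    by (rule prod.cong) (auto simp: U.prob_space)
  also have "\<dots> = (LINT x|U01. g x)\<^sup>2" by (simp only: two power2_eq_square)
  finally show ?thesis .
qed

text \<open>The quantitative weak law of large numbers for the vertex labels.\<close>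

lemma expectation_vertex_mean:
  assumes n: "0 < n" and g: "g \<in> borel_measurable U01" "\<And>x. x \<in> {0..1} \<Longrightarrow> \<bar>g x\<bar> \<le> B"
  defines "\<mu> \<equiv> LINT x|U01. g x :: real"
  shows "(LINT \<omega>|sample_space n. (mean_on {1..n} (\<lambda>v. g (fst \<omega> v)) - \<mu>)\<^sup>2) \<le> (2 * B)\<^sup>2 / real n"
proof -
  interpret U: prob_space U01 by (rule prob_space_U01)
  interpret S: prob_space "sample_space n" by (rule prob_space_sample_space)
  define h where "h = (\<lambda>x. g x - \<mu>)"
  have ig: "integrable U01 g" using g by (intro U.integrable_bounded[of _ B]) (auto simp: space_U01)
  have "\<bar>\<mu>\<bar> \<le> (LINT x|U01. \<bar>g x\<bar>)" unfolding \<mu>_def by (rule integral_abs_bound)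
  also have "\<dots> \<le> (LINT x|U01. B)" using g ig by (intro integral_mono) (auto simp: space_U01)
  finally have \<mu>B: "\<bar>\<mu>\<bar> \<le> B" by (simp add: U.prob_space)
  have mh: "h \<in> borel_measurable U01" unfolding h_def using g by simp
  have bh: "\<bar>h x\<bar> \<le> 2 * B" if "x \<in> {0..1}" for x
    using g(2)[OF that] \<mu>B abs_triangle_ineq4[of "g x" \<mu>] by (simp add: h_def)
  have ih: "(LINT x|U01. h x) = 0" unfolding h_def using ig by (simp add: U.prob_space \<mu>_def)
  have dev: "mean_on {1..n} (\<lambda>v. g (fst \<omega> v)) - \<mu> = (\<Sum>v\<in>{1..n}. h (fst \<omega> v)) / real n" for \<omega> :: "(nat \<Rightarrow> real) \<times> (nat \<times> nat \<Rightarrow> real)"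
    using n by (simp add: mean_on_def h_def sum_subtractf diff_divide_distrib)
  have "(LINT \<omega>|sample_space n. (\<Sum>v\<in>{1..n}. h (fst \<omega> v))\<^sup>2) \<le> (2 * B)\<^sup>2 * real (card ((\<lambda>v. (v, v)) ` {1..n}))"
  proof (rule S.expectation_square_sum_le)
    fix v assume v: "v \<in> {1..n}"
    show "(\<lambda>\<omega>. h (fst \<omega> v)) \<in> borel_measurable (sample_space n)"
      by (rule measurable_compose[OF measurable_vertex_label[OF v] mh])
    fix \<omega> assume "\<omega> \<in> space (sample_space n)"
    then show "\<bar>h (fst \<omega> v)\<bar> \<le> 2 * B" by (rule bh[OF vertex_label_in_unit[OF _ v]])
  next
    fix u v assume uv: "u \<in> {1..n}" "v \<in> {1..n}" and "(u, v) \<notin> (\<lambda>v. (v, v)) ` {1..n}"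
    then have "u \<noteq> v" by auto
    with uv show "(LINT \<omega>|sample_space n. h (fst \<omega> u) * h (fst \<omega> v)) = 0"
      using expectation_vertex_label_pair[OF _ _ _ mh bh, of u n v] ih by simp
  qed auto
  also have "card ((\<lambda>v. (v, v)) ` {1..n}) = n" by (simp add: card_image inj_on_def)
  finally have "(LINT \<omega>|sample_space n. (\<Sum>v\<in>{1..n}. h (fst \<omega> v))\<^sup>2) / (real n)\<^sup>2 \<le> (2 * B)\<^sup>2 * real n / (real n)\<^sup>2"
    by (rule divide_right_mono) simp
  then show ?thesis unfolding dev using n by (simp add: power_divide power2_eq_square)
qed

section \<open>Regularity and the variance of the root function\<close>

text \<open>Probabilities of graph events depend only on the law of the random graph, so they may be
  computed on the concrete space of labels and edge variables.\<close>

lemma measure_random_graph_eq: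
  assumes W: "graphon W" and G: "G \<in> M \<rightarrow>\<^sub>M count_space UNIV"
    and law: "distr M (count_space UNIV) G = random_graph n W"
  shows "measure M {\<omega>\<in>space M. P (G \<omega>)}
    = measure (sample_space n) {\<omega>\<in>space (sample_space n). P (sample_graph n W (fst \<omega>) (snd \<omega>))}"
proof -
  let ?S = "\<lambda>\<omega>. sample_graph n W (fst \<omega>) (snd \<omega>)"
  have S: "?S \<in> sample_space n \<rightarrow>\<^sub>M count_space UNIV"
    using measurable_sample_graph[OF W, of n] by (simp add: split_beta' sample_space_def)
  have "measure M {\<omega>\<in>space M. P (G \<omega>)} = measure (distr M (count_space UNIV) G) (Collect P)"
    by (subst measure_distr[OF G]) (auto intro!: arg_cong[where f = "measure M"])
  also have "distr M (count_space UNIV) G = distr (sample_space n) (count_space UNIV) ?S"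
    by (simp add: law random_graph_def sample_space_def split_beta')
  also have "measure \<dots> (Collect P) = measure (sample_space n) {\<omega>\<in>space (sample_space n). P (?S \<omega>)}"
    by (subst measure_distr[OF S]) (auto intro!: arg_cong[where f = "measure (sample_space n)"])
  finally show ?thesis .
qed

definition root_mean :: "'v::linorder sgraph \<Rightarrow> (real \<Rightarrow> real \<Rightarrow> real) \<Rightarrow> real" where
  "root_mean H W = (LINT x|U01. root_function H W x)"

definition root_variance :: "'v::linorder sgraph \<Rightarrow> (real \<Rightarrow> real \<Rightarrow> real) \<Rightarrow> real" where
  "root_variance H W = (LINT x|U01. (root_function H W x - root_mean H W)\<^sup>2)"

lemma integrable_root_function:
  assumes W: "graphon W" and H: "simple_graph H"
  shows "integrable U01 (root_function H W)"
proof -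
  interpret prob_space U01 by (rule prob_space_U01)
  show ?thesis
    using root_function_bounds[OF W H]
    by (intro integrable_bounded[of _ "real (card (verts H))"] measurable_root_function[OF W H])
      (auto simp: space_U01 abs_le_iff intro: order_trans)
qed

lemma root_mean_eq:
  assumes W: "graphon W" and H: "simple_graph H"
  shows "root_mean H W = real (card (verts H)) * hom_density H W"
proof -
  interpret prob_space U01 by (rule prob_space_U01)
  have "integrable U01 (\<lambda>x. hom_density_at a x H W)" if "a \<in> verts H" for a
    using hom_density_at_bounds[OF W H that]
    by (intro integrable_bounded[of _ 1] measurable_hom_density_at[OF W H that]) (auto simp: space_U01 abs_le_iff intro: order_trans)
  then show ?thesis
    unfolding root_mean_def root_function_def
    by (subst Bochner_Integration.integral_sum) (simp_all add: integral_hom_density_at[OF W H])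
qed

lemma root_mean_bounds:
  assumes W: "graphon W" and H: "simple_graph H"
  shows "0 \<le> root_mean H W" "root_mean H W \<le> real (card (verts H))"
proof -
  interpret prob_space U01 by (rule prob_space_U01)
  note b = root_function_bounds[OF W H]
  show "0 \<le> root_mean H W"
    unfolding root_mean_def using b by (intro integral_nonneg_AE AE_I2) (simp add: space_U01)
  have "root_mean H W \<le> (LINT x|U01. real (card (verts H)))"
    unfolding root_mean_def using b
    by (intro integral_mono integrable_root_function[OF W H]) (auto simp: space_U01)
  then show "root_mean H W \<le> real (card (verts H))" by (simp add: prob_space)
qed

lemma square_deviation_bound:
  fixes x y K :: real
  assumes "0 \<le> x" "x \<le> K" "0 \<le> y" "y \<le> K"
  shows "(x - y)\<^sup>2 \<le> K\<^sup>2"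
  using assms by (intro abs_le_square_iff[THEN iffD1]) auto

lemma root_square_deviation:
  assumes W: "graphon W" and H: "simple_graph H"
  shows "(\<lambda>x. (root_function H W x - root_mean H W)\<^sup>2) \<in> borel_measurable U01"
    and "x \<in> {0..1} \<Longrightarrow> \<bar>(root_function H W x - root_mean H W)\<^sup>2\<bar> \<le> (real (card (verts H)))\<^sup>2"
  using square_deviation_bound[OF root_function_bounds[OF W H] root_mean_bounds[OF W H]]
    measurable_root_function[OF W H]
  by simp_all

lemma root_variance_nonneg: "0 \<le> root_variance H W"
  by (simp add: root_variance_def)

text \<open>The root function has mean \<open>card (verts H) * hom_density H W\<close>, so regularity says that it
  equals its mean almost everywhere.\<close>

lemma H_regular_iff_root_variance:
  assumes W: "graphon W" and H: "simple_graph H" and k: "0 < card (verts H)"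
  shows "H_regular H W \<longleftrightarrow> root_variance H W = 0"
proof -
  interpret prob_space U01 by (rule prob_space_U01)
  have "integrable U01 (\<lambda>x. (root_function H W x - root_mean H W)\<^sup>2)"
    using root_square_deviation[OF W H] by (intro integrable_bounded) (auto simp: space_U01)
  then have "root_variance H W = 0 \<longleftrightarrow> (AE x in U01. (root_function H W x - root_mean H W)\<^sup>2 = 0)"
    unfolding root_variance_def by (intro integral_nonneg_eq_0_iff_AE) auto
  also have "\<dots> \<longleftrightarrow> H_regular H W"
    unfolding H_regular_def root_mean_eq[OF W H] root_function_def
    using k by (intro AE_cong) (auto simp: field_simps)
  finally show ?thesis by simp
qed

definition sampled_density ::
    "nat \<Rightarrow> (real \<Rightarrow> real \<Rightarrow> real) \<Rightarrow> 'v sgraph \<Rightarrow> (nat \<Rightarrow> real) \<times> (nat \<times> nat \<Rightarrow> real) \<Rightarrow> nat \<Rightarrow> real" where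
  "sampled_density n W H \<omega> = rooted_density H (sample_graph n W (fst \<omega>) (snd \<omega>))"

definition label_value ::
    "(real \<Rightarrow> real \<Rightarrow> real) \<Rightarrow> 'v::linorder sgraph \<Rightarrow> (nat \<Rightarrow> real) \<times> (nat \<times> nat \<Rightarrow> real) \<Rightarrow> nat \<Rightarrow> real" where
  "label_value W H \<omega> v = root_function H W (fst \<omega> v)"

context
  fixes W :: "real \<Rightarrow> real \<Rightarrow> real" and H :: "'v::linorder sgraph" and n :: nat
  assumes W: "graphon W" and H: "simple_graph H" and k: "2 \<le> card (verts H)" and n: "0 < n"
begin

lemma measurable_sampled_density: "(\<lambda>\<omega>. sampled_density n W H \<omega> v) \<in> borel_measurable (sample_space n)"
  unfolding sampled_density_def by (rule measurable_sample_graph'[OF W])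

lemma measurable_label_value:
  "v \<in> {1..n} \<Longrightarrow> (\<lambda>\<omega>. label_value W H \<omega> v) \<in> borel_measurable (sample_space n)"
  unfolding label_value_def
  by (rule measurable_compose[OF measurable_vertex_label measurable_root_function[OF W H]])

lemma sampled_density_bounds:
  assumes "v \<in> {1..n}"
  shows "0 \<le> sampled_density n W H \<omega> v" "sampled_density n W H \<omega> v \<le> real (card (verts H))"
  unfolding sampled_density_def by (rule rooted_density_sample_graph_bounds[OF W H assms])+

lemma label_value_bounds:
  assumes "v \<in> {1..n}" "\<omega> \<in> space (sample_space n)"
  shows "0 \<le> label_value W H \<omega> v" "label_value W H \<omega> v \<le> real (card (verts H))"
  unfolding label_value_def
  by (rule root_function_bounds[OF W H vertex_label_in_unit[OF assms(2,1)]])+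

text \<open>Stated for general \<open>X\<close> and \<open>Z\<close> because it is applied both to rooted densities against
  label values and to label values against their mean; all of these lie between \<open>0\<close> and
  \<open>card (verts H)\<close>.\<close>

lemma mean_square_integrable:
  assumes "\<And>v. v \<in> {1..n} \<Longrightarrow> (\<lambda>\<omega>. X \<omega> v) \<in> borel_measurable (sample_space n)"
    and "\<And>v. v \<in> {1..n} \<Longrightarrow> (\<lambda>\<omega>. Z \<omega> v) \<in> borel_measurable (sample_space n)"
    and "\<And>v \<omega>. v \<in> {1..n} \<Longrightarrow> \<omega> \<in> space (sample_space n) \<Longrightarrow> 0 \<le> X \<omega> v \<and> X \<omega> v \<le> real (card (verts H))"
    and "\<And>v \<omega>. v \<in> {1..n} \<Longrightarrow> \<omega> \<in> space (sample_space n) \<Longrightarrow> 0 \<le> Z \<omega> v \<and> Z \<omega> v \<le> real (card (verts H))"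
  shows "v \<in> {1..n} \<Longrightarrow> integrable (sample_space n) (\<lambda>\<omega>. (X \<omega> v - Z \<omega> v)\<^sup>2)"
    and "integrable (sample_space n) (\<lambda>\<omega>. mean_on {1..n} (\<lambda>v. (X \<omega> v - Z \<omega> v)\<^sup>2))"
    and "(LINT \<omega>|sample_space n. mean_on {1..n} (\<lambda>v. (X \<omega> v - Z \<omega> v)\<^sup>2))
      = mean_on {1..n} (\<lambda>v. LINT \<omega>|sample_space n. (X \<omega> v - Z \<omega> v)\<^sup>2)"
proof -
  interpret S: prob_space "sample_space n" by (rule prob_space_sample_space)
  have i: "integrable (sample_space n) (\<lambda>\<omega>. (X \<omega> v - Z \<omega> v)\<^sup>2)" if "v \<in> {1..n}" for v
  proof (rule S.integrable_bounded[of _ "(real (card (verts H)))\<^sup>2"])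
    show "(\<lambda>\<omega>. (X \<omega> v - Z \<omega> v)\<^sup>2) \<in> borel_measurable (sample_space n)"
      by (intro borel_measurable_power borel_measurable_diff assms that)
    fix \<omega> assume "\<omega> \<in> space (sample_space n)"
    then show "\<bar>(X \<omega> v - Z \<omega> v)\<^sup>2\<bar> \<le> (real (card (verts H)))\<^sup>2"
      using square_deviation_bound[of "X \<omega> v" "real (card (verts H))" "Z \<omega> v"] assms(3,4)[OF that] by simp
  qed
  then show "v \<in> {1..n} \<Longrightarrow> integrable (sample_space n) (\<lambda>\<omega>. (X \<omega> v - Z \<omega> v)\<^sup>2)" .
  show "integrable (sample_space n) (\<lambda>\<omega>. mean_on {1..n} (\<lambda>v. (X \<omega> v - Z \<omega> v)\<^sup>2))"
    unfolding mean_on_def by (intro integrable_divide Bochner_Integration.integrable_sum i)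
  show "(LINT \<omega>|sample_space n. mean_on {1..n} (\<lambda>v. (X \<omega> v - Z \<omega> v)\<^sup>2))
      = mean_on {1..n} (\<lambda>v. LINT \<omega>|sample_space n. (X \<omega> v - Z \<omega> v)\<^sup>2)"
    unfolding mean_on_def using i by (simp add: Bochner_Integration.integral_sum)
qed

lemma mean_on_bound:
  assumes "\<And>v. v \<in> {1..n} \<Longrightarrow> x v \<le> c"
  shows "mean_on {1..n} x \<le> c"
  using sum_mono[of "{1..n}" x "\<lambda>_. c"] assms n by (simp add: mean_on_def divide_le_eq mult.commute)

lemma density_label_deviation:
  shows "integrable (sample_space n) (\<lambda>\<omega>. mean_on {1..n} (\<lambda>v. (sampled_density n W H \<omega> v - label_value W H \<omega> v)\<^sup>2))"
    and "(LINT \<omega>|sample_space n. mean_on {1..n} (\<lambda>v. (sampled_density n W H \<omega> v - label_value W H \<omega> v)\<^sup>2))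
      \<le> (real (card (verts H)) * real (2 * card (verts H) - 1))\<^sup>2 / real n"
proof -
  note m = mean_square_integrable[of "sampled_density n W H" "label_value W H"]
  note a = measurable_sampled_density measurable_label_value conjI sampled_density_bounds label_value_bounds
  show "integrable (sample_space n) (\<lambda>\<omega>. mean_on {1..n} (\<lambda>v. (sampled_density n W H \<omega> v - label_value W H \<omega> v)\<^sup>2))"
    by (rule m(2)) (intro a; assumption)+
  have "(LINT \<omega>|sample_space n. mean_on {1..n} (\<lambda>v. (sampled_density n W H \<omega> v - label_value W H \<omega> v)\<^sup>2))
      = mean_on {1..n} (\<lambda>v. LINT \<omega>|sample_space n. (sampled_density n W H \<omega> v - label_value W H \<omega> v)\<^sup>2)"
    by (rule m(3)) (intro a; assumption)+
  also have "\<dots> \<le> (real (card (verts H)) * real (2 * card (verts H) - 1))\<^sup>2 / real n"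
    unfolding sampled_density_def label_value_def
    by (rule mean_on_bound) (rule expectation_rooted_density_deviation[OF W H k])
  finally show "(LINT \<omega>|sample_space n. mean_on {1..n} (\<lambda>v. (sampled_density n W H \<omega> v - label_value W H \<omega> v)\<^sup>2))
      \<le> (real (card (verts H)) * real (2 * card (verts H) - 1))\<^sup>2 / real n" .
qed

lemma label_mean_deviation:
  shows "integrable (sample_space n) (\<lambda>\<omega>. mean_on {1..n} (\<lambda>v. (label_value W H \<omega> v - root_mean H W)\<^sup>2))"
    and "(LINT \<omega>|sample_space n. mean_on {1..n} (\<lambda>v. (label_value W H \<omega> v - root_mean H W)\<^sup>2)) = root_variance H W"
proof -
  note m = mean_square_integrable[of "label_value W H" "\<lambda>_ _. root_mean H W"]
  note a = borel_measurable_const measurable_label_value conjI label_value_bounds root_mean_bounds[OF W H]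
  show "integrable (sample_space n) (\<lambda>\<omega>. mean_on {1..n} (\<lambda>v. (label_value W H \<omega> v - root_mean H W)\<^sup>2))"
    by (rule m(2)) (intro a; assumption)+
  have "(LINT \<omega>|sample_space n. mean_on {1..n} (\<lambda>v. (label_value W H \<omega> v - root_mean H W)\<^sup>2))
      = mean_on {1..n} (\<lambda>v. LINT \<omega>|sample_space n. (label_value W H \<omega> v - root_mean H W)\<^sup>2)"
    by (rule m(3)) (intro a; assumption)+
  also have "\<dots> = mean_on {1..n} (\<lambda>v. root_variance H W)"
    unfolding mean_on_def label_value_def root_variance_def
    by (intro arg_cong2[where f = "(/)"] sum.cong refl expectation_vertex_label root_square_deviation[OF W H])
  also have "\<dots> = root_variance H W" using n by (simp add: mean_on_def)
  finally show "(LINT \<omega>|sample_space n. mean_on {1..n} (\<lambda>v. (label_value W H \<omega> v - root_mean H W)\<^sup>2)) = root_variance H W" .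
qed

lemma var_on_sampled_density_le:
  "var_on {1..n} (sampled_density n W H \<omega>) \<le> 2 * mean_on {1..n} (\<lambda>v. (sampled_density n W H \<omega> v - label_value W H \<omega> v)\<^sup>2)
     + 2 * mean_on {1..n} (\<lambda>v. (label_value W H \<omega> v - root_mean H W)\<^sup>2)"
proof -
  have "mean_on {1..n} (\<lambda>v. (sampled_density n W H \<omega> v - root_mean H W)\<^sup>2)
      \<le> mean_on {1..n} (\<lambda>v. 2 * (sampled_density n W H \<omega> v - label_value W H \<omega> v)\<^sup>2 + 2 * (label_value W H \<omega> v - root_mean H W)\<^sup>2)"
    unfolding mean_on_def by (intro divide_right_mono sum_mono square_diff_triangle) auto
  also have "\<dots> = 2 * mean_on {1..n} (\<lambda>v. (sampled_density n W H \<omega> v - label_value W H \<omega> v)\<^sup>2)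
     + 2 * mean_on {1..n} (\<lambda>v. (label_value W H \<omega> v - root_mean H W)\<^sup>2)"
    by (simp add: mean_on_def sum.distrib sum_distrib_left[symmetric] add_divide_distrib)
  finally show ?thesis
    using var_on_le_mean_square[of "{1..n}" "sampled_density n W H \<omega>" "root_mean H W"] n by simp
qed

text \<open>When the root function is almost surely constant, the statistic is at most the empirical
  mean square deviation of the rooted densities from that constant, up to \<open>C / n\<close>. Its expectation is
  \<open>O(1 / n)\<close>, and Markov's inequality leaves a factor \<open>1 / sqrt n\<close> after scaling.\<close>

lemma prob_scaled_R_stat_regular:
  assumes regular: "root_variance H W = 0" and \<epsilon>: "0 < \<epsilon>" and C: "0 \<le> C"
    and approx: "\<And>\<omega>. \<bar>R_stat H (sample_graph n W (fst \<omega>) (snd \<omega>)) - var_on {1..n} (sampled_density n W H \<omega>)\<bar> \<le> C / real n"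
  shows "measure (sample_space n) {\<omega>\<in>space (sample_space n).
        \<bar>sqrt (real n) * R_stat H (sample_graph n W (fst \<omega>) (snd \<omega>)) - 0\<bar> > \<epsilon>}
     \<le> (2 * (real (card (verts H)) * real (2 * card (verts H) - 1))\<^sup>2 + C) / \<epsilon> / sqrt (real n)"
proof -
  interpret S: prob_space "sample_space n" by (rule prob_space_sample_space)
  define D where "D = (real (card (verts H)) * real (2 * card (verts H) - 1))\<^sup>2"
  define Q where "Q = (\<lambda>\<omega>. 2 * mean_on {1..n} (\<lambda>v. (sampled_density n W H \<omega> v - label_value W H \<omega> v)\<^sup>2)
     + 2 * mean_on {1..n} (\<lambda>v. (label_value W H \<omega> v - root_mean H W)\<^sup>2) + C / real n)"
  have intQ: "integrable (sample_space n) Q"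
    unfolding Q_def using density_label_deviation(1) label_mean_deviation(1) by simp
  have Q0: "0 \<le> Q \<omega>" for \<omega> using C by (simp add: Q_def mean_on_def sum_nonneg)
  have "(LINT \<omega>|sample_space n. Q \<omega>) = 2 * (LINT \<omega>|sample_space n. mean_on {1..n} (\<lambda>v. (sampled_density n W H \<omega> v - label_value W H \<omega> v)\<^sup>2)) + C / real n"
    unfolding Q_def using density_label_deviation(1) label_mean_deviation regular by (simp add: S.prob_space)
  also have "\<dots> \<le> 2 * (D / real n) + C / real n"
    using density_label_deviation(2) by (simp add: D_def)
  finally have EQ: "(LINT \<omega>|sample_space n. Q \<omega>) \<le> (2 * D + C) / real n"
    by (simp add: add_divide_distrib)
  have s: "0 < sqrt (real n)" using n by simp
  have le: "\<bar>R_stat H (sample_graph n W (fst \<omega>) (snd \<omega>))\<bar> \<le> Q \<omega>" for \<omega>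
    using approx[of \<omega>] var_on_sampled_density_le[of \<omega>] var_on_nonneg[of "{1..n}" "sampled_density n W H \<omega>"]
    unfolding Q_def by linarith
  have "measure (sample_space n) {\<omega>\<in>space (sample_space n).
        \<bar>sqrt (real n) * R_stat H (sample_graph n W (fst \<omega>) (snd \<omega>)) - 0\<bar> > \<epsilon>}
      \<le> measure (sample_space n) {\<omega>\<in>space (sample_space n). Q \<omega> \<ge> \<epsilon> / sqrt (real n)}"
  proof (rule S.finite_measure_mono)
    show "{\<omega>\<in>space (sample_space n). Q \<omega> \<ge> \<epsilon> / sqrt (real n)} \<in> sets (sample_space n)"
      using intQ by measurable
    have "\<epsilon> / sqrt (real n) \<le> Q \<omega>" if "\<bar>sqrt (real n) * R_stat H (sample_graph n W (fst \<omega>) (snd \<omega>)) - 0\<bar> > \<epsilon>" for \<omega>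
    proof -
      have "\<epsilon> \<le> sqrt (real n) * \<bar>R_stat H (sample_graph n W (fst \<omega>) (snd \<omega>))\<bar>"
        using that by (simp add: abs_mult)
      also have "\<dots> \<le> sqrt (real n) * Q \<omega>" using le s by (intro mult_left_mono) auto
      finally show ?thesis using s by (simp add: divide_le_eq mult.commute)
    qed
    then show "{\<omega>\<in>space (sample_space n). \<bar>sqrt (real n) * R_stat H (sample_graph n W (fst \<omega>) (snd \<omega>)) - 0\<bar> > \<epsilon>}
        \<subseteq> {\<omega>\<in>space (sample_space n). Q \<omega> \<ge> \<epsilon> / sqrt (real n)}" by blast
  qed
  also have "\<dots> \<le> (LINT \<omega>|sample_space n. Q \<omega>) / (\<epsilon> / sqrt (real n))"
    using s \<epsilon> Q0 by (intro integral_Markov_inequality_measure[OF intQ, of "{}"]) auto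
  also have "\<dots> \<le> ((2 * D + C) / real n) / (\<epsilon> / sqrt (real n))"
    using \<epsilon> s EQ by (intro divide_right_mono) auto
  also have "\<dots> = (2 * D + C) / \<epsilon> * (sqrt (real n) / real n)" by simp
  also have "sqrt (real n) / real n = 1 / sqrt (real n)"
    using n by (simp add: field_simps)
  finally show ?thesis by (simp add: D_def)
qed

text \<open>The empirical variance of the label values is close to \<open>root_variance H W\<close> by two laws of
  large numbers, and the rooted densities inherit at least a fixed fraction of it. All three errors
  are nonnegative with expectation \<open>O(1 / n)\<close>, so a single use of Markov's inequality for their
  sum suffices.\<close>

lemma prob_R_stat_bounded_below:
  assumes irregular: "0 < root_variance H W" and C: "0 \<le> C" "16 * C \<le> root_variance H W * real n"
    and approx: "\<And>\<omega>. \<bar>R_stat H (sample_graph n W (fst \<omega>) (snd \<omega>)) - var_on {1..n} (sampled_density n W H \<omega>)\<bar> \<le> C / real n"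
  defines "K \<equiv> (real (card (verts H)) * real (2 * card (verts H) - 1))\<^sup>2
      + (2 * real (card (verts H)))\<^sup>2 + (2 * (real (card (verts H)))\<^sup>2)\<^sup>2"
    and "\<delta> \<equiv> min ((root_variance H W / 4)\<^sup>2) (root_variance H W / 16)"
  shows "1 - K / \<delta> / real n \<le> measure (sample_space n) {\<omega>\<in>space (sample_space n).
        root_variance H W / 16 \<le> R_stat H (sample_graph n W (fst \<omega>) (snd \<omega>))}"
proof -
  interpret S: prob_space "sample_space n" by (rule prob_space_sample_space)
  define s where "s = root_variance H W"
  define \<mu> where "\<mu> = root_mean H W"
  define B where "B = (\<lambda>\<omega>. mean_on {1..n} (\<lambda>v. (sampled_density n W H \<omega> v - label_value W H \<omega> v)\<^sup>2))"
  define A where "A = (\<lambda>\<omega>. mean_on {1..n} (label_value W H \<omega>))"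
  define V where "V = (\<lambda>\<omega>. mean_on {1..n} (\<lambda>v. (label_value W H \<omega> v - \<mu>)\<^sup>2))"
  \<comment> \<open>The mean square distance of rooted densities and label values, and the errors of the two
    laws of large numbers for the mean and the centred second moment of the label values.\<close>
  define T where "T = (\<lambda>\<omega>. B \<omega> + (A \<omega> - \<mu>)\<^sup>2 + (V \<omega> - s)\<^sup>2)"
  have s: "0 < s" using irregular by (simp add: s_def)
  \<comment> \<open>If all errors are below \<open>\<delta>\<close>, the label values have empirical variance at least
    \<open>3/4 * s - s/16\<close>. Half of this minus \<open>s/16\<close> for the rooted densities, and minus another \<open>s/16\<close>
    for the statistic, is above \<open>s/16\<close>.\<close>
  have \<delta>: "0 < \<delta>" "\<delta> \<le> (s / 4)\<^sup>2" "\<delta> \<le> s / 16" using s by (auto simp: \<delta>_def s_def)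
  have ab: "\<bar>root_function H W x\<bar> \<le> real (card (verts H))" if "x \<in> {0..1}" for x
    using root_function_bounds[OF W H that] by simp
  have mA: "A \<in> borel_measurable (sample_space n)"
    unfolding A_def mean_on_def by (intro borel_measurable_divide borel_measurable_sum measurable_label_value) auto
  have bA: "0 \<le> A \<omega> \<and> A \<omega> \<le> real (card (verts H))" if "\<omega> \<in> space (sample_space n)" for \<omega>
    using label_value_bounds[OF _ that] unfolding A_def
    by (intro conjI mean_on_bound mean_on_nonneg) auto
  have iA: "integrable (sample_space n) (\<lambda>\<omega>. (A \<omega> - \<mu>)\<^sup>2)"
    using bA square_deviation_bound[OF _ _ root_mean_bounds[OF W H]] mA
    by (intro S.integrable_bounded[of _ "(real (card (verts H)))\<^sup>2"]) (auto simp: \<mu>_def)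
  have mV: "V \<in> borel_measurable (sample_space n)"
    unfolding V_def \<mu>_def using label_mean_deviation(1) by simp
  have bV: "0 \<le> V \<omega> \<and> V \<omega> \<le> (real (card (verts H)))\<^sup>2" if "\<omega> \<in> space (sample_space n)" for \<omega>
    using square_deviation_bound[OF label_value_bounds[OF _ that] root_mean_bounds[OF W H]] unfolding V_def \<mu>_def
    by (intro conjI mean_on_bound mean_on_nonneg) auto
  have "s = (LINT \<omega>|sample_space n. V \<omega>)" 
    unfolding s_def V_def \<mu>_def by (rule label_mean_deviation(2)[symmetric])
  also have "\<dots> \<le> (LINT \<omega>|sample_space n. (real (card (verts H)))\<^sup>2)"
    using label_mean_deviation(1) bV by (intro integral_mono) (auto simp: V_def \<mu>_def)
  finally have sK: "s \<le> (real (card (verts H)))\<^sup>2" by (simp add: S.prob_space)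
  have iV: "integrable (sample_space n) (\<lambda>\<omega>. (V \<omega> - s)\<^sup>2)"
    using bV square_deviation_bound[OF _ _ less_imp_le[OF s] sK] mV
    by (intro S.integrable_bounded[of _ "((real (card (verts H)))\<^sup>2)\<^sup>2"]) auto
  have iB: "integrable (sample_space n) B" unfolding B_def by (rule density_label_deviation(1))
  have iT: "integrable (sample_space n) T" unfolding T_def using iA iB iV by simp
  have T0: "0 \<le> T \<omega>" for \<omega> by (simp add: T_def B_def mean_on_def sum_nonneg)
  have "(LINT \<omega>|sample_space n. T \<omega>) = (LINT \<omega>|sample_space n. B \<omega>)
      + (LINT \<omega>|sample_space n. (A \<omega> - \<mu>)\<^sup>2) + (LINT \<omega>|sample_space n. (V \<omega> - s)\<^sup>2)"
    unfolding T_def using iA iB iV by simp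
  also have "\<dots> \<le> (real (card (verts H)) * real (2 * card (verts H) - 1))\<^sup>2 / real n
      + (2 * real (card (verts H)))\<^sup>2 / real n + (2 * (real (card (verts H)))\<^sup>2)\<^sup>2 / real n"
  proof (intro add_mono)
    show "(LINT \<omega>|sample_space n. B \<omega>) \<le> (real (card (verts H)) * real (2 * card (verts H) - 1))\<^sup>2 / real n"
      unfolding B_def by (rule density_label_deviation(2))
    show "(LINT \<omega>|sample_space n. (A \<omega> - \<mu>)\<^sup>2) \<le> (2 * real (card (verts H)))\<^sup>2 / real n"
      unfolding A_def \<mu>_def label_value_def root_mean_def
      by (rule expectation_vertex_mean[OF n measurable_root_function[OF W H] ab])
    show "(LINT \<omega>|sample_space n. (V \<omega> - s)\<^sup>2) \<le> (2 * (real (card (verts H)))\<^sup>2)\<^sup>2 / real n"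
      unfolding V_def \<mu>_def label_value_def s_def root_variance_def
      by (rule expectation_vertex_mean[OF n root_square_deviation[OF W H]])
  qed
  also have "\<dots> = K / real n" by (simp add: K_def add_divide_distrib)
  finally have ET: "(LINT \<omega>|sample_space n. T \<omega>) \<le> K / real n" .
  have "measure (sample_space n) {\<omega>\<in>space (sample_space n). T \<omega> \<ge> \<delta>} \<le> (LINT \<omega>|sample_space n. T \<omega>) / \<delta>"
    using \<delta> T0 by (intro integral_Markov_inequality_measure[OF iT, of "{}"]) auto
  also have "\<dots> \<le> K / real n / \<delta>" using ET \<delta> by (intro divide_right_mono) auto
  finally have markov: "measure (sample_space n) {\<omega>\<in>space (sample_space n). T \<omega> \<ge> \<delta>} \<le> K / \<delta> / real n"
    by (simp add: mult.commute)
  have good: "s / 16 \<le> R_stat H (sample_graph n W (fst \<omega>) (snd \<omega>))" if T: "T \<omega> < \<delta>" for \<omega>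
  proof -
    have B0: "0 \<le> B \<omega>" by (simp add: B_def mean_on_def sum_nonneg)
    have t: "B \<omega> < \<delta>" "(A \<omega> - \<mu>)\<^sup>2 < \<delta>" "(V \<omega> - s)\<^sup>2 < \<delta>"
      using T B0 zero_le_power2[of "A \<omega> - \<mu>"] zero_le_power2[of "V \<omega> - s"] unfolding T_def by linarith+
    have "\<bar>V \<omega> - s\<bar> \<le> s / 4"
    proof (rule power2_le_imp_le)
      show "\<bar>V \<omega> - s\<bar>\<^sup>2 \<le> (s / 4)\<^sup>2" using t(3) \<delta>(2) unfolding power2_abs by linarith
    qed (use s in simp)
    moreover have "var_on {1..n} (label_value W H \<omega>) = V \<omega> - (A \<omega> - \<mu>)\<^sup>2"
      using mean_square_deviation[of "{1..n}" "label_value W H \<omega>" \<mu>] n by (simp add: V_def A_def)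
    moreover have "var_on {1..n} (label_value W H \<omega>) \<le> 2 * var_on {1..n} (sampled_density n W H \<omega>) + 2 * B \<omega>"
      unfolding B_def using n by (intro var_on_perturb) auto
    moreover have "C / real n \<le> s / 16" using C n by (simp add: s_def field_simps)
    moreover note approx[of \<omega>]
    ultimately show ?thesis using t(1,2) \<delta>(3) s unfolding abs_le_iff by linarith
  qed
  have mT: "{\<omega>\<in>space (sample_space n). T \<omega> \<ge> \<delta>} \<in> sets (sample_space n)" using iT by measurable
  have "1 - K / \<delta> / real n \<le> 1 - measure (sample_space n) {\<omega>\<in>space (sample_space n). T \<omega> \<ge> \<delta>}"
    using markov by simp
  also have "\<dots> = measure (sample_space n) (space (sample_space n) - {\<omega>\<in>space (sample_space n). T \<omega> \<ge> \<delta>})"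
    by (rule S.prob_compl[OF mT, symmetric])
  also have "\<dots> \<le> measure (sample_space n) {\<omega>\<in>space (sample_space n).
        s / 16 \<le> R_stat H (sample_graph n W (fst \<omega>) (snd \<omega>))}"
  proof (rule S.finite_measure_mono)
    show "{\<omega>\<in>space (sample_space n). s / 16 \<le> R_stat H (sample_graph n W (fst \<omega>) (snd \<omega>))} \<in> sets (sample_space n)"
      using measurable_sample_graph'[OF W, of "R_stat H" n] by measurable
  qed (use good in \<open>auto simp: not_le\<close>)
  finally show ?thesis by (simp add: s_def)
qed

end

theorem proposition5p1:
  fixes W :: "real \<Rightarrow> real \<Rightarrow> real"
    and H :: "nat sgraph"
    and M :: "nat \<Rightarrow> 'w measure"
    and G :: "nat \<Rightarrow> 'w \<Rightarrow> nat sgraph"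
  assumes "graphon W"
    and "simple_graph H"
    and "verts H = {1..card (verts H)}"
    and "card (verts H) \<ge> 2"
    and "\<And>n. prob_space (M n)"
    and "\<And>n. G n \<in> M n \<rightarrow>\<^sub>M count_space UNIV"
    and "\<And>n. distr (M n) (count_space UNIV) (G n) = random_graph n W"
  shows "(H_regular H W \<longrightarrow>
            tendsto_in_prob M (\<lambda>n \<omega>. sqrt (real n) * R_stat H (G n \<omega>)) 0) \<and>
         (\<not> H_regular H W \<longrightarrow>
            tendsto_infinity_in_prob M (\<lambda>n \<omega>. sqrt (real n) * R_stat H (G n \<omega>)))"
proof -
  note W = assms(1) and H = assms(2) and k = assms(4)
  note transfer = measure_random_graph_eq[OF W assms(6,7)]
  define s where "s = root_variance H W"
  have regular: "H_regular H W \<longleftrightarrow> s = 0"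
    unfolding s_def by (rule H_regular_iff_root_variance[OF W H]) (use k in simp)
  obtain C N where C: "0 \<le> C" and N: "0 < N"
    and approx: "\<And>G :: nat sgraph. finite (verts G) \<Longrightarrow> N \<le> card (verts G) \<Longrightarrow>
       \<bar>R_stat H G - var_on (verts G) (rooted_density H G)\<bar> \<le> C / real (card (verts G))"
    using R_stat_approx[OF H k, where 'v = nat] by blast
  have approx': "\<bar>R_stat H (sample_graph n W (fst \<omega>) (snd \<omega>)) - var_on {1..n} (sampled_density n W H \<omega>)\<bar> \<le> C / real n"
    if "N \<le> n" for n \<omega>
    using approx[of "sample_graph n W (fst \<omega>) (snd \<omega>)"] that
    by (simp add: verts_sample_graph sampled_density_def)
  have reg: "(\<lambda>n. measure (M n) {\<omega>\<in>space (M n). \<bar>sqrt (real n) * R_stat H (G n \<omega>) - 0\<bar> > \<epsilon>}) \<longlonglongrightarrow> 0"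
    if s: "s = 0" and \<epsilon>: "0 < \<epsilon>" for \<epsilon>
  proof (rule tendsto_sandwich[OF _ _ tendsto_const])
    define D where "D = (2 * (real (card (verts H)) * real (2 * card (verts H) - 1))\<^sup>2 + C) / \<epsilon>"
    show "eventually (\<lambda>n. measure (M n) {\<omega>\<in>space (M n). \<bar>sqrt (real n) * R_stat H (G n \<omega>) - 0\<bar> > \<epsilon>}
        \<le> D / sqrt (real n)) sequentially"
    proof (rule eventually_sequentiallyI)
      fix n assume n: "N \<le> n"
      then have "0 < n" using N by simp
      then show "measure (M n) {\<omega>\<in>space (M n). \<bar>sqrt (real n) * R_stat H (G n \<omega>) - 0\<bar> > \<epsilon>} \<le> D / sqrt (real n)"
        unfolding transfer[of n "\<lambda>g. \<bar>sqrt (real n) * R_stat H g - 0\<bar> > \<epsilon>"] D_def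
        by (intro prob_scaled_R_stat_regular[OF W H k] s[unfolded s_def] \<epsilon> C approx'[OF n])
    qed
    show "(\<lambda>n. D / sqrt (real n)) \<longlonglongrightarrow> 0"
      by real_asymp
  qed simp
  have irreg: "(\<lambda>n. measure (M n) {\<omega>\<in>space (M n). sqrt (real n) * R_stat H (G n \<omega>) > K}) \<longlonglongrightarrow> 1"
    if "s \<noteq> 0" for K
  proof -
    have s: "0 < s" using that root_variance_nonneg[of H W] by (simp add: s_def)
    define D where "D = ((real (card (verts H)) * real (2 * card (verts H) - 1))\<^sup>2
      + (2 * real (card (verts H)))\<^sup>2 + (2 * (real (card (verts H)))\<^sup>2)\<^sup>2) / min ((s / 4)\<^sup>2) (s / 16)"
    have "eventually (\<lambda>n. K < sqrt (real n) * (s / 16)) sequentially"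
      using s by real_asymp
    moreover have "eventually (\<lambda>n. 16 * C \<le> s * real n) sequentially"
      using s by real_asymp
    moreover have "eventually (\<lambda>n. N \<le> n) sequentially" by (rule eventually_ge_at_top)
    ultimately have "eventually (\<lambda>n. 1 - D / real n
        \<le> measure (M n) {\<omega>\<in>space (M n). sqrt (real n) * R_stat H (G n \<omega>) > K}) sequentially"
    proof eventually_elim
      case (elim n)
      then have n: "0 < n" using N by simp
      interpret M: prob_space "M n" by (rule assms(5))
      have "1 - D / real n \<le> measure (M n) {\<omega>\<in>space (M n). s / 16 \<le> R_stat H (G n \<omega>)}"
        unfolding transfer[of n "\<lambda>g. s / 16 \<le> R_stat H g"] unfolding D_def s_def
        by (rule prob_R_stat_bounded_below[OF W H k n s[unfolded s_def] C elim(2)[unfolded s_def] approx'[OF elim(3)]])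
      also have "\<dots> \<le> measure (M n) {\<omega>\<in>space (M n). sqrt (real n) * R_stat H (G n \<omega>) > K}"
      proof (rule M.finite_measure_mono)
        have "(\<lambda>\<omega>. R_stat H (G n \<omega>)) \<in> borel_measurable (M n)"
          by (rule measurable_compose[OF assms(6)]) simp
        then show "{\<omega>\<in>space (M n). sqrt (real n) * R_stat H (G n \<omega>) > K} \<in> sets (M n)" by measurable
        have "K < sqrt (real n) * R_stat H (G n \<omega>)" if "s / 16 \<le> R_stat H (G n \<omega>)" for \<omega>
          using elim(1) mult_left_mono[OF that, of "sqrt (real n)"] by simp
        then show "{\<omega>\<in>space (M n). s / 16 \<le> R_stat H (G n \<omega>)}
            \<subseteq> {\<omega>\<in>space (M n). sqrt (real n) * R_stat H (G n \<omega>) > K}" by blast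
      qed
      finally show ?case .
    qed
    moreover have "(\<lambda>n. 1 - D / real n) \<longlonglongrightarrow> 1" by real_asymp
    moreover have "eventually (\<lambda>n. measure (M n) {\<omega>\<in>space (M n). sqrt (real n) * R_stat H (G n \<omega>) > K} \<le> 1) sequentially"
      using prob_space.prob_le_1[OF assms(5)] by simp
    ultimately show ?thesis by (rule_tac tendsto_sandwich[OF _ _ _ tendsto_const])
  qed
  show ?thesis
    unfolding regular tendsto_in_prob_def tendsto_infinity_in_prob_def using reg irreg by blast
qed

end
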